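(* Let $\Omega\subset X$ be a nonempty open set. Then the trace spaces of $\mathrm{BV}(\Omega)$ and $N^{1,1}(\Omega)$ are the same; that is, if a Banach function space $\mathbb Z(\partial\Omega,\mathcal H)$ on $\partial\Omega$ is the trace space of $\mathrm{BV}(\Omega)$, then it is also the trace space of $N^{1,1}(\Omega)$, and vice versa.
   Context: Standing assumptions: $(X,d,\mu)$ is a complete metric space with a Borel regular outer measure $\mu$ that is doubling: there is $C_d\ge 1$ with $0<\mu(B(x,2r))\le C_d\,\mu(B(x,r))<\infty$ for all balls $B(x,r)=\{y\in X: d(x,y)<r\}$. $X$ supports a $(1,1)$-Poincaré inequality: there are $C_P>0$, $\lambda\ge 1$ such that for every ball $B(x,r)$, every $u\in L^1_{\mathrm{loc}}(X)$ and every upper gradient $g$ of $u$, $\frac{1}{\mu(B(x,r))}\int_{B(x,r)}|u-u_{B(x,r)}|\,d\mu\le C_P r\,\frac{1}{\mu(B(x,\lambda r))}\int_{B(x,\lambda r)}g\,d\mu$, where $u_B$ is the $\mu$-mean of $u$ over $B$. A curve is a rectifiable continuous map from a compact interval. A nonnegative Borel function $g$ is an upper gradient of $u$ if $|u(x)-u(y)|\le\int_\gamma g\,ds$ for all nonconstant curves $\gamma$ with end points $x,y$ (with $|u(x)-u(y)|:=\infty$ if $|u(x)|$ or $|u(y)|$ is infinite). A curve family $\Gamma$ has zero $1$-modulus if there is a nonnegative Borel $\rho\in L^1(X)$ with $\int_\gamma\rho\,ds=\infty$ for all $\gamma\in\Gamma$. A nonnegative $\mu$-measurable $g$ is a $1$-weak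 upper gradient of $u$ in $H\subset X$ if the upper gradient inequality holds for all curves in $H$ outside a family of zero $1$-modulus; $g_u$ denotes the minimal one. $\|u\|_{N^{1,1}(H)}:=\|u\|_{L^1(H)}+\inf\|g\|_{L^1(H)}$ (infimum over $1$-weak upper gradients of $u$ in $H$), $N^{1,1}(H)=\{u:\|u\|_{N^{1,1}(H)}<\infty\}$. $\Omega'\Subset\Omega$ means $\overline{\Omega'}$ is a compact subset of $\Omega$; local spaces consist of functions in the corresponding space on every open $\Omega'\Subset\Omega$. For $u\in L^1_{\mathrm{loc}}(\Omega)$, $\|Du\|(\Omega):=\inf\{\liminf_{i}\int_\Omega g_{u_i}\,d\mu:\ u_i\in N^{1,1}_{\mathrm{loc}}(\Omega),\ u_i\to u \text{ in } L^1_{\mathrm{loc}}(\Omega)\}$. $\mathrm{BV}(\Omega)$ is the set of $u\in L^1(\Omega)$ with $\|Du\|(\Omega)<\infty$, with norm $\|u\|_{\mathrm{BV}(\Omega)}=\|u\|_{L^1(\Omega)}+\|Du\|(\Omega)$. Codimension $1$ Hausdorff measure: $\mathcal H(A)=\lim_{R\to0^+}\mathcal H_R(A)$, where $\mathcal H_R(A)=\inf\{\sum_{j\in I}\mu(B(x_j,r_j))/r_j:\ A\subset\bigcup_{j\in I}B(x_j,r_j),\ r_j\le R,\ I\subset\mathbb N\}$. Trace: for a $\mu$-measurable function $u$ on $\Omega$ and $x\in\partial\Omega$, a number $Tu(x)$ is the trace of $u$ at $x$ if $\lim_{r\to0^+}\frac{1}{\mu(B(x,r)\cap\Omega)}\int_{B(x,r)\cap\Omega}|u-Tu(x)|\,d\mu=0$.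 The function $u$ has a trace $Tu$ in $\partial\Omega$ if $Tu(x)$ exists for $\mathcal H$-a.e. $x\in\partial\Omega$. Trace space: for a Banach function space $\mathbb X(\Omega)$ on $\Omega$, a Banach space $\mathbb Y(\partial\Omega,\mathcal H)$ of functions on $\partial\Omega$ is the trace space of $\mathbb X(\Omega)$ if every $u\in\mathbb X(\Omega)$ has a trace and the trace operator $u\mapsto Tu$ is a bounded linear surjective operator from $\mathbb X(\Omega)$ to $\mathbb Y(\partial\Omega,\mathcal H)$. *)

theory Defs
  imports "HOL-Analysis.Analysis"
begin

text \<open>
  Functions on a set \<open>H\<close> are represented by total functions whose values off \<open>H\<close> are never
  inspected. The functions \<open>u\<close> are extended real valued, (weak) upper gradients take
  values in \<open>[0, \<infinity>]\<close>.
\<close>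

section \<open>The measure\<close>

definition borel_regular_outer_measure :: "('a::topological_space set \<Rightarrow> ennreal) \<Rightarrow> bool" where
  "borel_regular_outer_measure \<mu> \<longleftrightarrow>
     outer_measure_space (Pow UNIV) \<mu> \<and>
     sets borel \<subseteq> lambda_system UNIV (Pow UNIV) \<mu> \<and>
     (\<forall>A. \<exists>B\<in>sets borel. A \<subseteq> B \<and> \<mu> B = \<mu> A)"

text \<open>The measure obtained by restricting \<open>\<mu>\<close> to its Caratheodory measurable sets.\<close>

definition caratheodory :: "('a set \<Rightarrow> ennreal) \<Rightarrow> 'a measure" where
  "caratheodory \<mu> = measure_of UNIV (lambda_system UNIV (Pow UNIV) \<mu>) \<mu>"

definition doubling :: "'a::metric_space measure \<Rightarrow> bool" where
  "doubling M \<longleftrightarrow> (\<exists>C\<ge>1. \<forall>x. \<forall>r>0.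
     0 < emeasure M (ball x (2 * r)) \<and>
     emeasure M (ball x (2 * r)) \<le> ennreal C * emeasure M (ball x r) \<and>
     ennreal C * emeasure M (ball x r) < \<infinity>)"

section \<open>Curves and line integrals\<close>

definition curve_length :: "(real \<Rightarrow> 'a::metric_space) \<Rightarrow> real \<Rightarrow> real \<Rightarrow> ennreal" where
  "curve_length \<gamma> a b =
     (SUP ts \<in> {ts. sorted ts \<and> set ts \<subseteq> {a..b}}.
        \<Sum>i<length ts - 1. ennreal (dist (\<gamma> (ts ! i)) (\<gamma> (ts ! Suc i))))"

text \<open>Curves are parametrized over \<open>[0, 1]\<close>, as usual for \<^const>\<open>path\<close>.\<close>

definition rectifiable_curve :: "(real \<Rightarrow> 'a::metric_space) \<Rightarrow> bool" where
  "rectifiable_curve \<gamma> \<longleftrightarrow> path \<gamma> \<and> curve_length \<gamma> 0 1 < \<infinity>"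

definition nonconstant_curve :: "(real \<Rightarrow> 'a) \<Rightarrow> bool" where
  "nonconstant_curve \<gamma> \<longleftrightarrow> (\<exists>s\<in>{0..1}. \<exists>t\<in>{0..1}. \<gamma> s \<noteq> \<gamma> t)"

text \<open>
  The arc length parametrization. The parameters \<open>t\<close> at which the arc length equals \<open>s\<close> form an
  interval on which the curve is constant, so the choice is irrelevant.
\<close>

definition arclength_param :: "(real \<Rightarrow> 'a::metric_space) \<Rightarrow> real \<Rightarrow> 'a" where
  "arclength_param \<gamma> s = \<gamma> (SOME t. t \<in> {0..1} \<and> curve_length \<gamma> 0 t = ennreal s)"

definition line_integral :: "(real \<Rightarrow> 'a::metric_space) \<Rightarrow> ('a \<Rightarrow> ennreal) \<Rightarrow> ennreal" where
  "line_integral \<gamma> g =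
     (\<integral>\<^sup>+s\<in>{0..enn2real (curve_length \<gamma> 0 1)}. g (arclength_param \<gamma> s) \<partial>lebesgue)"

definition zero_modulus :: "'a::metric_space measure \<Rightarrow> (real \<Rightarrow> 'a) set \<Rightarrow> bool" where
  "zero_modulus M \<Gamma> \<longleftrightarrow>
     (\<exists>\<rho>\<in>borel_measurable borel. (\<integral>\<^sup>+x. \<rho> x \<partial>M) < \<infinity> \<and> (\<forall>\<gamma>\<in>\<Gamma>. line_integral \<gamma> \<rho> = \<infinity>))"

section \<open>Upper gradients\<close>

definition abs_diff :: "ereal \<Rightarrow> ereal \<Rightarrow> ennreal" where
  "abs_diff a b = (if \<bar>a\<bar> = \<infinity> \<or> \<bar>b\<bar> = \<infinity> then \<infinity> else e2ennreal \<bar>a - b\<bar>)"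

definition upper_gradient :: "('a::metric_space \<Rightarrow> ereal) \<Rightarrow> ('a \<Rightarrow> ennreal) \<Rightarrow> bool" where
  "upper_gradient u g \<longleftrightarrow>
     g \<in> borel_measurable borel \<and>
     (\<forall>\<gamma>. rectifiable_curve \<gamma> \<and> nonconstant_curve \<gamma> \<longrightarrow>
        abs_diff (u (pathstart \<gamma>)) (u (pathfinish \<gamma>)) \<le> line_integral \<gamma> g)"

definition weak_upper_gradient ::
    "'a::metric_space measure \<Rightarrow> 'a set \<Rightarrow> ('a \<Rightarrow> ereal) \<Rightarrow> ('a \<Rightarrow> ennreal) \<Rightarrow> bool" where
  "weak_upper_gradient M H u g \<longleftrightarrow>
     g \<in> borel_measurable (restrict_space M H) \<and>
     (\<exists>\<Gamma>. zero_modulus M \<Gamma> \<and>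
        (\<forall>\<gamma>. rectifiable_curve \<gamma> \<and> nonconstant_curve \<gamma> \<and> path_image \<gamma> \<subseteq> H \<and> \<gamma> \<notin> \<Gamma> \<longrightarrow>
           abs_diff (u (pathstart \<gamma>)) (u (pathfinish \<gamma>)) \<le> line_integral \<gamma> g))"

section \<open>Function spaces on open sets\<close>

definition compactly_inside :: "'a::topological_space set \<Rightarrow> 'a set \<Rightarrow> bool" where
  "compactly_inside U \<Omega> \<longleftrightarrow> compact (closure U) \<and> closure U \<subseteq> \<Omega>"

definition L1_norm :: "'a measure \<Rightarrow> 'a set \<Rightarrow> ('a \<Rightarrow> ereal) \<Rightarrow> ennreal" where
  "L1_norm M H u = (\<integral>\<^sup>+x\<in>H. e2ennreal \<bar>u x\<bar> \<partial>M)"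

definition L1 :: "'a measure \<Rightarrow> 'a set \<Rightarrow> ('a \<Rightarrow> ereal) set" where
  "L1 M H = {u. u \<in> borel_measurable (restrict_space M H) \<and> L1_norm M H u < \<infinity>}"

definition L1_loc :: "'a::topological_space measure \<Rightarrow> 'a set \<Rightarrow> ('a \<Rightarrow> ereal) set" where
  "L1_loc M \<Omega> = {u. \<forall>U. open U \<and> compactly_inside U \<Omega> \<longrightarrow> u \<in> L1 M U}"

definition L1_loc_converges ::
    "'a::topological_space measure \<Rightarrow> 'a set \<Rightarrow> (nat \<Rightarrow> 'a \<Rightarrow> ereal) \<Rightarrow> ('a \<Rightarrow> ereal) \<Rightarrow> bool" where
  "L1_loc_converges M \<Omega> us u \<longleftrightarrow>
     (\<forall>U. open U \<and> compactly_inside U \<Omega> \<longrightarrow>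
        (\<lambda>i. L1_norm M U (\<lambda>x. us i x - u x)) \<longlonglongrightarrow> 0)"

definition N11_norm :: "'a::metric_space measure \<Rightarrow> 'a set \<Rightarrow> ('a \<Rightarrow> ereal) \<Rightarrow> ennreal" where
  "N11_norm M H u = L1_norm M H u + (INF g \<in> {g. weak_upper_gradient M H u g}. \<integral>\<^sup>+x\<in>H. g x \<partial>M)"

definition N11 :: "'a::metric_space measure \<Rightarrow> 'a set \<Rightarrow> ('a \<Rightarrow> ereal) set" where
  "N11 M H = {u. u \<in> borel_measurable (restrict_space M H) \<and> N11_norm M H u < \<infinity>}"

definition N11_loc :: "'a::metric_space measure \<Rightarrow> 'a set \<Rightarrow> ('a \<Rightarrow> ereal) set" where
  "N11_loc M \<Omega> = {u. \<forall>U. open U \<and> compactly_inside U \<Omega> \<longrightarrow> u \<in> N11 M U}"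

text \<open>
  Minimality refers to locally integrable competitors, as is standard: without integrability the
  pointwise minimum of two weak upper gradients need not be a weak upper gradient. The minimal one
  is unique up to null sets, and it exists for \<open>u \<in> N11_loc M \<Omega>\<close>.
\<close>

definition minimal_weak_upper_gradient ::
    "'a::metric_space measure \<Rightarrow> 'a set \<Rightarrow> ('a \<Rightarrow> ereal) \<Rightarrow> ('a \<Rightarrow> ennreal) \<Rightarrow> bool" where
  "minimal_weak_upper_gradient M \<Omega> u g \<longleftrightarrow>
     weak_upper_gradient M \<Omega> u g \<and> enn2ereal \<circ> g \<in> L1_loc M \<Omega> \<and>
     (\<forall>h. weak_upper_gradient M \<Omega> u h \<and> enn2ereal \<circ> h \<in> L1_loc M \<Omega> \<longrightarrow>
        (AE x in M. x \<in> \<Omega> \<longrightarrow> g x \<le> h x))"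

definition min_wug :: "'a::metric_space measure \<Rightarrow> 'a set \<Rightarrow> ('a \<Rightarrow> ereal) \<Rightarrow> 'a \<Rightarrow> ennreal" where
  "min_wug M \<Omega> u = (SOME g. minimal_weak_upper_gradient M \<Omega> u g)"

definition total_variation :: "'a::metric_space measure \<Rightarrow> 'a set \<Rightarrow> ('a \<Rightarrow> ereal) \<Rightarrow> ennreal" where
  "total_variation M \<Omega> u =
     (INF us \<in> {us. (\<forall>i. us i \<in> N11_loc M \<Omega>) \<and> L1_loc_converges M \<Omega> us u}.
        liminf (\<lambda>i. \<integral>\<^sup>+x\<in>\<Omega>. min_wug M \<Omega> (us i) x \<partial>M))"

definition BV_norm :: "'a::metric_space measure \<Rightarrow> 'a set \<Rightarrow> ('a \<Rightarrow> ereal) \<Rightarrow> ennreal" where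
  "BV_norm M \<Omega> u = L1_norm M \<Omega> u + total_variation M \<Omega> u"

definition BV :: "'a::metric_space measure \<Rightarrow> 'a set \<Rightarrow> ('a \<Rightarrow> ereal) set" where
  "BV M \<Omega> = {u \<in> L1 M \<Omega>. total_variation M \<Omega> u < \<infinity>}"

section \<open>Poincare inequality\<close>

text \<open>
  In a complete doubling space balls are relatively compact, so a locally integrable function is
  integrable on them, in particular finite almost everywhere; hence the detour through
  \<^const>\<open>real_of_ereal\<close> does not affect the mean value.
\<close>

definition mean :: "'a measure \<Rightarrow> 'a set \<Rightarrow> ('a \<Rightarrow> ereal) \<Rightarrow> real" where
  "mean M B u = (LINT x:B|M. real_of_ereal (u x)) / measure M B"

definition poincare_1_1 :: "'a::metric_space measure \<Rightarrow> bool" where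
  "poincare_1_1 M \<longleftrightarrow> (\<exists>C>0. \<exists>L\<ge>1. \<forall>x. \<forall>r>0. \<forall>u\<in>L1_loc M UNIV. \<forall>g. upper_gradient u g \<longrightarrow>
     (\<integral>\<^sup>+y\<in>ball x r. e2ennreal \<bar>u y - ereal (mean M (ball x r) u)\<bar> \<partial>M) / emeasure M (ball x r)
       \<le> ennreal (C * r) * ((\<integral>\<^sup>+y\<in>ball x (L * r). g y \<partial>M) / emeasure M (ball x (L * r))))"

section \<open>Codimension one Hausdorff measure\<close>

definition codim1_content :: "'a::metric_space measure \<Rightarrow> real \<Rightarrow> 'a set \<Rightarrow> ennreal" where
  "codim1_content M R A =
     (INF (I, x, r) \<in> {(I :: nat set, x, r).
           A \<subseteq> (\<Union>j\<in>I. ball (x j) (r j)) \<and> (\<forall>j\<in>I. 0 < r j \<and> r j \<le> R)}.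
        \<Sum>\<^sub>\<infinity>j\<in>I. emeasure M (ball (x j) (r j)) / ennreal (r j))"

definition codim1_hausdorff :: "'a::metric_space measure \<Rightarrow> 'a set \<Rightarrow> ennreal" where
  "codim1_hausdorff M A = Lim (at_right 0) (\<lambda>R. codim1_content M R A)"

definition hausdorff_ae :: "'a::metric_space measure \<Rightarrow> 'a set \<Rightarrow> ('a \<Rightarrow> bool) \<Rightarrow> bool" where
  "hausdorff_ae M S P \<longleftrightarrow> codim1_hausdorff M {x\<in>S. \<not> P x} = 0"

section \<open>Traces\<close>

definition is_trace_at ::
    "'a::metric_space measure \<Rightarrow> 'a set \<Rightarrow> ('a \<Rightarrow> ereal) \<Rightarrow> 'a \<Rightarrow> real \<Rightarrow> bool" where
  "is_trace_at M \<Omega> u x t \<longleftrightarrow>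
     ((\<lambda>r. (\<integral>\<^sup>+y\<in>ball x r \<inter> \<Omega>. e2ennreal \<bar>u y - ereal t\<bar> \<partial>M) / emeasure M (ball x r \<inter> \<Omega>))
        \<longlongrightarrow> 0) (at_right 0)"

definition has_trace :: "'a::metric_space measure \<Rightarrow> 'a set \<Rightarrow> ('a \<Rightarrow> ereal) \<Rightarrow> bool" where
  "has_trace M \<Omega> u \<longleftrightarrow>
     u \<in> borel_measurable (restrict_space M \<Omega>) \<and>
     hausdorff_ae M (frontier \<Omega>) (\<lambda>x. \<exists>t. is_trace_at M \<Omega> u x t)"

definition boundary_trace :: "'a::metric_space measure \<Rightarrow> 'a set \<Rightarrow> ('a \<Rightarrow> ereal) \<Rightarrow> 'a \<Rightarrow> real" where
  "boundary_trace M \<Omega> u x = (THE t. is_trace_at M \<Omega> u x t)"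

text \<open>
  A Banach space whose elements are real functions on \<open>S\<close> modulo equality almost everywhere with
  respect to the codimension one Hausdorff measure: \<open>Z\<close> is the saturated set of representatives and
  \<open>nZ\<close> the norm, read on representatives.
\<close>

definition banach_function_space ::
    "'a::metric_space measure \<Rightarrow> 'a set \<Rightarrow> ('a \<Rightarrow> real) set \<Rightarrow> (('a \<Rightarrow> real) \<Rightarrow> real) \<Rightarrow> bool" where
  "banach_function_space M S Z nZ \<longleftrightarrow>
     (\<lambda>x. 0) \<in> Z \<and>
     (\<forall>f\<in>Z. \<forall>g\<in>Z. (\<lambda>x. f x + g x) \<in> Z) \<and>
     (\<forall>c. \<forall>f\<in>Z. (\<lambda>x. c * f x) \<in> Z) \<and>
     (\<forall>f\<in>Z. \<forall>g. hausdorff_ae M S (\<lambda>x. f x = g x) \<longrightarrow> g \<in> Z \<and> nZ g = nZ f) \<and>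
     (\<forall>f\<in>Z. 0 \<le> nZ f) \<and>
     (\<forall>f\<in>Z. nZ f = 0 \<longleftrightarrow> hausdorff_ae M S (\<lambda>x. f x = 0)) \<and>
     (\<forall>f\<in>Z. \<forall>g\<in>Z. nZ (\<lambda>x. f x + g x) \<le> nZ f + nZ g) \<and>
     (\<forall>c. \<forall>f\<in>Z. nZ (\<lambda>x. c * f x) = \<bar>c\<bar> * nZ f) \<and>
     (\<forall>f :: nat \<Rightarrow> 'a \<Rightarrow> real. (\<forall>n. f n \<in> Z) \<and>
        (\<forall>e>0. \<exists>N. \<forall>m\<ge>N. \<forall>n\<ge>N. nZ (\<lambda>x. f m x - f n x) < e) \<longrightarrow>
        (\<exists>g\<in>Z. (\<lambda>n. nZ (\<lambda>x. f n x - g x)) \<longlonglongrightarrow> 0))"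

text \<open>
  \<open>V\<close> with norm \<open>nV\<close> is the function space on \<open>\<Omega>\<close>. Identities between elements of \<open>Z\<close> are
  identities almost everywhere on the boundary. Since elements of \<open>V\<close> are finite outside a null
  set, the value \<^const>\<open>ereal\<close> arithmetic gives to \<open>\<infinity> - \<infinity>\<close> does not affect the trace of a linear
  combination.
\<close>

definition is_trace_space ::
    "'a::metric_space measure \<Rightarrow> 'a set \<Rightarrow> ('a \<Rightarrow> ereal) set \<Rightarrow> (('a \<Rightarrow> ereal) \<Rightarrow> ennreal) \<Rightarrow>
     ('a \<Rightarrow> real) set \<Rightarrow> (('a \<Rightarrow> real) \<Rightarrow> real) \<Rightarrow> bool" where
  "is_trace_space M \<Omega> V nV Z nZ \<longleftrightarrow>
     banach_function_space M (frontier \<Omega>) Z nZ \<and>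
     (\<forall>u\<in>V. has_trace M \<Omega> u) \<and>
     (\<forall>u\<in>V. boundary_trace M \<Omega> u \<in> Z) \<and>
     (\<forall>u\<in>V. \<forall>v\<in>V. \<forall>a b. hausdorff_ae M (frontier \<Omega>)
        (\<lambda>x. boundary_trace M \<Omega> (\<lambda>y. ereal a * u y + ereal b * v y) x
              = a * boundary_trace M \<Omega> u x + b * boundary_trace M \<Omega> v x)) \<and>
     (\<exists>C\<ge>0. \<forall>u\<in>V. ennreal (nZ (boundary_trace M \<Omega> u)) \<le> ennreal C * nV u) \<and>
     (\<forall>f\<in>Z. \<exists>u\<in>V. hausdorff_ae M (frontier \<Omega>) (\<lambda>x. boundary_trace M \<Omega> u x = f x))"

end

theory Submission
  imports Defs
begin

text \<open>
  Every \<open>u\<close> in \<open>BV(\<Omega>)\<close> has a companion \<open>v\<close> in \<open>N\<^sup>1\<^sup>,\<^sup>1(\<Omega>)\<close> of comparable norm with the same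
  trace at every boundary point; together with \<open>N\<^sup>1\<^sup>,\<^sup>1(\<Omega>) \<subseteq> BV(\<Omega>)\<close> this identifies the trace spaces.
  To obtain \<open>v\<close>, take Newtonian functions with bounded energies converging to \<open>u\<close> in
  \<open>L\<^sup>1\<^sub>l\<^sub>o\<^sub>c(\<Omega>)\<close> and interpolate between members of this sequence along the layers of a compact
  exhaustion of \<open>\<Omega>\<close>. By Fatou's lemma the member used on a layer can be chosen such that the energies on the
  layers add up to at most a multiple of the total variation. It can also be chosen so far out that the
  \<open>L\<^sup>1\<close> distance of \<open>u\<close> and \<open>v\<close> on the layer is tiny compared with the measure of \<open>B \<inter> \<Omega>\<close> for every
  ball \<open>B\<close> centred at the boundary that reaches the layer; these measures are bounded below by
  compactness. Hence the averages of \<open>\<bar>u - v\<bar>\<close> over \<open>B \<inter> \<Omega>\<close> tend to zero at the boundary.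
\<close>

section \<open>Curve length\<close>

text \<open>The interpolant is the series
  \<open>f 0 + \<Sum>k. cutoff k * (f (Suc k) - f k)\<close>. A product with a
  \<open>2 ^ k\<close>-Lipschitz cutoff costs the gradients of both members plus
  \<open>2 ^ k * \<bar>f (Suc k) - f k\<bar>\<close>. This last term is harmless because the slope
  \<open>2 ^ k\<close> is known before the members are chosen, so their L1 distance to
  \<open>u\<close> can be made small against it. Only energies survive, with the factor 24 = 2 * 3 *
  4: a gradient enters at most twice, three members meet on a layer, and the sets on which energies
  are compared overlap at most four times. The obstacle is that curves see null sets: a weak upper
  gradient cannot be altered almost everywhere without care. Two devices deal with this. An
  exceptional curve family is replaced by one integrable Borel weight, and a measurable function by
  a Borel majorant that is larger everywhere and equal almost everywhere. Moreover
  \<open>min_wug\<close> is a choice term and says nothing until a minimal weak upper gradient on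
  all of \<Omega> is constructed from data given on compactly contained sets. Gluing, pointwise
  minima and decreasing limits along arcs serve this purpose.\<close>

abbreviation chord_sum :: "(real \<Rightarrow> 'a::metric_space) \<Rightarrow> real list \<Rightarrow> ennreal" where
  "chord_sum \<gamma> ts \<equiv> (\<Sum>i<length ts - 1. ennreal (dist (\<gamma> (ts ! i)) (\<gamma> (ts ! Suc i))))"

lemma chord_sum_Cons:
  "chord_sum \<gamma> (x # y # zs) = ennreal (dist (\<gamma> x) (\<gamma> y)) + chord_sum \<gamma> (y # zs)"
  by (simp add: sum.lessThan_Suc_shift del: sum.lessThan_Suc sum_ennreal)

lemma chord_sum_map: "chord_sum \<gamma> (map \<phi> ts) = chord_sum (\<lambda>t. \<gamma> (\<phi> t)) ts"
  by (intro sum.cong) auto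

lemma chord_sum_cong:
  assumes "\<And>t. t \<in> set ts \<Longrightarrow> \<gamma> t = \<gamma>' t" shows "chord_sum \<gamma> ts = chord_sum \<gamma>' ts"
  using assms by (intro sum.cong) auto

text \<open>The concatenated list has one extra chord, joining the last node of \<open>ts\<close> to
  the first of \<open>us\<close>; dropping it gives the inequality.\<close>

lemma chord_sum_append: "chord_sum \<gamma> ts + chord_sum \<gamma> us \<le> chord_sum \<gamma> (ts @ us)"
proof (induction ts rule: induct_list012)
  case (2 x)
  show ?case
    using chord_sum_Cons[of \<gamma> x] by (cases us) (simp_all del: sum.lessThan_Suc sum_ennreal)
next
  case (3 x y zs)
  then show ?case
    using chord_sum_Cons[of \<gamma> x y zs] chord_sum_Cons[of \<gamma> x y "zs @ us"]
    by (simp add: add.assoc add_left_mono del: sum.lessThan_Suc sum_ennreal)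
qed auto

lemma chord_sum_le_curve_length:
  "sorted ts \<Longrightarrow> set ts \<subseteq> {a..b} \<Longrightarrow> chord_sum \<gamma> ts \<le> curve_length \<gamma> a b"
  unfolding curve_length_def by (rule SUP_upper) simp

lemma curve_length_leI:
  "(\<And>ts. sorted ts \<Longrightarrow> set ts \<subseteq> {a..b} \<Longrightarrow> chord_sum \<gamma> ts \<le> y) \<Longrightarrow> curve_length \<gamma> a b \<le> y"
  unfolding curve_length_def by (rule SUP_least) simp

lemma dist_le_curve_length:
  assumes "a \<le> b" shows "ennreal (dist (\<gamma> a) (\<gamma> b)) \<le> curve_length \<gamma> a b"
  using chord_sum_le_curve_length[of "[a, b]" a b \<gamma>] assms by simp

lemma sorted_map_mono_on:
  "sorted ts \<Longrightarrow> mono_on S \<phi> \<Longrightarrow> set ts \<subseteq> S \<Longrightarrow> sorted (map \<phi> ts)"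
  by (induction ts) (auto simp: mono_on_def)

text \<open>A monotone map sends ordered nodes to ordered nodes. Only monotonicity enters, so this
  covers a right inverse of the arc length, which may jump.\<close>

lemma curve_length_comp_le:
  assumes "mono_on {a..b} \<phi>"
  shows "curve_length (\<lambda>t. \<gamma> (\<phi> t)) a b \<le> curve_length \<gamma> (\<phi> a) (\<phi> b)"
proof (rule curve_length_leI)
  fix ts assume ts: "sorted ts" "set ts \<subseteq> {a..b}"
  have "set (map \<phi> ts) \<subseteq> {\<phi> a..\<phi> b}"
    using ts assms by (fastforce simp: mono_on_def)
  then show "chord_sum (\<lambda>t. \<gamma> (\<phi> t)) ts \<le> curve_length \<gamma> (\<phi> a) (\<phi> b)"
    using chord_sum_le_curve_length[OF sorted_map_mono_on[OF ts(1) assms ts(2)]]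
    by (simp only: chord_sum_map)
qed

lemma curve_length_cong:
  assumes "\<And>t. t \<in> {a..b} \<Longrightarrow> \<gamma> t = \<gamma>' t"
  shows "curve_length \<gamma> a b = curve_length \<gamma>' a b"
  unfolding curve_length_def
  by (intro SUP_cong refl chord_sum_cong) (use assms in auto)

lemma curve_length_add:
  fixes \<gamma> :: "real \<Rightarrow> 'a::metric_space"
  assumes "a \<le> b" "b \<le> c"
  shows "curve_length \<gamma> a b + curve_length \<gamma> b c = curve_length \<gamma> a c"
proof (rule antisym)
  let ?A = "{ts. sorted ts \<and> set ts \<subseteq> {a..b}}" and ?B = "{ts. sorted ts \<and> set ts \<subseteq> {b..c}}"
  \<comment> \<open>Suprema in \<open>ennreal\<close> commute with adding a constant over nonempty
    index sets; the empty list of nodes is always available.\<close>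
  have ne: "?A \<noteq> {}" "?B \<noteq> {}" by (auto intro: exI[of _ "[]"])
  have "chord_sum \<gamma> ts + chord_sum \<gamma> us \<le> curve_length \<gamma> a c" if "ts \<in> ?A" "us \<in> ?B" for ts us
  proof -
    have "sorted (ts @ us)" using that by (fastforce simp: sorted_append)
    moreover have "set (ts @ us) \<subseteq> {a..c}" using that assms by fastforce
    ultimately show ?thesis
      using chord_sum_le_curve_length chord_sum_append order_trans by blast
  qed
  then have "chord_sum \<gamma> ts + curve_length \<gamma> b c \<le> curve_length \<gamma> a c" if "ts \<in> ?A" for ts
    unfolding curve_length_def[of \<gamma> b c] using ne that
    by (subst ennreal_SUP_add_right) (auto intro!: SUP_least)
  then show "curve_length \<gamma> a b + curve_length \<gamma> b c \<le> curve_length \<gamma> a c"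
    unfolding curve_length_def[of \<gamma> a b] using ne
    by (subst ennreal_SUP_add_left[symmetric]) (auto intro!: SUP_least)
next
  show "curve_length \<gamma> a c \<le> curve_length \<gamma> a b + curve_length \<gamma> b c"
  proof (rule curve_length_leI)
    fix ts assume ts: "sorted ts" "set ts \<subseteq> {a..c}"
    \<comment> \<open>Clamping all nodes at \<open>b\<close> from above and from below replaces
      inserting \<open>b\<close> as a node. A chord across \<open>b\<close> is split by the triangle
      inequality; any other chord reappears in one of the two sums.\<close>
    have *: "chord_sum \<gamma> ts \<le> chord_sum (\<lambda>t. \<gamma> (min t b)) ts + chord_sum (\<lambda>t. \<gamma> (max t b)) ts"
      unfolding sum.distrib[symmetric]
    proof (rule sum_mono)
      fix i assume i: "i \<in> {..<length ts - 1}"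
      have le: "ts ! i \<le> ts ! Suc i" using ts(1) i by (auto simp: sorted_iff_nth_mono)
      show "ennreal (dist (\<gamma> (ts ! i)) (\<gamma> (ts ! Suc i)))
        \<le> ennreal (dist (\<gamma> (min (ts ! i) b)) (\<gamma> (min (ts ! Suc i) b)))
         + ennreal (dist (\<gamma> (max (ts ! i) b)) (\<gamma> (max (ts ! Suc i) b)))"
        using le dist_triangle[of "\<gamma> (ts ! i)" "\<gamma> (ts ! Suc i)" "\<gamma> b"]
        by (cases "ts ! i \<le> b"; cases "ts ! Suc i \<le> b")
           (auto simp: min_def max_def simp flip: ennreal_plus intro!: ennreal_leI)
    qed
    have 1: "chord_sum (\<lambda>t. \<gamma> (min t b)) ts \<le> curve_length \<gamma> a b"
      unfolding chord_sum_map[of \<gamma> "\<lambda>t. min t b", symmetric]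
      by (rule chord_sum_le_curve_length)
         (use ts assms in \<open>auto intro!: sorted_map_mono_on[of _ UNIV] mono_onI\<close>)
    have 2: "chord_sum (\<lambda>t. \<gamma> (max t b)) ts \<le> curve_length \<gamma> b c"
      unfolding chord_sum_map[of \<gamma> "\<lambda>t. max t b", symmetric]
      by (rule chord_sum_le_curve_length)
         (use ts assms in \<open>auto intro!: sorted_map_mono_on[of _ UNIV] mono_onI\<close>)
    show "chord_sum \<gamma> ts \<le> curve_length \<gamma> a b + curve_length \<gamma> b c"
      using * add_mono[OF 1 2] by (rule order_trans)
  qed
qed

lemma curve_length_mono:
  assumes "a' \<le> a" "b \<le> b'" shows "curve_length \<gamma> a b \<le> curve_length \<gamma> a' b'"
  by (rule curve_length_leI, rule chord_sum_le_curve_length) (use assms in auto)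

lemma curve_length_const [simp]: "curve_length (\<lambda>_. x) a b = 0"
  by (rule antisym[OF curve_length_leI]) auto

lemma curve_length_refl [simp]: "curve_length \<gamma> a a = 0"
proof -
  have "curve_length \<gamma> a a = curve_length (\<lambda>_. \<gamma> a) a a" by (rule curve_length_cong) simp
  then show ?thesis by simp
qed

text \<open>
  The length is lower semicontinuous: clamping the nodes of a near-optimal partition to a slightly
  smaller interval changes the chord sum only a little.
\<close>

lemma curve_length_gt_clamp:
  fixes \<gamma> :: "real \<Rightarrow> 'a::metric_space"
  assumes cont: "continuous_on {a..b} \<gamma>" and p: "p \<in> T" and y: "y < curve_length \<gamma> a b"
    and \<phi>: "\<And>x. x \<in> {a..b} \<Longrightarrow> continuous_on T (\<lambda>t. \<phi> t x)"
      "\<And>x. x \<in> {a..b} \<Longrightarrow> \<phi> p x = x" "\<And>t. mono (\<phi> t)"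
      "\<And>t x. t \<in> T \<Longrightarrow> x \<in> {a..b} \<Longrightarrow> \<phi> t x \<in> {l t..r t} \<inter> {a..b}"
  shows "\<forall>\<^sub>F t in at p within T. y < curve_length \<gamma> (l t) (r t)"
proof -
  obtain ts where ts: "sorted ts" "set ts \<subseteq> {a..b}" and yts: "y < chord_sum \<gamma> ts"
    using y unfolding curve_length_def less_SUP_iff by auto
  have "((\<lambda>t. chord_sum (\<lambda>x. \<gamma> (\<phi> t x)) ts) \<longlongrightarrow> chord_sum (\<lambda>x. \<gamma> (\<phi> p x)) ts) (at p within T)"
  proof (intro tendsto_sum tendsto_ennrealI tendsto_dist)
    have *: "((\<lambda>t. \<gamma> (\<phi> t x)) \<longlongrightarrow> \<gamma> (\<phi> p x)) (at p within T)" if "x \<in> {a..b}" for x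
    proof -
      have "continuous_on T (\<lambda>t. \<gamma> (\<phi> t x))"
        by (rule continuous_on_compose2[OF cont \<phi>(1)[OF that]]) (use that \<phi>(4) in auto)
      then show ?thesis using p unfolding continuous_on_def by auto
    qed
    fix i assume i: "i \<in> {..<length ts - 1}"
    then have "ts ! i \<in> {a..b}" "ts ! Suc i \<in> {a..b}"
      using ts(2) nth_mem[of i ts] nth_mem[of "Suc i" ts] by fastforce+
    then show "((\<lambda>t. \<gamma> (\<phi> t (ts ! i))) \<longlongrightarrow> \<gamma> (\<phi> p (ts ! i))) (at p within T)"
      "((\<lambda>t. \<gamma> (\<phi> t (ts ! Suc i))) \<longlongrightarrow> \<gamma> (\<phi> p (ts ! Suc i))) (at p within T)"
      by (auto intro!: *)
  qed
  moreover have "chord_sum (\<lambda>x. \<gamma> (\<phi> p x)) ts = chord_sum \<gamma> ts"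
    using ts(2) \<phi>(2) by (intro chord_sum_cong) (auto simp: subset_iff)
  ultimately have "\<forall>\<^sub>F t in at p within T. y < chord_sum (\<lambda>x. \<gamma> (\<phi> t x)) ts"
    using yts by (auto intro: order_tendstoD)
  moreover have "\<forall>\<^sub>F t in at p within T. t \<in> T" by (simp add: eventually_at_filter)
  ultimately show ?thesis
  proof eventually_elim
    case (elim t)
    have "chord_sum \<gamma> (map (\<phi> t) ts) \<le> curve_length \<gamma> (l t) (r t)"
    proof (rule chord_sum_le_curve_length)
      show "sorted (map (\<phi> t) ts)"
        by (rule sorted_map_mono_on[OF ts(1), of UNIV]) (use \<phi>(3) in auto)
      show "set (map (\<phi> t) ts) \<subseteq> {l t..r t}"
        using \<phi>(4)[OF elim(2)] ts(2) by (auto simp: subset_iff)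
    qed
    with elim(1) show ?case unfolding chord_sum_map by (rule less_le_trans)
  qed
qed

text \<open>Lower semicontinuity is applied twice: to the length from \<open>a\<close> to
  \<open>t\<close>, and to the remaining length from \<open>t\<close> to \<open>b\<close>. Since
  both add up to a finite constant, the second bound is upper semicontinuity of the first
  length.\<close>

lemma continuous_on_curve_length:
  fixes \<gamma> :: "real \<Rightarrow> 'a::metric_space"
  assumes cont: "continuous_on {a..b} \<gamma>" and fin: "curve_length \<gamma> a b < \<infinity>"
  shows "continuous_on {a..b} (\<lambda>t. enn2real (curve_length \<gamma> a t))"
  unfolding continuous_on_def
proof
  fix p assume p: "p \<in> {a..b}"
  let ?F = "at p within {a..b}"
  have fin': "curve_length \<gamma> s t < \<infinity>" if "s \<in> {a..b}" "t \<in> {a..b}" for s t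
    using curve_length_mono[of a s t b \<gamma>] that fin by (auto intro: le_less_trans)
  define S where "S s t = enn2real (curve_length \<gamma> s t)" for s t
  have S: "curve_length \<gamma> s t = ennreal (S s t)" "0 \<le> S s t" if "s \<in> {a..b}" "t \<in> {a..b}" for s t
    using fin'[OF that] by (auto simp: S_def)
  have add: "S a t + S t b = S a b" if "t \<in> {a..b}" for t
    using curve_length_add[of a t b \<gamma>] that fin'[of a t] fin'[of t b]
      enn2real_plus[of "curve_length \<gamma> a t" "curve_length \<gamma> t b"] by (simp add: S_def)
  have ab: "a \<in> {a..b}" "b \<in> {a..b}" using p by auto
  have inF: "\<forall>\<^sub>F t in ?F. t \<in> {a..b}" by (simp add: eventually_at_filter)
  \<comment> \<open>\<open>ennreal\<close> maps negative reals to 0, so strict bounds are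
    transported for \<open>0 \<le> y\<close>; below 0 the nonnegativity of \<open>f\<close>
    suffices.\<close>
  have lower: "\<forall>\<^sub>F t in ?F. y < f t"
    if "\<And>t. t \<in> {a..b} \<Longrightarrow> 0 \<le> f t" "0 \<le> y \<Longrightarrow> \<forall>\<^sub>F t in ?F. ennreal y < ennreal (f t)" for y and f :: "real \<Rightarrow> real"
  proof (cases "0 \<le> y")
    case True
    show ?thesis using that(2)[OF True] inF by eventually_elim (use that(1) True in \<open>auto simp: ennreal_less_iff\<close>)
  next
    case False
    show ?thesis using inF by (rule eventually_mono) (use that(1) False in fastforce)
  qed
  show "((\<lambda>t. enn2real (curve_length \<gamma> a t)) \<longlongrightarrow> enn2real (curve_length \<gamma> a p)) ?F"
    unfolding S_def[symmetric]
  proof (rule order_tendstoI)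
    fix y assume y: "y < S a p"
    show "\<forall>\<^sub>F t in ?F. y < S a t"
    proof (rule lower)
      assume "0 \<le> y"
      have "\<forall>\<^sub>F t in ?F. ennreal y < curve_length \<gamma> a t"
      proof (rule curve_length_gt_clamp[where \<phi> = "\<lambda>t x. min x t" and l = "\<lambda>_. a" and r = "\<lambda>t. t"])
        show "continuous_on {a..p} \<gamma>" using cont by (rule continuous_on_subset) (use p in auto)
        show "ennreal y < curve_length \<gamma> a p" using y S[OF ab(1) p] \<open>0 \<le> y\<close> by (simp add: ennreal_lessI)
      qed (use p in \<open>auto intro!: continuous_intros monoI\<close>)
      then show "\<forall>\<^sub>F t in ?F. ennreal y < ennreal (S a t)"
        using inF by eventually_elim (use S(1)[OF ab(1)] in simp)
    qed (use S(2) ab in auto)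
  next
    fix y assume y: "S a p < y"
    have "\<forall>\<^sub>F t in ?F. S a b - y < S t b"
    proof (rule lower)
      assume "0 \<le> S a b - y"
      have "\<forall>\<^sub>F t in ?F. ennreal (S a b - y) < curve_length \<gamma> t b"
      proof (rule curve_length_gt_clamp[where \<phi> = "\<lambda>t x. max x t" and l = "\<lambda>t. t" and r = "\<lambda>_. b"])
        show "continuous_on {p..b} \<gamma>" using cont by (rule continuous_on_subset) (use p in auto)
        show "ennreal (S a b - y) < curve_length \<gamma> p b"
          using y add[OF p] S[OF p ab(2)] \<open>0 \<le> S a b - y\<close> by (simp add: ennreal_lessI)
      qed (use p in \<open>auto intro!: continuous_intros monoI\<close>)
      then show "\<forall>\<^sub>F t in ?F. ennreal (S a b - y) < ennreal (S t b)"
        using inF by eventually_elim (use S(1)[OF _ ab(2)] in simp)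
    qed (use S(2) ab in auto)
    then show "\<forall>\<^sub>F t in ?F. S a t < y" using inF by eventually_elim (use add in fastforce)
  qed
qed

section \<open>Arc length parametrization\<close>

text \<open>Prescribing the length of every subarc makes the property pass to subarcs by translation
  and implies that the arc is 1-Lipschitz. The condition \<open>0 < L\<close> encodes
  nonconstancy.\<close>

definition unit_speed :: "(real \<Rightarrow> 'a::metric_space) \<Rightarrow> real \<Rightarrow> bool" where
  "unit_speed c L \<longleftrightarrow> 0 < L \<and>
     (\<forall>a b. 0 \<le> a \<and> a \<le> b \<and> b \<le> L \<longrightarrow> curve_length c a b = ennreal (b - a))"

lemma unit_speedD:
  assumes "unit_speed c L"
  shows "0 < L" "\<lbrakk>0 \<le> a; a \<le> b; b \<le> L\<rbrakk> \<Longrightarrow> curve_length c a b = ennreal (b - a)"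
  using assms by (auto simp: unit_speed_def)

lemma curve_length_affine:
  fixes k d :: real
  assumes "0 < k"
  shows "curve_length (\<lambda>t. \<gamma> (k * t + d)) p q = curve_length \<gamma> (k * p + d) (k * q + d)"
proof (rule antisym)
  show "curve_length (\<lambda>t. \<gamma> (k * t + d)) p q \<le> curve_length \<gamma> (k * p + d) (k * q + d)"
    by (rule curve_length_comp_le) (use assms in \<open>auto intro!: mono_onI\<close>)
  have "curve_length (\<lambda>t. \<gamma> (k * ((t - d) / k) + d)) (k * p + d) (k * q + d)
    \<le> curve_length (\<lambda>t. \<gamma> (k * t + d)) ((k * p + d - d) / k) ((k * q + d - d) / k)"
    by (rule curve_length_comp_le[of _ _ "\<lambda>t. (t - d) / k"])
       (use assms in \<open>auto intro!: mono_onI divide_right_mono diff_right_mono\<close>)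
  then show "curve_length \<gamma> (k * p + d) (k * q + d) \<le> curve_length (\<lambda>t. \<gamma> (k * t + d)) p q"
    using assms by simp
qed

lemma unit_speed_sub:
  assumes "unit_speed c L" "0 \<le> a" "a < b" "b \<le> L"
  shows "unit_speed (\<lambda>s. c (a + s)) (b - a)"
  unfolding unit_speed_def
proof (intro conjI allI impI)
  fix p q assume pq: "0 \<le> p \<and> p \<le> q \<and> q \<le> b - a"
  have "curve_length (\<lambda>s. c (a + s)) p q = curve_length c (p + a) (q + a)"
    using curve_length_affine[of 1 c a p q] by (simp only: mult_1 add.commute[of _ a])
  then show "curve_length (\<lambda>s. c (a + s)) p q = ennreal (q - p)"
    using unit_speedD(2)[OF assms(1), of "p + a" "q + a"] pq assms by auto
qed (use assms in auto)

lemma unit_speed_dist_le: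
  assumes "unit_speed c L" "s \<in> {0..L}" "t \<in> {0..L}"
  shows "dist (c s) (c t) \<le> \<bar>s - t\<bar>"
proof -
  have *: "dist (c s) (c t) \<le> t - s" if "s \<le> t" "s \<in> {0..L}" "t \<in> {0..L}" for s t
    using dist_le_curve_length[of s t c] unit_speedD(2)[OF assms(1), of s t] that
    by (auto simp: ennreal_le_iff)
  show ?thesis using *[of s t] *[of t s] assms by (cases "s \<le> t") (auto simp: dist_commute)
qed

lemma unit_speed_continuous_on:
  assumes "unit_speed c L" shows "continuous_on {0..L} c"
  by (rule lipschitz_on_continuous_on[of 1], rule lipschitz_onI)
     (use unit_speed_dist_le[OF assms] in \<open>auto simp: dist_real_def\<close>)

text \<open>Rescaling to the unit interval turns an arc into an admissible curve. Its length up to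
  \<open>t\<close> is \<open>L * t\<close>, which is injective in \<open>t\<close>, so the choice in
  \<open>arclength_param\<close> is forced and returns the arc itself.\<close>

lemma curve_of_unit_speed:
  assumes c: "unit_speed c L"
  defines "\<gamma> \<equiv> \<lambda>t. c (L * t)"
  shows "rectifiable_curve \<gamma>" "nonconstant_curve \<gamma>" "pathstart \<gamma> = c 0" "pathfinish \<gamma> = c L"
    "path_image \<gamma> = c ` {0..L}"
    "line_integral \<gamma> g = (\<integral>\<^sup>+s\<in>{0..L}. g (c s) \<partial>lebesgue)"
proof -
  have L: "0 < L" using unit_speedD[OF c] by simp
  have len: "curve_length \<gamma> p q = ennreal (L * q - L * p)" if "0 \<le> p" "p \<le> q" "q \<le> 1" for p q
    using curve_length_affine[of L c 0 p q] unit_speedD(2)[OF c, of "L * p" "L * q"] that L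
    by (simp add: \<gamma>_def)
  have image: "(\<lambda>t. L * t) ` {0..1} = {0..L}"
    using L by (simp add: image_mult_atLeastAtMost)
  have "continuous_on {0..1} \<gamma>"
    unfolding \<gamma>_def
    by (rule continuous_on_compose2[OF unit_speed_continuous_on[OF c]])
       (simp_all only: image order_refl continuous_on_mult_const)
  then show rc: "rectifiable_curve \<gamma>"
    unfolding rectifiable_curve_def path_def using len[of 0 1] by simp
  show "pathstart \<gamma> = c 0" "pathfinish \<gamma> = c L" by (simp_all add: \<gamma>_def pathstart_def pathfinish_def)
  have "path_image \<gamma> = c ` ((\<lambda>t. L * t) ` {0..1})" by (simp only: path_image_def \<gamma>_def image_image)
  then show "path_image \<gamma> = c ` {0..L}" by (simp only: image)
  show "nonconstant_curve \<gamma>"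
  proof (rule ccontr)
    assume "\<not> nonconstant_curve \<gamma>"
    then have eq: "\<gamma> t = \<gamma> 0" if "t \<in> {0..1}" for t
      using that unfolding nonconstant_curve_def by (metis atLeastAtMost_iff order_refl zero_le_one)
    have "curve_length \<gamma> 0 1 = curve_length (\<lambda>_. \<gamma> 0) 0 1" by (rule curve_length_cong) (rule eq)
    also have "\<dots> = 0" by simp
    finally show False using len[of 0 1] L by simp
  qed
  have "arclength_param \<gamma> s = c s" if s: "s \<in> {0..L}" for s
  proof -
    have "t \<in> {0..1} \<and> curve_length \<gamma> 0 t = ennreal s \<longleftrightarrow> t = s / L" for t
    proof
      assume t: "t \<in> {0..1} \<and> curve_length \<gamma> 0 t = ennreal s"
      then have "L * t = s" using len[of 0 t] s L by simp
      then show "t = s / L" using L by (simp add: eq_divide_eq mult.commute)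
    next
      assume t: "t = s / L"
      then have "t \<in> {0..1}" "L * t = s" using s L by auto
      then show "t \<in> {0..1} \<and> curve_length \<gamma> 0 t = ennreal s" using len[of 0 t] by simp
    qed
    then show ?thesis using L unfolding arclength_param_def by (simp add: \<gamma>_def)
  qed
  then show "line_integral \<gamma> g = (\<integral>\<^sup>+s\<in>{0..L}. g (c s) \<partial>lebesgue)"
    unfolding line_integral_def using len[of 0 1] L
    by (auto intro!: nn_integral_cong simp: indicator_def)
qed

text \<open>The arc length \<open>S\<close> is continuous and maps onto \<open>{0..L}\<close>,
  \<open>\<tau>\<close> is a right inverse of it, and \<gamma> is constant wherever \<open>S\<close>
  is. Hence \<open>c\<close> is \<gamma> composed with \<open>\<tau>\<close>, and \<gamma> is
  \<open>c\<close> composed with \<open>S\<close>. Monotone reparametrization bounds the length of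
  \<open>c\<close> from above by the first identity and from below by the second.\<close>

lemma unit_speed_of_curve:
  assumes \<gamma>: "rectifiable_curve \<gamma>" "nonconstant_curve \<gamma>"
  defines "c \<equiv> arclength_param \<gamma>" and "L \<equiv> enn2real (curve_length \<gamma> 0 1)"
  shows "unit_speed c L" "c 0 = pathstart \<gamma>" "c L = pathfinish \<gamma>" "c ` {0..L} \<subseteq> path_image \<gamma>"
proof -
  have cont: "continuous_on {0..1} \<gamma>" and fin: "curve_length \<gamma> 0 1 < \<infinity>"
    using \<gamma>(1) by (auto simp: rectifiable_curve_def path_def)
  define S where "S t = enn2real (curve_length \<gamma> 0 t)" for t
  have S: "curve_length \<gamma> 0 t = ennreal (S t)" "0 \<le> S t" if "t \<in> {0..1}" for t
    using curve_length_mono[of 0 0 t 1 \<gamma>] that fin by (auto simp: S_def intro: le_less_trans)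
  have len: "curve_length \<gamma> p q = ennreal (S q - S p)" "S p \<le> S q" if "0 \<le> p" "p \<le> q" "q \<le> 1" for p q
  proof -
    have add: "ennreal (S p) + curve_length \<gamma> p q = ennreal (S q)"
      using curve_length_add[of 0 p q \<gamma>] S[of p] S[of q] that by simp
    then have "curve_length \<gamma> p q \<noteq> \<infinity>" by auto
    then obtain d where d: "0 \<le> d" "curve_length \<gamma> p q = ennreal d"
      by (cases "curve_length \<gamma> p q") auto
    with add S[of p] S[of q] that have "S p + d = S q" by (simp flip: ennreal_plus)
    with d show "curve_length \<gamma> p q = ennreal (S q - S p)" "S p \<le> S q" by auto
  qed
  have S0: "S 0 = 0" and SL: "S 1 = L" by (simp_all add: S_def L_def)
  have "\<exists>t. t \<in> {0..1} \<and> S t = s" if "s \<in> {0..L}" for s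
    using IVT'[of S 0 s 1] that S0 SL continuous_on_curve_length[OF cont fin]
    by (auto simp: S_def[abs_def])
  moreover define \<tau> where "\<tau> s = (SOME t. t \<in> {0..1} \<and> curve_length \<gamma> 0 t = ennreal s)" for s
  ultimately have \<tau>: "\<tau> s \<in> {0..1} \<and> S (\<tau> s) = s" if "s \<in> {0..L}" for s
  proof -
    obtain t where "t \<in> {0..1} \<and> curve_length \<gamma> 0 t = ennreal s"
      using \<open>s \<in> {0..L} \<Longrightarrow> \<exists>t. t \<in> {0..1} \<and> S t = s\<close> \<open>s \<in> {0..L}\<close> S by blast
    then have "\<tau> s \<in> {0..1} \<and> curve_length \<gamma> 0 (\<tau> s) = ennreal s"
      unfolding \<tau>_def by (rule someI)
    then show ?thesis using that by (simp add: S_def)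
  qed
  have c\<tau>: "c s = \<gamma> (\<tau> s)" for s by (simp add: c_def arclength_param_def \<tau>_def)
  have S_range: "S t \<in> {0..L}" if "t \<in> {0..1}" for t
    using len(2)[of 0 t] len(2)[of t 1] that S0 SL by auto
  have eq_le: "\<gamma> p = \<gamma> q" if "p \<in> {0..1}" "q \<in> {0..1}" "S p = S q" "p \<le> q" for p q
  proof -
    have "ennreal (dist (\<gamma> p) (\<gamma> q)) \<le> ennreal 0"
      using dist_le_curve_length[OF that(4), of \<gamma>] len(1)[of p q] that by simp
    then show ?thesis by simp
  qed
  have eq: "\<gamma> p = \<gamma> q" if "p \<in> {0..1}" "q \<in> {0..1}" "S p = S q" for p q
    using eq_le[of p q] eq_le[of q p] that by fastforce
  have cS: "c (S t) = \<gamma> t" if "t \<in> {0..1}" for t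
    unfolding c\<tau> by (rule eq) (use \<tau>[OF S_range[OF that]] that in auto)
  show "c 0 = pathstart \<gamma>" "c L = pathfinish \<gamma>"
    using cS[of 0] cS[of 1] unfolding S0 SL pathstart_def pathfinish_def by simp_all
  show "c ` {0..L} \<subseteq> path_image \<gamma>" using \<tau> unfolding path_image_def c\<tau> by auto
  have mono\<tau>: "mono_on {0..L} \<tau>"
  proof (rule mono_onI)
    fix r s assume rs: "r \<in> {0..L}" "s \<in> {0..L}" "r \<le> s"
    show "\<tau> r \<le> \<tau> s"
    proof (cases "r = s")
      case False
      show ?thesis
      proof (rule ccontr)
        assume "\<not> \<tau> r \<le> \<tau> s"
        then show False using len(2)[of "\<tau> s" "\<tau> r"] \<tau> rs False by fastforce
      qed
    qed simp
  qed
  have monoS: "mono_on {0..1} S" by (rule mono_onI) (use len(2) in auto)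
  have cl: "curve_length c a b = ennreal (b - a)" if ab: "0 \<le> a" "a \<le> b" "b \<le> L" for a b
  proof (rule antisym)
    have "curve_length c a b = curve_length (\<lambda>s. \<gamma> (\<tau> s)) a b" by (simp add: c\<tau>[abs_def])
    also have "\<dots> \<le> curve_length \<gamma> (\<tau> a) (\<tau> b)"
      by (rule curve_length_comp_le, rule mono_on_subset[OF mono\<tau>]) (use ab in auto)
    also have "\<dots> = ennreal (b - a)"
      using len(1)[of "\<tau> a" "\<tau> b"] \<tau>[of a] \<tau>[of b] ab mono_onD[OF mono\<tau>, of a b] by auto
    finally show "curve_length c a b \<le> ennreal (b - a)" .
    have "ennreal (b - a) = curve_length \<gamma> (\<tau> a) (\<tau> b)"
      using len(1)[of "\<tau> a" "\<tau> b"] \<tau>[of a] \<tau>[of b] ab mono_onD[OF mono\<tau>, of a b] by auto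
    also have "\<dots> = curve_length (\<lambda>t. c (S t)) (\<tau> a) (\<tau> b)"
      by (rule curve_length_cong, rule cS[symmetric]) (use \<tau>[of a] \<tau>[of b] ab in auto)
    also have "\<dots> \<le> curve_length c (S (\<tau> a)) (S (\<tau> b))"
      by (rule curve_length_comp_le, rule mono_on_subset[OF monoS]) (use \<tau>[of a] \<tau>[of b] ab in auto)
    also have "\<dots> = curve_length c a b" using \<tau>[of a] \<tau>[of b] ab by simp
    finally show "ennreal (b - a) \<le> curve_length c a b" .
  qed
  have "0 < L"
  proof (rule ccontr)
    assume "\<not> 0 < L"
    then have S_zero: "S t = 0" if "t \<in> {0..1}" for t using S_range[OF that] by auto
    have "\<gamma> s = \<gamma> t" if "s \<in> {0..1}" "t \<in> {0..1}" for s t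
      by (rule eq) (use S_zero that in auto)
    then show False using \<gamma>(2) unfolding nonconstant_curve_def by blast
  qed
  then show "unit_speed c L" unfolding unit_speed_def using cl by auto
qed

text \<open>The arc is continuous only on \<open>{0..L}\<close>; clamping the parameter to this
  interval gives a globally continuous, hence Borel, map with the same values on
  \<open>{a..b}\<close>.\<close>

lemma unit_speed_measurable:
  fixes g :: "'a::metric_space \<Rightarrow> ennreal"
  assumes c: "unit_speed c L" and g: "g \<in> borel_measurable borel" and ab: "0 \<le> a" "b \<le> L"
  shows "(\<lambda>s. g (c s) * indicator {a..b} s) \<in> borel_measurable borel"
proof -
  have "continuous_on UNIV (\<lambda>s. c (max 0 (min L s)))"
    by (rule continuous_on_compose2[OF unit_speed_continuous_on[OF c]])
       (use unit_speedD(1)[OF c] in \<open>auto intro!: continuous_intros\<close>)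
  then have [measurable]: "(\<lambda>s. c (max 0 (min L s))) \<in> borel_measurable borel"
    by (rule borel_measurable_continuous_onI)
  note g[measurable]
  have "(\<lambda>s. g (c (max 0 (min L s))) * indicator {a..b} s) \<in> borel_measurable borel"
    by measurable
  also have "(\<lambda>s. g (c (max 0 (min L s))) * indicator {a..b} s) = (\<lambda>s. g (c s) * indicator {a..b} s)"
    using ab by (intro ext) (auto simp: indicator_def max_absorb2 min_absorb2)
  finally show ?thesis .
qed

text \<open>Using \<open>lborel\<close> instead of \<open>lebesgue\<close> leaves the value
  unchanged, as nonnegative integrals do not change under completion, and gives access to affine
  substitution. The explicit endpoints allow work with subarcs without reparametrizing.\<close>

definition arc_integral :: "(real \<Rightarrow> 'a) \<Rightarrow> real \<Rightarrow> real \<Rightarrow> ('a \<Rightarrow> ennreal) \<Rightarrow> ennreal" where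
  "arc_integral c a b g = (\<integral>\<^sup>+s\<in>{a..b}. g (c s) \<partial>lborel)"

lemma lebesgue_eq_arc_integral: "(\<integral>\<^sup>+s\<in>{0..L}. g (c s) \<partial>lebesgue) = arc_integral c 0 L g"
  unfolding arc_integral_def by (rule nn_integral_completion)

lemma arc_integral_shift:
  fixes g :: "'a::metric_space \<Rightarrow> ennreal"
  assumes c: "unit_speed c L" and g: "g \<in> borel_measurable borel" and ab: "0 \<le> a" "a \<le> b" "b \<le> L"
  shows "arc_integral (\<lambda>s. c (a + s)) 0 (b - a) g = arc_integral c a b g"
proof -
  have "arc_integral c a b g = (\<integral>\<^sup>+s. g (c (a + 1 * s)) * indicator {a..b} (a + 1 * s) \<partial>lborel)"
    unfolding arc_integral_def using unit_speed_measurable[OF c g ab(1,3)]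
    by (subst nn_integral_real_affine[where c = 1 and t = a]) auto
  also have "\<dots> = arc_integral (\<lambda>s. c (a + s)) 0 (b - a) g"
    unfolding arc_integral_def by (intro nn_integral_cong) (auto simp: indicator_def)
  finally show ?thesis ..
qed

section \<open>Local-to-global principles along arcs\<close>

lemma abs_diff_ereal [simp]: "abs_diff (ereal a) (ereal b) = ennreal \<bar>a - b\<bar>"
  by (simp add: abs_diff_def)

text \<open>The convention that the difference is infinite as soon as one value is infinite makes
  this hold without exceptions: an infinite middle value makes the right side infinite.\<close>

lemma abs_diff_triangle: "abs_diff a c \<le> abs_diff a b + abs_diff b c"
  by (cases a; cases b; cases c) (auto simp: abs_diff_def simp flip: ennreal_plus intro!: ennreal_leI)

lemma interval_integral_add_le:
  fixes k :: "real \<Rightarrow> ennreal"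
  assumes k: "(\<lambda>s. k s * indicator {a..c} s) \<in> borel_measurable borel" and "a \<le> b" "b \<le> c"
  shows "(\<integral>\<^sup>+s\<in>{a..b}. k s \<partial>lborel) + (\<integral>\<^sup>+s\<in>{b..c}. k s \<partial>lborel) \<le> (\<integral>\<^sup>+s\<in>{a..c}. k s \<partial>lborel)"
proof -
  have *: "(\<lambda>s. k s * indicator I s) \<in> borel_measurable borel" if "I \<subseteq> {a..c}" "I \<in> sets borel" for I
  proof -
    note k[measurable] that(2)[measurable]
    have "(\<lambda>s. k s * indicator {a..c} s * indicator I s) \<in> borel_measurable borel" by measurable
    also have "(\<lambda>s. k s * indicator {a..c} s * indicator I s) = (\<lambda>s. k s * indicator I s)"
      using that(1) by (intro ext) (auto simp: indicator_def)
    finally show ?thesis .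
  qed
  have [measurable]: "(\<lambda>s. k s * indicator {a..b} s) \<in> borel_measurable borel"
    "(\<lambda>s. k s * indicator {b..c} s) \<in> borel_measurable borel"
    by (rule *; use assms in auto)+
  have "(\<integral>\<^sup>+s\<in>{a..b}. k s \<partial>lborel) + (\<integral>\<^sup>+s\<in>{b..c}. k s \<partial>lborel)
    = (\<integral>\<^sup>+s. k s * indicator {a..b} s + k s * indicator {b..c} s \<partial>lborel)"
    by (subst nn_integral_add) auto
  also have "\<dots> \<le> (\<integral>\<^sup>+s\<in>{a..c}. k s \<partial>lborel)"
    using AE_lborel_singleton[of b] assms(2,3)
    by (intro nn_integral_mono_AE) (auto elim!: eventually_mono simp: indicator_def)
  finally show ?thesis .
qed

text \<open>Pieces of length \<delta>\<open>/2\<close> are peeled off at the right end and summed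
  with the triangle inequality. Taking half of \<delta> keeps each piece strictly shorter than
  \<delta>.\<close>

lemma abs_diff_le_integral_if_local:
  fixes f :: "real \<Rightarrow> ereal" and k :: "real \<Rightarrow> ennreal"
  assumes k: "(\<lambda>s. k s * indicator {0..L} s) \<in> borel_measurable borel" and \<delta>: "0 < \<delta>" and L: "0 < L"
    and local: "\<And>a b. 0 \<le> a \<Longrightarrow> a < b \<Longrightarrow> b \<le> L \<Longrightarrow> b - a < \<delta> \<Longrightarrow>
      abs_diff (f a) (f b) \<le> (\<integral>\<^sup>+s\<in>{a..b}. k s \<partial>lborel)"
  shows "abs_diff (f 0) (f L) \<le> (\<integral>\<^sup>+s\<in>{0..L}. k s \<partial>lborel)"
proof -
  define \<eta> where "\<eta> = \<delta> / 2"
  have \<eta>: "0 < \<eta>" "\<eta> < \<delta>" using \<delta> by (auto simp: \<eta>_def)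
  have step: "abs_diff (f 0) (f b) \<le> (\<integral>\<^sup>+s\<in>{0..b}. k s \<partial>lborel)"
    if "0 < b" "b \<le> L" "b \<le> real n * \<eta>" for b n
    using that
  proof (induction n arbitrary: b)
    case (Suc n)
    show ?case
    proof (cases "b \<le> \<eta>")
      case True
      then show ?thesis using local[of 0 b] Suc.prems \<eta> by auto
    next
      case False
      define a where "a = b - \<eta>"
      have a: "0 < a" "a < b" "b - a < \<delta>" "a \<le> real n * \<eta>"
        using False \<eta> Suc.prems by (auto simp: a_def algebra_simps)
      have "abs_diff (f 0) (f b) \<le> abs_diff (f 0) (f a) + abs_diff (f a) (f b)"
        by (rule abs_diff_triangle)
      also have "\<dots> \<le> (\<integral>\<^sup>+s\<in>{0..a}. k s \<partial>lborel) + (\<integral>\<^sup>+s\<in>{a..b}. k s \<partial>lborel)"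
        by (intro add_mono Suc.IH local) (use a Suc.prems in auto)
      also have "\<dots> \<le> (\<integral>\<^sup>+s\<in>{0..b}. k s \<partial>lborel)"
      proof (rule interval_integral_add_le)
        have "(\<lambda>s. k s * indicator {0..L} s * indicator {0..b} s) \<in> borel_measurable borel"
          using k by measurable
        also have "(\<lambda>s. k s * indicator {0..L} s * indicator {0..b} s) = (\<lambda>s. k s * indicator {0..b} s)"
          using Suc.prems by (auto simp: indicator_def)
        finally show "(\<lambda>s. k s * indicator {0..b} s) \<in> borel_measurable borel" .
      qed (use a in auto)
      finally show ?thesis .
    qed
  qed simp
  obtain n where "L \<le> real n * \<eta>" using reals_Archimedean3[OF \<eta>(1)] less_imp_le by blast
  then show ?thesis using step L by blast
qed

text \<open>
  With \<open>E = {h\<^sub>1 \<le> h\<^sub>2}\<close> one uses \<open>h\<^sub>1\<close> on an open set slightly larger than \<open>E\<close> and \<open>h\<^sub>2\<close> off a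
  compact set slightly smaller than \<open>E\<close>; every short interval sees one of the two bounds only.
\<close>

lemma abs_diff_le_integral_min:
  fixes f :: "real \<Rightarrow> ereal" and h1 h2 :: "real \<Rightarrow> ennreal"
  assumes [measurable]: "h1 \<in> borel_measurable borel" "h2 \<in> borel_measurable borel"
    and fin: "(\<integral>\<^sup>+s. h1 s \<partial>lborel) < \<infinity>" "(\<integral>\<^sup>+s. h2 s \<partial>lborel) < \<infinity>" and L: "0 < L"
    and bound: "\<And>a b. 0 \<le> a \<Longrightarrow> a < b \<Longrightarrow> b \<le> L \<Longrightarrow> abs_diff (f a) (f b) \<le> (\<integral>\<^sup>+s\<in>{a..b}. h1 s \<partial>lborel)"
      "\<And>a b. 0 \<le> a \<Longrightarrow> a < b \<Longrightarrow> b \<le> L \<Longrightarrow> abs_diff (f a) (f b) \<le> (\<integral>\<^sup>+s\<in>{a..b}. h2 s \<partial>lborel)"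
  shows "abs_diff (f 0) (f L) \<le> (\<integral>\<^sup>+s. min (h1 s) (h2 s) \<partial>lborel)"
proof (rule ennreal_le_epsilon)
  fix e :: real assume e: "0 < e"
  define N1 where "N1 = density lborel h1"
  define N2 where "N2 = density lborel h2"
  define E where "E = {s. h1 s \<le> h2 s}"
  have E [measurable]: "E \<in> sets borel" unfolding E_def by measurable
  have N_sets: "sets N1 = sets borel" "sets N2 = sets borel" by (auto simp: N1_def N2_def)
  have em: "emeasure N1 A = (\<integral>\<^sup>+s. h1 s * indicator A s \<partial>lborel)"
    "emeasure N2 A = (\<integral>\<^sup>+s. h2 s * indicator A s \<partial>lborel)" if "A \<in> sets borel" for A
    using that by (auto simp: N1_def N2_def emeasure_density)
  have N_fin: "emeasure N1 A < \<infinity>" "emeasure N2 A < \<infinity>" if "A \<in> sets borel" for A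
    unfolding em[OF that]
    by (rule le_less_trans[OF nn_integral_mono fin(1)], simp add: indicator_def,
        rule le_less_trans[OF nn_integral_mono fin(2)], simp add: indicator_def)
  \<comment> \<open>Both densities define finite Borel measures on the line, so \<open>E\<close> can
    be approximated from outside in the \<open>h1\<close> measure and from inside in the
    \<open>h2\<close> measure.\<close>
  have "emeasure N1 E = (INF U \<in> {U. E \<subseteq> U \<and> open U}. emeasure N1 U)"
    by (rule outer_regular) (use N_sets N_fin[of UNIV] in \<open>auto simp: N1_def\<close>)
  moreover have "emeasure N1 E < emeasure N1 E + ennreal (e / 2)"
    using N_fin(1)[OF E] e by (cases "emeasure N1 E") (auto simp flip: ennreal_plus intro!: ennreal_lessI)
  ultimately obtain U where U: "E \<subseteq> U" "open U" "emeasure N1 U < emeasure N1 E + ennreal (e / 2)"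
    by (auto simp: INF_less_iff)
  have SUP: "emeasure N2 E = (SUP K \<in> {K. K \<subseteq> E \<and> compact K}. emeasure N2 K)"
    by (rule inner_regular) (use N_sets N_fin[of UNIV] in \<open>auto simp: N2_def\<close>)
  \<comment> \<open>A strict lower approximation exists only if \<open>E\<close> has positive
    \<open>h2\<close> measure; otherwise the empty set serves.\<close>
  obtain K where K: "K \<subseteq> E" "compact K" "emeasure N2 E \<le> emeasure N2 K + ennreal (e / 2)"
  proof (cases "emeasure N2 E = 0")
    case True then show ?thesis using that[of "{}"] by auto
  next
    case False
    then have "emeasure N2 E - ennreal (e / 2) < emeasure N2 E"
      using N_fin(2)[OF E] e by (intro ennreal_between) (auto simp: zero_less_iff_neq_zero)
    also note SUP
    finally obtain K where K: "K \<subseteq> E" "compact K" "emeasure N2 E - ennreal (e / 2) < emeasure N2 K"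
      by (auto simp: less_SUP_iff)
    then have "emeasure N2 E \<le> emeasure N2 K + ennreal (e / 2)"
      using less_imp_le[OF K(3)] by (simp add: ennreal_minus_le_iff add.commute)
    then show ?thesis using that K(1,2) by blast
  qed
  have [measurable]: "U \<in> sets borel" "K \<in> sets borel" 
    using U(2) K(2) by (auto intro: borel_closed compact_imp_closed)
  have "emeasure N2 (- K) = emeasure N2 (- E) + emeasure N2 (E - K)"
    using K(1) by (subst plus_emeasure) (auto simp: N_sets intro!: arg_cong[where f = "emeasure N2"])
  also have "emeasure N2 (E - K) = emeasure N2 E - emeasure N2 K"
    using K(1) N_fin(2)[of K] by (subst emeasure_Diff) (auto simp: N_sets)
  also have "\<dots> \<le> ennreal (e / 2)"
    using K(3) N_fin(2)[of K] by (auto simp: ennreal_minus_le_iff)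
  finally have NK: "emeasure N2 (- K) \<le> emeasure N2 (- E) + ennreal (e / 2)"
    by (simp add: add_left_mono)
  \<comment> \<open>A Lebesgue number for the cover \<open>{U}\<close> of \<open>K\<close>: an
    interval shorter than \<delta> that meets \<open>K\<close> lies in \<open>U\<close>.\<close>
  obtain \<delta> where \<delta>: "0 < \<delta>" "\<And>x. x \<in> K \<Longrightarrow> ball x \<delta> \<subseteq> U"
    using Heine_Borel_lemma[OF K(2), of "{U}"] K(1) U(1,2) by auto
  \<comment> \<open>On \<open>U - K\<close> both functions are counted, but the total integral
    exceeds that of the minimum by at most the two regularity errors.\<close>
  define k where "k s = h1 s * indicator U s + h2 s * indicator (- K) s" for s
  have [measurable]: "k \<in> borel_measurable borel" unfolding k_def by measurable
  have "abs_diff (f 0) (f L) \<le> (\<integral>\<^sup>+s\<in>{0..L}. k s \<partial>lborel)"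
  proof (rule abs_diff_le_integral_if_local[OF _ \<delta>(1) L])
    fix a b assume ab: "0 \<le> a" "a < b" "b \<le> L" "b - a < \<delta>"
    show "abs_diff (f a) (f b) \<le> (\<integral>\<^sup>+s\<in>{a..b}. k s \<partial>lborel)"
    proof (cases "{a..b} \<inter> K = {}")
      case True
      have "(\<integral>\<^sup>+s\<in>{a..b}. h2 s \<partial>lborel) \<le> (\<integral>\<^sup>+s\<in>{a..b}. k s \<partial>lborel)"
        using True by (intro nn_integral_mono) (auto simp: k_def indicator_def)
      then show ?thesis using bound(2)[OF ab(1-3)] by (rule order_trans[rotated])
    next
      case False
      then obtain x where "x \<in> K" "x \<in> {a..b}" by blast
      then have "{a..b} \<subseteq> U" using \<delta>(2)[of x] ab by (auto simp: dist_real_def subset_iff)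
      then have "(\<integral>\<^sup>+s\<in>{a..b}. h1 s \<partial>lborel) \<le> (\<integral>\<^sup>+s\<in>{a..b}. k s \<partial>lborel)"
        by (intro nn_integral_mono) (auto simp: k_def indicator_def)
      then show ?thesis using bound(1)[OF ab(1-3)] by (rule order_trans[rotated])
    qed
  qed measurable
  also have "\<dots> \<le> (\<integral>\<^sup>+s. k s \<partial>lborel)"
    by (intro nn_integral_mono) (auto simp: indicator_def)
  also have "\<dots> = emeasure N1 U + emeasure N2 (- K)"
    unfolding k_def by (subst nn_integral_add) (auto simp: em)
  also have "\<dots> \<le> (emeasure N1 E + ennreal (e / 2)) + (emeasure N2 (- E) + ennreal (e / 2))"
    using U(3) NK by (intro add_mono) auto
  also have "\<dots> = (emeasure N1 E + emeasure N2 (- E)) + ennreal e"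
    using e by (simp add: ac_simps flip: ennreal_plus)
  also have "emeasure N1 E + emeasure N2 (- E) = (\<integral>\<^sup>+s. h1 s * indicator E s + h2 s * indicator (- E) s \<partial>lborel)"
    by (subst nn_integral_add) (auto simp: em)
  also have "\<dots> = (\<integral>\<^sup>+s. min (h1 s) (h2 s) \<partial>lborel)"
    by (intro nn_integral_cong) (auto simp: E_def indicator_def min_def)
  finally show "abs_diff (f 0) (f L) \<le> (\<integral>\<^sup>+s. min (h1 s) (h2 s) \<partial>lborel) + ennreal e" .
qed

section \<open>Weak upper gradients along unit speed arcs\<close>

text \<open>The weights \<open>(1/2) ^ Suc k / (1 + s k)\<close> work. They let countably many
  finite quantities be merged into one finite quantity without losing any of them, since every
  weight is positive.\<close>

lemma ex_summable_weights:
  fixes s :: "nat \<Rightarrow> ennreal"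
  assumes fin: "\<And>k. s k < \<infinity>"
  obtains w where "\<And>k. 0 < w k" "\<And>k. w k < \<infinity>" "(\<Sum>k. w k * s k) < \<infinity>"
proof -
  define w where "w k = ennreal ((1/2) ^ Suc k / (1 + enn2real (s k)))" for k
  have w: "0 < w k" "w k < \<infinity>" for k
    by (auto simp: w_def intro!: divide_pos_pos add_pos_nonneg)
  have wi: "w k * s k \<le> ennreal ((1/2) ^ Suc k)" for k
  proof -
    obtain r where r: "0 \<le> r" "s k = ennreal r"
      using fin[of k] by (cases "s k") auto
    have "(1/2) ^ Suc k / (1 + r) * r \<le> (1/2) ^ Suc k"
      using r(1) by (simp add: divide_le_eq mult_left_mono)
    then show ?thesis using r by (simp add: w_def ennreal_mult[symmetric] ennreal_leI del: power_Suc)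
  qed
  have "(\<Sum>k. w k * s k) \<le> (\<Sum>k. ennreal ((1/2) ^ Suc k))" by (intro suminf_le wi) auto
  also have "\<dots> = ennreal 1" by (rule suminf_ennreal_eq[OF _ power_half_series]) simp
  finally have "(\<Sum>k. w k * s k) < \<infinity>" by (auto intro: le_less_trans)
  with w show ?thesis by (rule that)
qed

text \<open>The measurable sets may form a larger class than the Borel sets, as Caratheodory
  measurable sets do. \<open>borel_hull\<close> is what remains of Borel regularity; it makes the
  passage from measurable functions to Borel ones possible.\<close>

locale metric_measure =
  fixes M :: "'a::complete_space measure"
  assumes space_M: "space M = UNIV"
    and borel_sets: "sets borel \<subseteq> sets M"
    and borel_hull: "A \<in> sets M \<Longrightarrow> \<exists>B\<in>sets borel. A \<subseteq> B \<and> emeasure M B = emeasure M A"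
    and doubling: "doubling M"
begin

lemma borel_measurable_M:
  assumes "f \<in> borel_measurable borel" shows "f \<in> borel_measurable M"
  using assms borel_sets by (auto simp: measurable_def space_M)

lemma open_sets_M: "open A \<Longrightarrow> A \<in> sets M"
  using borel_sets by auto

lemma borel_measurable_restrict:
  "f \<in> borel_measurable borel \<Longrightarrow> f \<in> borel_measurable (restrict_space M H)"
  by (intro measurable_restrict_space1 borel_measurable_M)

text \<open>A weight stands for the family of arcs on which its integral is infinite, which is the
  general form of a family of zero modulus up to inclusion.\<close>

definition arc_weight :: "('a \<Rightarrow> ennreal) \<Rightarrow> bool" where
  "arc_weight \<rho> \<longleftrightarrow> \<rho> \<in> borel_measurable borel \<and> (\<integral>\<^sup>+x. \<rho> x \<partial>M) < \<infinity>"

text \<open>The upper gradient inequality is stated for all good subarcs. Finiteness of the integral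
  of \<rho> is inherited by subarcs, so a good arc may be subdivided freely; an abstract exceptional
  family would not offer this.\<close>

definition bounds_arcs :: "('a \<Rightarrow> ennreal) \<Rightarrow> 'a set \<Rightarrow> ('a \<Rightarrow> ereal) \<Rightarrow> ('a \<Rightarrow> ennreal) \<Rightarrow> bool" where
  "bounds_arcs \<rho> H u g \<longleftrightarrow> (\<forall>c L a b. unit_speed c L \<longrightarrow> 0 \<le> a \<longrightarrow> a < b \<longrightarrow> b \<le> L \<longrightarrow>
     c ` {a..b} \<subseteq> H \<longrightarrow> arc_integral c a b \<rho> < \<infinity> \<longrightarrow>
     abs_diff (u (c a)) (u (c b)) \<le> arc_integral c a b g)"

lemma arc_weight_measurable [measurable_dest]: "arc_weight \<rho> \<Longrightarrow> \<rho> \<in> borel_measurable borel"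
  by (simp add: arc_weight_def)

lemma arc_weight_add:
  assumes "arc_weight \<rho>" "arc_weight \<sigma>" shows "arc_weight (\<lambda>x. \<rho> x + \<sigma> x)"
  using assms unfolding arc_weight_def by (auto simp: nn_integral_add borel_measurable_M)

lemma bounds_arcsD:
  "\<lbrakk>bounds_arcs \<rho> H u g; unit_speed c L; 0 \<le> a; a < b; b \<le> L; c ` {a..b} \<subseteq> H; arc_integral c a b \<rho> < \<infinity>\<rbrakk>
    \<Longrightarrow> abs_diff (u (c a)) (u (c b)) \<le> arc_integral c a b g"
  unfolding bounds_arcs_def by blast

text \<open>The weight witnessing zero modulus replaces the exceptional family: a subarc with finite
  \<rho>-integral, rescaled to a curve, cannot belong to that family.\<close>

lemma weak_upper_gradientE:
  fixes g :: "'a \<Rightarrow> ennreal"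
  assumes wug: "weak_upper_gradient M H u g" and g: "g \<in> borel_measurable borel"
  obtains \<rho> where "arc_weight \<rho>" "bounds_arcs \<rho> H u g"
proof -
  obtain \<Gamma> \<rho> where \<rho>: "\<rho> \<in> borel_measurable borel" "(\<integral>\<^sup>+x. \<rho> x \<partial>M) < \<infinity>" "\<forall>\<gamma>\<in>\<Gamma>. line_integral \<gamma> \<rho> = \<infinity>"
    and \<Gamma>: "\<And>\<gamma>. rectifiable_curve \<gamma> \<Longrightarrow> nonconstant_curve \<gamma> \<Longrightarrow> path_image \<gamma> \<subseteq> H \<Longrightarrow> \<gamma> \<notin> \<Gamma> \<Longrightarrow>
       abs_diff (u (pathstart \<gamma>)) (u (pathfinish \<gamma>)) \<le> line_integral \<gamma> g"
    using wug unfolding weak_upper_gradient_def zero_modulus_def by blast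
  have "bounds_arcs \<rho> H u g"
    unfolding bounds_arcs_def
  proof (intro allI impI)
    fix c L a b assume c: "unit_speed c L" and ab: "0 \<le> a" "a < b" "b \<le> L"
      and H: "c ` {a..b} \<subseteq> H" and fin: "arc_integral c a b \<rho> < \<infinity>"
    define c' where "c' = (\<lambda>s. c (a + s))"
    have c': "unit_speed c' (b - a)" unfolding c'_def by (rule unit_speed_sub[OF c ab])
    have int: "line_integral (\<lambda>t. c' ((b - a) * t)) h = arc_integral c a b h"
      if "h \<in> borel_measurable borel" for h :: "'a \<Rightarrow> ennreal"
      using curve_of_unit_speed(6)[OF c', of h] lebesgue_eq_arc_integral[of h c' "b - a"]
        arc_integral_shift[OF c that, of a b] ab by (simp add: c'_def)
    have "c' ` {0..b - a} \<subseteq> H" using H by (auto simp: c'_def)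
    moreover have "(\<lambda>t. c' ((b - a) * t)) \<notin> \<Gamma>" using \<rho>(3) int[OF \<rho>(1)] fin by force
    ultimately show "abs_diff (u (c a)) (u (c b)) \<le> arc_integral c a b g"
      using \<Gamma>[OF curve_of_unit_speed(1,2)[OF c']] curve_of_unit_speed(3-5)[OF c'] int[OF g]
      by (simp add: c'_def)
  qed
  moreover have "arc_weight \<rho>" using \<rho>(1,2) by (simp add: arc_weight_def)
  ultimately show ?thesis using that by blast
qed

text \<open>All curves with infinite \<rho>-integral are declared exceptional. Curves on which
  \<open>g\<close> has infinite integral satisfy the inequality trivially, which is why finiteness
  may be assumed in \<open>bound\<close>.\<close>

lemma weak_upper_gradientI:
  fixes g :: "'a \<Rightarrow> ennreal"
  assumes g: "g \<in> borel_measurable borel"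
    and \<rho>: "arc_weight \<rho>"
    and bound: "\<And>c L. unit_speed c L \<Longrightarrow> c ` {0..L} \<subseteq> H \<Longrightarrow> arc_integral c 0 L \<rho> < \<infinity> \<Longrightarrow>
       arc_integral c 0 L g < \<infinity> \<Longrightarrow> abs_diff (u (c 0)) (u (c L)) \<le> arc_integral c 0 L g"
  shows "weak_upper_gradient M H u g"
  unfolding weak_upper_gradient_def
proof (intro conjI exI allI impI)
  show "g \<in> borel_measurable (restrict_space M H)" by (rule borel_measurable_restrict[OF g])
  show "zero_modulus M {\<gamma>. line_integral \<gamma> \<rho> = \<infinity>}" 
    using \<rho> by (auto simp: zero_modulus_def arc_weight_def)
  fix \<gamma> assume \<gamma>: "rectifiable_curve \<gamma> \<and> nonconstant_curve \<gamma> \<and> path_image \<gamma> \<subseteq> H \<and> \<gamma> \<notin> {\<gamma>. line_integral \<gamma> \<rho> = \<infinity>}"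
  define c where "c = arclength_param \<gamma>"
  define L where "L = enn2real (curve_length \<gamma> 0 1)"
  have c: "unit_speed c L" "c 0 = pathstart \<gamma>" "c L = pathfinish \<gamma>" "c ` {0..L} \<subseteq> path_image \<gamma>"
    unfolding c_def L_def by (rule unit_speed_of_curve; use \<gamma> in blast)+
  have int: "line_integral \<gamma> h = arc_integral c 0 L h" if "h \<in> borel_measurable borel" for h :: "'a \<Rightarrow> ennreal"
    unfolding line_integral_def c_def[symmetric] L_def[symmetric]
    by (rule lebesgue_eq_arc_integral)
  show "abs_diff (u (pathstart \<gamma>)) (u (pathfinish \<gamma>)) \<le> line_integral \<gamma> g"
  proof (cases "arc_integral c 0 L g < \<infinity>")
    case True
    then show ?thesis using bound[OF c(1)] c \<gamma> int[OF g] int[OF arc_weight_measurable[OF \<rho>]] by (auto simp: less_top)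
  next
    case False
    then show ?thesis using int[OF g] by (simp add: less_top[symmetric])
  qed
qed

text \<open>A countable union of families of zero modulus has zero modulus: \<sigma> is a weighted
  sum of the given weights, and positivity of each coefficient recovers finiteness of each summand
  along the arc and its subarcs.\<close>

lemma countable_modulus:
  fixes \<rho> :: "nat \<Rightarrow> 'a \<Rightarrow> ennreal"
  assumes "\<And>k. arc_weight (\<rho> k)"
  obtains \<sigma> where "arc_weight \<sigma>"
    "\<And>c L a b k. unit_speed c L \<Longrightarrow> 0 \<le> a \<Longrightarrow> a < b \<Longrightarrow> b \<le> L \<Longrightarrow> arc_integral c 0 L \<sigma> < \<infinity> \<Longrightarrow>
       arc_integral c a b (\<rho> k) < \<infinity>"
proof -
  have [measurable]: "\<rho> k \<in> borel_measurable borel" and fin: "(\<integral>\<^sup>+x. \<rho> k x \<partial>M) < \<infinity>" for k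
    using assms[of k] by (auto simp: arc_weight_def)
  obtain w where w: "\<And>k. 0 < w k" "\<And>k. w k < \<infinity>" "(\<Sum>k. w k * (\<integral>\<^sup>+x. \<rho> k x \<partial>M)) < \<infinity>"
    using ex_summable_weights[where s = "\<lambda>k. \<integral>\<^sup>+x. \<rho> k x \<partial>M", OF fin] by metis
  define \<sigma> where "\<sigma> x = (\<Sum>k. w k * \<rho> k x)" for x
  have [measurable]: "\<sigma> \<in> borel_measurable borel" unfolding \<sigma>_def by measurable
  have "(\<integral>\<^sup>+x. \<sigma> x \<partial>M) = (\<Sum>k. w k * (\<integral>\<^sup>+x. \<rho> k x \<partial>M))"
    unfolding \<sigma>_def
    by (subst nn_integral_suminf) (auto intro!: suminf_cong nn_integral_cmult borel_measurable_M)
  also note w(3)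
  finally have "arc_weight \<sigma>" by (simp add: arc_weight_def)
  moreover have "arc_integral c a b (\<rho> k) < \<infinity>"
    if c: "unit_speed c L" and ab: "0 \<le> a" "a < b" "b \<le> L" and f: "arc_integral c 0 L \<sigma> < \<infinity>" for c L a b k
  proof -
    have "w k * arc_integral c a b (\<rho> k) \<le> w k * (\<integral>\<^sup>+s. \<rho> k (c s) * indicator {0..L} s \<partial>lborel)"
      unfolding arc_integral_def using ab by (intro mult_left_mono nn_integral_mono) (auto simp: indicator_def)
    also have "\<dots> = (\<integral>\<^sup>+s. w k * (\<rho> k (c s) * indicator {0..L} s) \<partial>lborel)"
      using unit_speed_measurable[OF c, of "\<rho> k" 0 L] by (subst nn_integral_cmult) auto
    also have "\<dots> \<le> arc_integral c 0 L \<sigma>"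
      unfolding arc_integral_def
    proof (intro nn_integral_mono)
      fix s
      have "(\<Sum>k\<in>{k}. w k * \<rho> k (c s)) \<le> \<sigma> (c s)" unfolding \<sigma>_def by (intro sum_le_suminf) auto
      then show "w k * (\<rho> k (c s) * indicator {0..L} s) \<le> \<sigma> (c s) * indicator {0..L} s"
        by (auto simp: indicator_def)
    qed
    finally have "w k * arc_integral c a b (\<rho> k) < \<infinity>" using f by (rule le_less_trans)
    then show ?thesis using w(1,2)[of k] by (auto simp: ennreal_mult_less_top less_top[symmetric])
  qed
  ultimately show ?thesis using that[of \<sigma>] by simp
qed

lemma arc_integral_mono:
  assumes "0 \<le> a" "b \<le> L" "\<And>s. s \<in> {a..b} \<Longrightarrow> g (c s) \<le> h (c s)"
  shows "arc_integral c a b g \<le> arc_integral c 0 L h"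
  unfolding arc_integral_def using assms by (intro nn_integral_mono) (auto simp: indicator_def)

text \<open>Serves to restrict to a smaller set and to pass to a Borel majorant at once. The
  exceptional family is kept, because the arc length parametrization of a curve stays in its image,
  where \<open>h\<close> dominates \<open>g\<close>.\<close>

lemma weak_upper_gradient_mono:
  assumes "weak_upper_gradient M H u g" "H' \<subseteq> H" "H' \<in> sets M" "h \<in> borel_measurable borel"
    "\<And>x. x \<in> H' \<Longrightarrow> g x \<le> h x"
  shows "weak_upper_gradient M H' u h"
proof -
  obtain \<Gamma> where \<Gamma>: "zero_modulus M \<Gamma>"
    "\<And>\<gamma>. rectifiable_curve \<gamma> \<Longrightarrow> nonconstant_curve \<gamma> \<Longrightarrow> path_image \<gamma> \<subseteq> H \<Longrightarrow> \<gamma> \<notin> \<Gamma> \<Longrightarrow>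
       abs_diff (u (pathstart \<gamma>)) (u (pathfinish \<gamma>)) \<le> line_integral \<gamma> g"
    using assms(1) unfolding weak_upper_gradient_def by blast
  show ?thesis
    unfolding weak_upper_gradient_def
  proof (intro conjI exI[of _ \<Gamma>] allI impI \<Gamma>(1) borel_measurable_restrict assms(4))
    fix \<gamma> assume \<gamma>: "rectifiable_curve \<gamma> \<and> nonconstant_curve \<gamma> \<and> path_image \<gamma> \<subseteq> H' \<and> \<gamma> \<notin> \<Gamma>"
    define c where "c = arclength_param \<gamma>"
    define L where "L = enn2real (curve_length \<gamma> 0 1)"
    have c: "c ` {0..L} \<subseteq> path_image \<gamma>"
      unfolding c_def L_def by (rule unit_speed_of_curve; use \<gamma> in blast)
    have "line_integral \<gamma> g \<le> line_integral \<gamma> h"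
      unfolding line_integral_def c_def[symmetric] L_def[symmetric]
      by (intro nn_integral_mono) (use c \<gamma> assms(5) in \<open>force simp: indicator_def\<close>)
    moreover have "abs_diff (u (pathstart \<gamma>)) (u (pathfinish \<gamma>)) \<le> line_integral \<gamma> g"
      using \<Gamma>(2) \<gamma> assms(2) by blast
    ultimately show "abs_diff (u (pathstart \<gamma>)) (u (pathfinish \<gamma>)) \<le> line_integral \<gamma> h" by simp
  qed
qed

text \<open>The image of an arc is compact, so a Lebesgue number of the cover makes every short
  subarc lie in a single \<open>W k\<close>, where \<open>h k\<close> controls it and is dominated
  by \<open>G\<close>. Countability of the cover keeps the union of the exceptional families
  negligible.\<close>

lemma weak_upper_gradient_glue:
  fixes h :: "nat \<Rightarrow> 'a \<Rightarrow> ennreal"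
  assumes W: "\<And>k. open (W k)" "\<Omega> \<subseteq> (\<Union>k. W k)"
    and h: "\<And>k. h k \<in> borel_measurable borel" "\<And>k. weak_upper_gradient M (W k) u (h k)"
    and G: "G \<in> borel_measurable borel" "\<And>k x. x \<in> W k \<Longrightarrow> h k x \<le> G x"
  shows "weak_upper_gradient M \<Omega> u G"
proof -
  have "\<exists>\<rho>. arc_weight \<rho> \<and> bounds_arcs \<rho> (W k) u (h k)" for k
    using weak_upper_gradientE[OF h(2,1)[of k]] by metis
  then obtain \<rho> where \<rho>: "\<And>k. arc_weight (\<rho> k)" and bound: "\<And>k. bounds_arcs (\<rho> k) (W k) u (h k)"
    by metis
  obtain \<sigma> where \<sigma>: "arc_weight \<sigma>"
    "\<And>c L a b k. unit_speed c L \<Longrightarrow> 0 \<le> a \<Longrightarrow> a < b \<Longrightarrow> b \<le> L \<Longrightarrow> arc_integral c 0 L \<sigma> < \<infinity> \<Longrightarrow>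
       arc_integral c a b (\<rho> k) < \<infinity>"
    using countable_modulus[of \<rho>, OF \<rho>] by metis
  show ?thesis
  proof (rule weak_upper_gradientI[OF G(1) \<sigma>(1)])
    fix c L assume c: "unit_speed c L" and c\<Omega>: "c ` {0..L} \<subseteq> \<Omega>" and fin: "arc_integral c 0 L \<sigma> < \<infinity>"
    have "compact (c ` {0..L})"
      by (intro compact_continuous_image unit_speed_continuous_on[OF c]) simp
    then obtain \<delta> where \<delta>: "0 < \<delta>" "\<And>x. x \<in> c ` {0..L} \<Longrightarrow> \<exists>U\<in>range W. ball x \<delta> \<subseteq> U"
      using Heine_Borel_lemma[of "c ` {0..L}" "range W"] W c\<Omega> by (metis (no_types, lifting) order_trans rangeE)
    show "abs_diff (u (c 0)) (u (c L)) \<le> arc_integral c 0 L G"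
      unfolding arc_integral_def
    proof (rule abs_diff_le_integral_if_local[where f = "\<lambda>s. u (c s)" and k = "\<lambda>s. G (c s)", OF _ \<delta>(1)])
      show "0 < L" using unit_speedD(1)[OF c] .
      show "(\<lambda>s. G (c s) * indicator {0..L} s) \<in> borel_measurable borel"
        by (rule unit_speed_measurable[OF c G(1)]) auto
      fix a b assume ab: "0 \<le> a" "a < b" "b \<le> L" "b - a < \<delta>"
      obtain k where k: "ball (c a) \<delta> \<subseteq> W k" using \<delta>(2)[of "c a"] ab by auto
      have "c s \<in> ball (c a) \<delta>" if "s \<in> {a..b}" for s
        using unit_speed_dist_le[OF c, of a s] that ab by auto
      with k have ck: "c ` {a..b} \<subseteq> W k" by auto
      have "abs_diff (u (c a)) (u (c b)) \<le> arc_integral c a b (h k)"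
        by (rule bounds_arcsD[OF bound c ab(1-3) ck \<sigma>(2)[OF c ab(1-3) fin]])
      also have "\<dots> \<le> (\<integral>\<^sup>+s\<in>{a..b}. G (c s) \<partial>lborel)"
        unfolding arc_integral_def
          by (intro nn_integral_mono) (use ck G(2)[of _ k] in \<open>auto simp: indicator_def image_subset_iff\<close>)
      finally show "abs_diff (u (c a)) (u (c b)) \<le> (\<integral>\<^sup>+s\<in>{a..b}. G (c s) \<partial>lborel)" .
    qed
  qed
qed

section \<open>Calculus rules: removal of infinite values, sums, Lipschitz cutoffs\<close>

text \<open>Infinite values become 0. This only decreases differences, since a difference involving
  an infinite value was infinite by convention.\<close>

lemma weak_upper_gradient_real_of_ereal:
  assumes "weak_upper_gradient M H u g"
  shows "weak_upper_gradient M H (\<lambda>x. ereal (real_of_ereal (u x))) g"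
proof -
  have "abs_diff (ereal (real_of_ereal a)) (ereal (real_of_ereal b)) \<le> abs_diff a b" for a b
    by (cases a; cases b) (auto simp: abs_diff_def)
  then show ?thesis using assms unfolding weak_upper_gradient_def by (meson order_trans)
qed

lemma arc_integral_add:
  fixes g h :: "'a \<Rightarrow> ennreal"
  assumes c: "unit_speed c L" and gh: "g \<in> borel_measurable borel" "h \<in> borel_measurable borel"
  shows "arc_integral c 0 L (\<lambda>x. g x + h x) = arc_integral c 0 L g + arc_integral c 0 L h"
  unfolding arc_integral_def using unit_speed_measurable[OF c gh(1), of 0 L] unit_speed_measurable[OF c gh(2), of 0 L]
  by (subst nn_integral_add[symmetric]) (auto intro!: nn_integral_cong simp: distrib_right)

lemma arc_integral_cmult:
  fixes g :: "'a \<Rightarrow> ennreal"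
  assumes c: "unit_speed c L" and g: "g \<in> borel_measurable borel"
  shows "arc_integral c 0 L (\<lambda>x. k * g x) = k * arc_integral c 0 L g"
  unfolding arc_integral_def using unit_speed_measurable[OF c g, of 0 L]
  by (subst nn_integral_cmult[symmetric]) (auto intro!: nn_integral_cong simp: mult.assoc)

lemma weak_upper_gradient_add:
  fixes f f' :: "'a \<Rightarrow> real"
  assumes f: "weak_upper_gradient M H (\<lambda>x. ereal (f x)) g" "g \<in> borel_measurable borel"
    and f': "weak_upper_gradient M H (\<lambda>x. ereal (f' x)) g'" "g' \<in> borel_measurable borel"
  shows "weak_upper_gradient M H (\<lambda>x. ereal (f x + f' x)) (\<lambda>x. g x + g' x)"
proof -
  note [measurable] = f(2) f'(2)
  obtain \<rho> where \<rho>: "arc_weight \<rho>" "bounds_arcs \<rho> H (\<lambda>x. ereal (f x)) g"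
    using weak_upper_gradientE[OF f] by metis
  obtain \<rho>' where \<rho>': "arc_weight \<rho>'" "bounds_arcs \<rho>' H (\<lambda>x. ereal (f' x)) g'"
    using weak_upper_gradientE[OF f'] by metis
  note \<rho>_meas = arc_weight_measurable[OF \<rho>(1)] arc_weight_measurable[OF \<rho>'(1)]
  show ?thesis
  proof (rule weak_upper_gradientI[OF _ arc_weight_add[OF \<rho>(1) \<rho>'(1)]])
    fix c L assume c: "unit_speed c L" "c ` {0..L} \<subseteq> H" "arc_integral c 0 L (\<lambda>x. \<rho> x + \<rho>' x) < \<infinity>"
    note L = unit_speedD(1)[OF c(1)]
    have fin: "arc_integral c 0 L \<rho> < \<infinity>" "arc_integral c 0 L \<rho>' < \<infinity>"
      using c(3) unfolding arc_integral_add[OF c(1) \<rho>_meas] by auto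
    have "abs_diff (ereal (f (c 0) + f' (c 0))) (ereal (f (c L) + f' (c L)))
      \<le> abs_diff (ereal (f (c 0))) (ereal (f (c L))) + abs_diff (ereal (f' (c 0))) (ereal (f' (c L)))"
      by (auto simp flip: ennreal_plus intro!: ennreal_leI)
    also have "\<dots> \<le> arc_integral c 0 L g + arc_integral c 0 L g'"
      using bounds_arcsD[OF \<rho>(2) c(1) order_refl L order_refl c(2) fin(1)]
        bounds_arcsD[OF \<rho>'(2) c(1) order_refl L order_refl c(2) fin(2)] by (rule add_mono)
    finally show "abs_diff (ereal (f (c 0) + f' (c 0))) (ereal (f (c L) + f' (c L)))
      \<le> arc_integral c 0 L (\<lambda>x. g x + g' x)"
      unfolding arc_integral_add[OF c(1) f(2) f'(2)] .
  qed measurable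
qed

text \<open>
  On an arc of length \<open>d\<close> the oscillation of \<open>f\<close> is at most the integral of \<open>g\<close>, so that
  replacing the value of \<open>f\<close> at an endpoint by its average costs only a factor \<open>1 + K d\<close> on \<open>g\<close>.
  Subdividing makes \<open>d\<close> arbitrarily small.
\<close>

lemma weak_upper_gradient_cutoff:
  fixes f \<eta> :: "'a \<Rightarrow> real"
  assumes f: "weak_upper_gradient M H (\<lambda>x. ereal (f x)) g" "g \<in> borel_measurable borel"
    and p: "p \<in> borel_measurable borel" "\<And>x. x \<in> H \<Longrightarrow> ennreal \<bar>f x\<bar> \<le> p x"
    and \<eta>: "\<And>x. 0 \<le> \<eta> x" "\<And>x. \<eta> x \<le> 1" "\<And>x y. \<bar>\<eta> x - \<eta> y\<bar> \<le> K * dist x y" and K: "0 \<le> K"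
  shows "weak_upper_gradient M H (\<lambda>x. ereal (\<eta> x * f x)) (\<lambda>x. g x + ennreal K * p x)"
proof -
  note [measurable] = f(2) p(1)
  obtain \<rho> where \<rho>: "arc_weight \<rho>" "bounds_arcs \<rho> H (\<lambda>x. ereal (f x)) g"
    using weak_upper_gradientE[OF f] by metis
  show ?thesis
  proof (rule weak_upper_gradientI[OF _ \<rho>(1)])
    fix c L assume c: "unit_speed c L" and cH: "c ` {0..L} \<subseteq> H" and fin\<rho>: "arc_integral c 0 L \<rho> < \<infinity>"
      and fin: "arc_integral c 0 L (\<lambda>x. g x + ennreal K * p x) < \<infinity>"
    note L = unit_speedD(1)[OF c]
    let ?I = "arc_integral c 0 L g"
    have Ip: "(\<lambda>x. ennreal K * p x) \<in> borel_measurable borel" by measurable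
    have I_fin: "?I < \<infinity>" using fin unfolding arc_integral_add[OF c f(2) Ip] by auto
    have osc: "ennreal \<bar>f (c a) - f (c b)\<bar> \<le> arc_integral c a b g" if "0 \<le> a" "a < b" "b \<le> L" for a b
    proof -
      have "c ` {a..b} \<subseteq> H" using cH that by auto
      moreover have "arc_integral c a b \<rho> < \<infinity>"
        using that by (intro le_less_trans[OF arc_integral_mono fin\<rho>]) auto
      ultimately show ?thesis using bounds_arcsD[OF \<rho>(2) c that] by simp
    qed
    have *: "ennreal \<bar>\<eta> (c 0) * f (c 0) - \<eta> (c L) * f (c L)\<bar>
      \<le> arc_integral c 0 L (\<lambda>x. ennreal (1 + K * \<delta>) * g x + ennreal K * p x)" if \<delta>: "0 < \<delta>" for \<delta>
    proof -
      define k where "k x = ennreal (1 + K * \<delta>) * g x + ennreal K * p x" for x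
      have [measurable]: "k \<in> borel_measurable borel" unfolding k_def by measurable
      have "abs_diff (ereal (\<eta> (c 0) * f (c 0))) (ereal (\<eta> (c L) * f (c L))) \<le> (\<integral>\<^sup>+s\<in>{0..L}. k (c s) \<partial>lborel)"
      proof (rule abs_diff_le_integral_if_local[where f = "\<lambda>s. ereal (\<eta> (c s) * f (c s))" and k = "\<lambda>s. k (c s)", OF _ \<delta> L])
        show "(\<lambda>s. k (c s) * indicator {0..L} s) \<in> borel_measurable borel"
          by (rule unit_speed_measurable[OF c]) auto
        fix a b assume ab: "0 \<le> a" "a < b" "b \<le> L" "b - a < \<delta>"
        let ?J = "arc_integral c a b g"
        have J_fin: "?J < \<infinity>" using ab by (intro le_less_trans[OF arc_integral_mono I_fin]) auto
        note meas = unit_speed_measurable[OF c _ ab(1,3)]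
        \<comment> \<open>The inequality \<open>\<bar>f (c a)\<bar> \<le> p (c s)\<close> plus the
          oscillation of \<open>f\<close> is integrated over \<open>s\<close>. The Borel majorant
          \<open>p\<close> stands in for \<open>\<bar>f\<bar>\<close>, which is not assumed Borel
          and so need not be measurable along the arc.\<close>
        have "ennreal ((b - a) * \<bar>f (c a)\<bar>) = (\<integral>\<^sup>+s. ennreal \<bar>f (c a)\<bar> * indicator {a..b} s \<partial>lborel)"
          using ab by (simp add: nn_integral_cmult_indicator ennreal_mult mult.commute)
        also have "\<dots> \<le> (\<integral>\<^sup>+s. p (c s) * indicator {a..b} s + ?J * indicator {a..b} s \<partial>lborel)"
        proof (intro nn_integral_mono)
          fix s
          have "ennreal \<bar>f (c a)\<bar> \<le> p (c s) + ?J" if s: "s \<in> {a..b}"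
          proof (cases "a < s")
            case True
            have "ennreal \<bar>f (c a)\<bar> \<le> ennreal (\<bar>f (c s)\<bar> + \<bar>f (c a) - f (c s)\<bar>)"
              by (intro ennreal_leI) linarith
            also have "\<dots> = ennreal \<bar>f (c s)\<bar> + ennreal \<bar>f (c a) - f (c s)\<bar>" by (simp add: ennreal_plus)
            also have "\<dots> \<le> p (c s) + arc_integral c a s g"
              using cH s ab True by (intro add_mono p(2) osc) auto
            also have "arc_integral c a s g \<le> ?J"
              unfolding arc_integral_def using s by (intro nn_integral_mono) (auto simp: indicator_def)
            finally show ?thesis by (simp add: add_left_mono)
          next
            case False
            then have "s = a" using s by auto
            then show ?thesis using p(2)[of "c a"] cH ab by (auto intro!: add_increasing2 simp: image_subset_iff)
          qed
          then show "ennreal \<bar>f (c a)\<bar> * indicator {a..b} s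
              \<le> p (c s) * indicator {a..b} s + ?J * indicator {a..b} s"
            by (auto simp: indicator_def)
        qed
        also have "\<dots> = arc_integral c a b p + ?J * ennreal (b - a)"
          using ab meas[OF p(1)]
          by (subst nn_integral_add) (auto simp: arc_integral_def nn_integral_cmult_indicator)
        also have "\<dots> \<le> arc_integral c a b p + ?J * ennreal \<delta>"
          using ab by (intro add_left_mono mult_left_mono ennreal_leI) auto
        finally have avg: "ennreal ((b - a) * \<bar>f (c a)\<bar>) \<le> arc_integral c a b p + ?J * ennreal \<delta>" .
        \<comment> \<open>Product rule with \<eta> taken at the end \<open>b\<close> and
          \<open>f\<close> at the end \<open>a\<close>, the end at which the average has just been
          estimated.\<close>
        have "\<bar>\<eta> (c a) * f (c a) - \<eta> (c b) * f (c b)\<bar>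
          = \<bar>\<eta> (c b) * (f (c a) - f (c b)) + (\<eta> (c a) - \<eta> (c b)) * f (c a)\<bar>" by (simp add: algebra_simps)
        also have "\<dots> \<le> \<eta> (c b) * \<bar>f (c a) - f (c b)\<bar> + \<bar>\<eta> (c a) - \<eta> (c b)\<bar> * \<bar>f (c a)\<bar>"
          using \<eta>(1) by (intro order_trans[OF abs_triangle_ineq]) (simp add: abs_mult)
        also have "\<dots> \<le> 1 * \<bar>f (c a) - f (c b)\<bar> + (K * (b - a)) * \<bar>f (c a)\<bar>"
        proof (intro add_mono mult_right_mono \<eta>(2))
          have "dist (c a) (c b) \<le> b - a" using unit_speed_dist_le[OF c, of a b] ab by auto
          then show "\<bar>\<eta> (c a) - \<eta> (c b)\<bar> \<le> K * (b - a)"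
            using K \<eta>(3)[of "c a" "c b"] by (meson mult_left_mono order_trans)
        qed auto
        finally have "\<bar>\<eta> (c a) * f (c a) - \<eta> (c b) * f (c b)\<bar>
          \<le> \<bar>f (c a) - f (c b)\<bar> + K * ((b - a) * \<bar>f (c a)\<bar>)" by simp
        then have "ennreal \<bar>\<eta> (c a) * f (c a) - \<eta> (c b) * f (c b)\<bar>
          \<le> ennreal \<bar>f (c a) - f (c b)\<bar> + ennreal K * ennreal ((b - a) * \<bar>f (c a)\<bar>)"
          using K ab by (simp add: ennreal_leI flip: ennreal_plus ennreal_mult)
        also have "\<dots> \<le> ?J + ennreal K * (arc_integral c a b p + ?J * ennreal \<delta>)"
          by (intro add_mono mult_left_mono avg osc ab) auto
        also have "\<dots> = ennreal (1 + K * \<delta>) * ?J + ennreal K * arc_integral c a b p"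
          using K \<delta> by (simp add: ennreal_plus ennreal_mult algebra_simps)
        also have "\<dots> = (\<integral>\<^sup>+s\<in>{a..b}. k (c s) \<partial>lborel)"
          unfolding arc_integral_def k_def using meas[OF f(2)] meas[OF p(1)]
          by (subst (1 2) nn_integral_cmult[symmetric])
            (auto simp: distrib_right mult.assoc nn_integral_add[symmetric])
        finally show "abs_diff (ereal (\<eta> (c a) * f (c a))) (ereal (\<eta> (c b) * f (c b))) \<le> (\<integral>\<^sup>+s\<in>{a..b}. k (c s) \<partial>lborel)"
          by simp
      qed
      then show ?thesis by (simp add: arc_integral_def k_def)
    qed
    have "ennreal \<bar>\<eta> (c 0) * f (c 0) - \<eta> (c L) * f (c L)\<bar> \<le> arc_integral c 0 L (\<lambda>x. g x + ennreal K * p x)"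
    proof (rule ennreal_le_epsilon)
      fix e :: real assume e: "0 < e"
      obtain i where i: "0 \<le> i" "?I = ennreal i" using I_fin by (cases ?I) auto
      \<comment> \<open>Chosen so that the surplus \<open>K *\<close> \<delta> times the integral of
        \<open>g\<close> is at most \<open>e\<close>; adding 1 keeps the denominator positive when
        \<open>K\<close> or that integral vanishes.\<close>
      define \<delta> where "\<delta> = e / (K * i + 1)"
      have \<delta>: "0 < \<delta>" using e K i by (auto simp: \<delta>_def intro!: divide_pos_pos add_nonneg_pos)
      have Ki: "K * \<delta> * i \<le> e"
      proof -
        have "K * \<delta> * i = e * ((K * i) / (K * i + 1))" by (simp add: \<delta>_def)
        also have "\<dots> \<le> e * 1" using e K i by (intro mult_left_mono) (auto simp: divide_le_eq add_nonneg_pos)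
        finally show ?thesis by simp
      qed
      have "arc_integral c 0 L (\<lambda>x. ennreal (1 + K * \<delta>) * g x + ennreal K * p x)
        = ennreal (1 + K * \<delta>) * ?I + ennreal K * arc_integral c 0 L p"
        by (subst arc_integral_add[OF c]) (auto simp: arc_integral_cmult[OF c f(2)] arc_integral_cmult[OF c p(1)])
      also have "ennreal (1 + K * \<delta>) * ?I = ?I + ennreal (K * \<delta> * i)"
        using i K \<delta> by (simp add: algebra_simps flip: ennreal_plus ennreal_mult)
      also have "\<dots> \<le> ?I + ennreal e" by (intro add_left_mono ennreal_leI Ki)
      finally have "arc_integral c 0 L (\<lambda>x. ennreal (1 + K * \<delta>) * g x + ennreal K * p x)
        \<le> arc_integral c 0 L (\<lambda>x. g x + ennreal K * p x) + ennreal e"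
        by (simp add: arc_integral_add[OF c f(2) Ip] arc_integral_cmult[OF c p(1)] ac_simps)
      with *[OF \<delta>] show "ennreal \<bar>\<eta> (c 0) * f (c 0) - \<eta> (c L) * f (c L)\<bar>
          \<le> arc_integral c 0 L (\<lambda>x. g x + ennreal K * p x) + ennreal e" by (rule order_trans)
    qed
    then show "abs_diff (ereal (\<eta> (c 0) * f (c 0))) (ereal (\<eta> (c L) * f (c L)))
      \<le> arc_integral c 0 L (\<lambda>x. g x + ennreal K * p x)" by simp
  qed measurable
qed

section \<open>Minima and decreasing limits of locally integrable weak upper gradients\<close>

text \<open>Local integrability of a Borel function, tested on a fixed sequence of sets instead of
  all compactly contained ones, so that countably many weights suffice. For the sets
  \<open>core k\<close> it agrees with membership in \<open>L1_loc\<close>.\<close>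

definition integrable_along_exhaustion :: "(nat \<Rightarrow> 'a set) \<Rightarrow> ('a \<Rightarrow> ennreal) \<Rightarrow> bool" where
  "integrable_along_exhaustion U g \<longleftrightarrow>
     g \<in> borel_measurable borel \<and> (\<forall>k. (\<integral>\<^sup>+x\<in>U k. g x \<partial>M) < \<infinity>)"

text \<open>Each restriction of \<open>g\<close> to \<open>U k\<close> is itself an admissible
  weight. A compact arc in \<Omega> lies in one of the increasing sets \<open>U k\<close>, so
  avoiding countably many families makes the integral of \<open>g\<close> along it finite.\<close>

lemma locally_integrable_modulus:
  fixes g :: "'a \<Rightarrow> ennreal"
  assumes U: "\<And>k. open (U k)" "incseq U" "\<Omega> \<subseteq> (\<Union>k. U k)" and g: "integrable_along_exhaustion U g"
  obtains \<sigma> where "arc_weight \<sigma>"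
    "\<And>c L. unit_speed c L \<Longrightarrow> c ` {0..L} \<subseteq> \<Omega> \<Longrightarrow> arc_integral c 0 L \<sigma> < \<infinity> \<Longrightarrow> arc_integral c 0 L g < \<infinity>"
proof -
  have [measurable]: "g \<in> borel_measurable borel" "U k \<in> sets borel" for k
    using g U(1) by (auto simp: integrable_along_exhaustion_def)
  have m: "(\<lambda>x. g x * indicator (U k) x) \<in> borel_measurable borel" for k by measurable
  have w: "arc_weight (\<lambda>x. g x * indicator (U k) x)" for k
    using g m by (simp add: arc_weight_def integrable_along_exhaustion_def)
  obtain \<sigma> where \<sigma>: "arc_weight \<sigma>"
    "\<And>c L a b k. unit_speed c L \<Longrightarrow> 0 \<le> a \<Longrightarrow> a < b \<Longrightarrow> b \<le> L \<Longrightarrow> arc_integral c 0 L \<sigma> < \<infinity> \<Longrightarrow>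
       arc_integral c a b (\<lambda>x. g x * indicator (U k) x) < \<infinity>"
    using countable_modulus[of "\<lambda>k x. g x * indicator (U k) x", OF w] by blast
  show ?thesis
  proof (rule that[OF \<sigma>(1)])
    fix c L assume c: "unit_speed c L" "c ` {0..L} \<subseteq> \<Omega>" "arc_integral c 0 L \<sigma> < \<infinity>"
    note L = unit_speedD(1)[OF c(1)]
    have "compact (c ` {0..L})"
      by (intro compact_continuous_image unit_speed_continuous_on[OF c(1)]) simp
    then obtain C where C: "finite C" "c ` {0..L} \<subseteq> (\<Union>k\<in>C. U k)"
      using compactE_image[of "c ` {0..L}" UNIV U] U(1,3) c(2) by (metis order_trans)
    have "(\<Union>k\<in>C. U k) \<subseteq> U (Max (insert 0 C))"
    proof (rule UN_least)
      fix k assume "k \<in> C"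
      then have "k \<le> Max (insert 0 C)" using C(1) by simp
      then show "U k \<subseteq> U (Max (insert 0 C))" by (rule incseqD[OF U(2)])
    qed
    with C(2) have "c ` {0..L} \<subseteq> U (Max (insert 0 C))" by blast
    then have "arc_integral c 0 L g \<le> arc_integral c 0 L (\<lambda>x. g x * indicator (U (Max (insert 0 C))) x)"
      by (intro arc_integral_mono) (auto simp: image_subset_iff indicator_def)
    also have "\<dots> < \<infinity>" using \<sigma>(2)[OF c(1)] c(3) L by blast
    finally show "arc_integral c 0 L g < \<infinity>" .
  qed
qed

text \<open>Outside four negligible families both inequalities hold on every subarc and both
  functions are integrable along the arc. This is the situation of
  \<open>abs_diff_le_integral_min\<close>, where integrability gives the finite measures needed for
  regularity.\<close>

lemma weak_upper_gradient_min:
  assumes U: "\<And>k. open (U k)" "incseq U" "\<Omega> \<subseteq> (\<Union>k. U k)"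
    and g: "integrable_along_exhaustion U g" "weak_upper_gradient M \<Omega> u g"
    and h: "integrable_along_exhaustion U h" "weak_upper_gradient M \<Omega> u h"
  shows "weak_upper_gradient M \<Omega> u (\<lambda>x. min (g x) (h x))"
proof -
  have gh [measurable]: "g \<in> borel_measurable borel" "h \<in> borel_measurable borel"
    using g(1) h(1) by (auto simp: integrable_along_exhaustion_def)
  obtain \<rho>1 where 1: "arc_weight \<rho>1" "bounds_arcs \<rho>1 \<Omega> u g"
    using weak_upper_gradientE[OF g(2) gh(1)] by metis
  obtain \<rho>2 where 2: "arc_weight \<rho>2" "bounds_arcs \<rho>2 \<Omega> u h"
    using weak_upper_gradientE[OF h(2) gh(2)] by metis
  obtain \<rho>3 where 3: "arc_weight \<rho>3"
    "\<And>c L. unit_speed c L \<Longrightarrow> c ` {0..L} \<subseteq> \<Omega> \<Longrightarrow> arc_integral c 0 L \<rho>3 < \<infinity> \<Longrightarrow> arc_integral c 0 L g < \<infinity>"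
    using locally_integrable_modulus[OF U g(1)] by metis
  obtain \<rho>4 where 4: "arc_weight \<rho>4"
    "\<And>c L. unit_speed c L \<Longrightarrow> c ` {0..L} \<subseteq> \<Omega> \<Longrightarrow> arc_integral c 0 L \<rho>4 < \<infinity> \<Longrightarrow> arc_integral c 0 L h < \<infinity>"
    using locally_integrable_modulus[OF U h(1)] by metis
  define \<rho> where "\<rho> x = (\<rho>1 x + \<rho>2 x) + (\<rho>3 x + \<rho>4 x)" for x
  have "arc_weight \<rho>" unfolding \<rho>_def by (intro arc_weight_add 1 2 3 4)
  show ?thesis
  proof (rule weak_upper_gradientI[OF _ \<open>arc_weight \<rho>\<close>])
    fix c L assume c: "unit_speed c L" "c ` {0..L} \<subseteq> \<Omega>" and fin: "arc_integral c 0 L \<rho> < \<infinity>"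
    note L = unit_speedD(1)[OF c(1)]
    have le: "\<rho>1 x \<le> \<rho> x" "\<rho>2 x \<le> \<rho> x" "\<rho>3 x \<le> \<rho> x" "\<rho>4 x \<le> \<rho> x" for x
      unfolding \<rho>_def by (auto intro: add_increasing add_increasing2)
    have fin_ab: "arc_integral c a b \<rho>1 < \<infinity>" "arc_integral c a b \<rho>2 < \<infinity>" if "0 \<le> a" "b \<le> L" for a b
      using le_less_trans[OF arc_integral_mono fin, of a b] that le by blast+
    have fin_gh: "arc_integral c 0 L g < \<infinity>" "arc_integral c 0 L h < \<infinity>"
      using 3(2)[OF c] 4(2)[OF c] le_less_trans[OF arc_integral_mono fin, of 0 L] le by blast+
    have "abs_diff (u (c 0)) (u (c L)) \<le>
      (\<integral>\<^sup>+s. min (g (c s) * indicator {0..L} s) (h (c s) * indicator {0..L} s) \<partial>lborel)"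
    proof (rule abs_diff_le_integral_min[where f = "\<lambda>s. u (c s)", OF _ _ _ _ L])
      show "(\<lambda>s. g (c s) * indicator {0..L} s) \<in> borel_measurable borel"
        "(\<lambda>s. h (c s) * indicator {0..L} s) \<in> borel_measurable borel"
        by (auto intro!: unit_speed_measurable[OF c(1)])
      show "(\<integral>\<^sup>+s. g (c s) * indicator {0..L} s \<partial>lborel) < \<infinity>"
        "(\<integral>\<^sup>+s. h (c s) * indicator {0..L} s \<partial>lborel) < \<infinity>"
        using fin_gh by (auto simp: arc_integral_def)
      fix a b assume ab: "0 \<le> a" "a < b" "b \<le> L"
      have restrict: "(\<integral>\<^sup>+s\<in>{a..b}. q (c s) * indicator {0..L} s \<partial>lborel) = arc_integral c a b q" for q
        unfolding arc_integral_def using ab by (intro nn_integral_cong) (auto simp: indicator_def)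
      have "c ` {a..b} \<subseteq> \<Omega>" using c(2) ab by auto
      then show "abs_diff (u (c a)) (u (c b)) \<le> (\<integral>\<^sup>+s\<in>{a..b}. g (c s) * indicator {0..L} s \<partial>lborel)"
        "abs_diff (u (c a)) (u (c b)) \<le> (\<integral>\<^sup>+s\<in>{a..b}. h (c s) * indicator {0..L} s \<partial>lborel)"
        unfolding restrict using bounds_arcsD[OF 1(2) c(1) ab] bounds_arcsD[OF 2(2) c(1) ab] fin_ab[of a b] ab by auto
    qed
    also have "\<dots> = arc_integral c 0 L (\<lambda>x. min (g x) (h x))"
      unfolding arc_integral_def by (intro nn_integral_cong) (auto simp: indicator_def)
    finally show "abs_diff (u (c 0)) (u (c L)) \<le> arc_integral c 0 L (\<lambda>x. min (g x) (h x))" .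
  qed measurable
qed

text \<open>On an arc outside the exceptional families all the inequalities hold simultaneously and
  \<open>g 0\<close> has finite integral, so monotone convergence for decreasing sequences passes to
  the infimum.\<close>

lemma weak_upper_gradient_INF:
  fixes g :: "nat \<Rightarrow> 'a \<Rightarrow> ennreal"
  assumes U: "\<And>k. open (U k)" "incseq U" "\<Omega> \<subseteq> (\<Union>k. U k)"
    and g: "\<And>n. integrable_along_exhaustion U (g n)" "\<And>n. weak_upper_gradient M \<Omega> u (g n)"
    and dec: "\<And>x. decseq (\<lambda>n. g n x)"
  shows "weak_upper_gradient M \<Omega> u (\<lambda>x. INF n. g n x)"
proof -
  have gm [measurable]: "g n \<in> borel_measurable borel" for n
    using g(1) by (auto simp: integrable_along_exhaustion_def)
  have "\<exists>\<rho>. arc_weight \<rho> \<and> bounds_arcs \<rho> \<Omega> u (g n)" for n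
    using weak_upper_gradientE[OF g(2)[of n] gm] by metis
  then obtain \<rho> where \<rho>: "\<And>n. arc_weight (\<rho> n)" and bound: "\<And>n. bounds_arcs (\<rho> n) \<Omega> u (g n)"
    by metis
  obtain \<sigma> where \<sigma>: "arc_weight \<sigma>"
    "\<And>c L a b k. unit_speed c L \<Longrightarrow> 0 \<le> a \<Longrightarrow> a < b \<Longrightarrow> b \<le> L \<Longrightarrow> arc_integral c 0 L \<sigma> < \<infinity> \<Longrightarrow>
       arc_integral c a b (\<rho> k) < \<infinity>"
    using countable_modulus[of \<rho>, OF \<rho>] by metis
  obtain \<tau> where \<tau>: "arc_weight \<tau>"
    "\<And>c L. unit_speed c L \<Longrightarrow> c ` {0..L} \<subseteq> \<Omega> \<Longrightarrow> arc_integral c 0 L \<tau> < \<infinity> \<Longrightarrow> arc_integral c 0 L (g 0) < \<infinity>"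
    using locally_integrable_modulus[OF U g(1)[of 0]] by metis
  note \<sigma>\<tau> = arc_weight_measurable[OF \<sigma>(1)] arc_weight_measurable[OF \<tau>(1)]
  show ?thesis
  proof (rule weak_upper_gradientI[OF _ arc_weight_add[OF \<sigma>(1) \<tau>(1)]])
    fix c L assume c: "unit_speed c L" "c ` {0..L} \<subseteq> \<Omega>" "arc_integral c 0 L (\<lambda>x. \<sigma> x + \<tau> x) < \<infinity>"
    note L = unit_speedD(1)[OF c(1)]
    have fin: "arc_integral c 0 L \<sigma> < \<infinity>" "arc_integral c 0 L \<tau> < \<infinity>"
      using c(3) unfolding arc_integral_add[OF c(1) \<sigma>\<tau>] by auto
    have "abs_diff (u (c 0)) (u (c L)) \<le> (INF n. arc_integral c 0 L (g n))"
      using bounds_arcsD[OF bound c(1) order_refl L order_refl c(2) \<sigma>(2)[OF c(1) order_refl L order_refl fin(1)]]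
      by (intro INF_greatest)
    also have "\<dots> = (\<integral>\<^sup>+s. (INF n. g n (c s) * indicator {0..L} s) \<partial>lborel)"
      unfolding arc_integral_def
    proof (rule nn_integral_monotone_convergence_INF_decseq[symmetric])
      show "decseq (\<lambda>n s. g n (c s) * indicator {0..L} s)"
        unfolding monotone_def le_fun_def
        using dec by (auto intro!: mult_right_mono simp: decseq_def)
      show "(\<lambda>s. g n (c s) * indicator {0..L} s) \<in> borel_measurable lborel" for n
        using unit_speed_measurable[OF c(1) gm, of 0 L] by simp
      show "(\<integral>\<^sup>+s. g 0 (c s) * indicator {0..L} s \<partial>lborel) < \<infinity>"
        using \<tau>(2)[OF c(1,2) fin(2)] by (simp add: arc_integral_def)
    qed
    also have "\<dots> = arc_integral c 0 L (\<lambda>x. INF n. g n x)"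
      unfolding arc_integral_def by (intro nn_integral_cong) (auto simp: indicator_def)
    finally show "abs_diff (u (c 0)) (u (c L)) \<le> arc_integral c 0 L (\<lambda>x. INF n. g n x)" .
  qed measurable
qed

end

section \<open>Doubling measures\<close>

text \<open>The Caratheodory measurable sets already form a sigma algebra on which \<mu> is a
  measure, so generating a sigma algebra and extending change neither. The hulls then come from
  Borel regularity of \<mu>.\<close>

lemma metric_measure_caratheodory:
  fixes \<mu> :: "'a::complete_space set \<Rightarrow> ennreal"
  assumes reg: "borel_regular_outer_measure \<mu>" and dbl: "doubling (caratheodory \<mu>)"
  shows "metric_measure (caratheodory \<mu>)"
proof -
  define L where "L = lambda_system UNIV (Pow UNIV) \<mu>"
  have oms: "outer_measure_space (Pow UNIV) \<mu>" and borel: "sets borel \<subseteq> L"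
    and hull: "\<And>A. \<exists>B\<in>sets borel. A \<subseteq> B \<and> \<mu> B = \<mu> A"
    using reg by (auto simp: borel_regular_outer_measure_def L_def)
  have ms: "measure_space UNIV L \<mu>"
    unfolding L_def by (rule sigma_algebra.caratheodory_lemma[OF sigma_algebra_Pow oms])
  then have alg: "sigma_algebra UNIV L" by (simp add: measure_space_def)
  have sp: "space (caratheodory \<mu>) = UNIV"
    unfolding caratheodory_def L_def[symmetric] by (simp add: space_measure_of_conv)
  have st: "sets (caratheodory \<mu>) = L"
    unfolding caratheodory_def L_def[symmetric] by (rule sigma_algebra.sets_measure_of_eq[OF alg])
  have "sigma_sets UNIV L = L"
    by (rule sigma_algebra.sigma_sets_eq[OF alg])
  then have em: "emeasure (caratheodory \<mu>) A = \<mu> A" if "A \<in> L" for A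
    using ms that unfolding caratheodory_def L_def[symmetric]
    by (subst emeasure_measure_of_conv) (auto simp: measure_space_def)
  show ?thesis
  proof
    fix A assume "A \<in> sets (caratheodory \<mu>)"
    then show "\<exists>B\<in>sets borel. A \<subseteq> B \<and> emeasure (caratheodory \<mu>) B = emeasure (caratheodory \<mu>) A"
      using hull[of A] em borel unfolding st by (metis subsetD)
  qed (use sp st borel dbl in auto)
qed

context metric_measure
begin

lemma borel_setsD: "A \<in> sets borel \<Longrightarrow> A \<in> sets M"
  using borel_sets by auto

lemma ball_sets [measurable, simp]: "ball x r \<in> sets M"
  by (rule open_sets_M) simp

lemma emeasure_ball:
  assumes "0 < r" shows "0 < emeasure M (ball x r)" "emeasure M (ball x r) < \<infinity>"
proof -
  obtain C :: real where C: "1 \<le> C"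
    and d: "\<And>x r. r > 0 \<Longrightarrow> 0 < emeasure M (ball x (2 * r)) \<and>
     emeasure M (ball x (2 * r)) \<le> ennreal C * emeasure M (ball x r) \<and>
     ennreal C * emeasure M (ball x r) < \<infinity>"
    using doubling unfolding doubling_def by blast
  show "0 < emeasure M (ball x r)" using d[of "r / 2" x] assms by simp
  have "ennreal C * emeasure M (ball x r) < \<infinity>" using d[of r x] assms by simp
  then show "emeasure M (ball x r) < \<infinity>"
    using C by (auto simp: ennreal_mult_less_top)
qed

lemma emeasure_ball_pow:
  obtains C :: real where "1 \<le> C"
    "\<And>x r n. 0 < r \<Longrightarrow> emeasure M (ball x (2 ^ n * r)) \<le> ennreal (C ^ n) * emeasure M (ball x r)"
proof -
  obtain C :: real where C: "1 \<le> C"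
    and d: "\<And>x r. r > 0 \<Longrightarrow> emeasure M (ball x (2 * r)) \<le> ennreal C * emeasure M (ball x r)"
    using doubling unfolding doubling_def by blast
  have "emeasure M (ball x (2 ^ n * r)) \<le> ennreal (C ^ n) * emeasure M (ball x r)" if "0 < r" for x r n
  proof (induction n)
    case (Suc n)
    have "emeasure M (ball x (2 ^ Suc n * r)) \<le> ennreal C * emeasure M (ball x (2 ^ n * r))"
      using d[of "2 ^ n * r" x] that by (simp add: mult.assoc)
    also have "\<dots> \<le> ennreal C * (ennreal (C ^ n) * emeasure M (ball x r))"
      by (intro mult_left_mono Suc.IH) auto
    also have "\<dots> = ennreal (C ^ Suc n) * emeasure M (ball x r)"
      using C by (simp add: ennreal_mult mult.assoc)
    finally show ?case .
  qed simp
  with C show ?thesis by (rule that)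
qed

section \<open>Compactness from completeness and doubling\<close>

text \<open>A packing argument: the balls of radius \<open>e / 2\<close> around separated points are
  disjoint and contained in \<open>B\<close>, while doubling bounds the measure of each below by a
  fixed fraction of that of \<open>B\<close>.\<close>

lemma separated_card_le:
  fixes S :: "'a set"
  assumes S: "S \<subseteq> ball x0 R" and e: "0 < e"
  obtains b :: nat where "\<And>F. finite F \<Longrightarrow> F \<subseteq> S \<Longrightarrow> (\<forall>x\<in>F. \<forall>y\<in>F. x \<noteq> y \<longrightarrow> e \<le> dist x y) \<Longrightarrow> card F \<le> b"
proof (cases "S = {}")
  case True
  have "card F \<le> 0" if "F \<subseteq> S" for F :: "'a set" using that True by simp
  then show ?thesis using that by blast
next
  case False
  then obtain s where "dist x0 s < R" using S unfolding subset_iff mem_ball by blast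
  then have R: "0 < R" using zero_le_dist[of x0 s] by linarith
  obtain C :: real where C: "1 \<le> C"
    "\<And>x r n. 0 < r \<Longrightarrow> emeasure M (ball x (2 ^ n * r)) \<le> ennreal (C ^ n) * emeasure M (ball x r)"
    using emeasure_ball_pow by metis
  define B where "B = ball x0 (R + e)"
  obtain m where m: "0 < m" "emeasure M B = ennreal m"
    using emeasure_ball[of "R + e" x0] R e unfolding B_def by (cases "emeasure M (ball x0 (R + e))") auto
  \<comment> \<open>After \<open>N\<close> doublings the ball of radius \<open>e / 2\<close> around
    any point of \<open>F\<close> contains \<open>B\<close>, since points of \<open>B\<close> have
    distance less than \<open>2 * R + e\<close> from it.\<close>
  obtain N :: nat where N: "(2 * R + e) / (e / 2) < 2 ^ N"
    using real_arch_pow[of 2] by auto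
  have Ne: "2 * R + e \<le> 2 ^ N * (e / 2)" using N e by (simp add: field_simps)
  have "card F \<le> nat \<lceil>C ^ N\<rceil>"
    if F: "finite F" "F \<subseteq> S" and sep: "\<forall>x\<in>F. \<forall>y\<in>F. x \<noteq> y \<longrightarrow> e \<le> dist x y" for F
  proof -
    have low: "ennreal m \<le> ennreal (C ^ N) * emeasure M (ball x (e / 2))" if "x \<in> F" for x
    proof -
      have "B \<subseteq> ball x (2 ^ N * (e / 2))"
      proof
        fix y assume "y \<in> B"
        moreover have "dist x0 x < R" using F(2) S that unfolding subset_iff mem_ball by blast
        ultimately have "dist x y < 2 * R + e"
          using dist_triangle[of x y x0] by (auto simp: B_def dist_commute)
        then show "y \<in> ball x (2 ^ N * (e / 2))" using Ne by simp
      qed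
      then have "emeasure M B \<le> emeasure M (ball x (2 ^ N * (e / 2)))" by (rule emeasure_mono) simp
      also have "\<dots> \<le> ennreal (C ^ N) * emeasure M (ball x (e / 2))" using e by (intro C(2)) simp
      finally show ?thesis using m by simp
    qed
    have disj: "disjoint_family_on (\<lambda>x. ball x (e / 2)) F"
      unfolding disjoint_family_on_def
    proof (intro ballI impI)
      fix x y assume xy: "x \<in> F" "y \<in> F" "x \<noteq> y"
      then have "e \<le> dist x y" using sep by blast
      then show "ball x (e / 2) \<inter> ball y (e / 2) = {}"
        using dist_triangle_half_l by (metis disjoint_ballI field_sum_of_halves)
    qed
    have "of_nat (card F) * ennreal m = (\<Sum>x\<in>F. ennreal m)" by simp
    also have "\<dots> \<le> (\<Sum>x\<in>F. ennreal (C ^ N) * emeasure M (ball x (e / 2)))" by (intro sum_mono low)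
    also have "\<dots> = ennreal (C ^ N) * emeasure M (\<Union>x\<in>F. ball x (e / 2))"
      using F(1) disj by (subst sum_emeasure[symmetric]) (auto simp: sum_distrib_left)
    also have "\<dots> \<le> ennreal (C ^ N) * emeasure M B"
    proof (intro mult_left_mono emeasure_mono)
      show "(\<Union>x\<in>F. ball x (e / 2)) \<subseteq> B"
      proof (rule UN_least, rule subsetI)
        fix x y assume "x \<in> F" "y \<in> ball x (e / 2)"
        then show "y \<in> B"
          using F(2) S dist_triangle[of x0 y x] e unfolding B_def subset_iff mem_ball by force
      qed
    qed (auto simp: B_def)
    finally have "ennreal (real (card F) * m) \<le> ennreal (C ^ N * m)"
      using m C(1) by (simp add: ennreal_mult ennreal_of_nat_eq_real_of_nat)
    then have "real (card F) \<le> C ^ N"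
      using m C(1) by (subst (asm) ennreal_le_iff) auto
    then show ?thesis by linarith
  qed
  then show ?thesis by (rule that)
qed

text \<open>A separated set of maximal cardinality is an \<open>e\<close>-net, since a point far
  from all its members could be added. Total boundedness and completeness then give
  compactness.\<close>

lemma compact_if_closed_bounded:
  fixes S :: "'a set"
  assumes "closed S" and S: "S \<subseteq> ball x0 R"
  shows "compact S"
  unfolding compact_eq_totally_bounded
proof (intro conjI allI impI)
  show "complete S" using assms(1) by (simp add: complete_eq_closed)
  fix e :: real assume e: "0 < e"
  define P where "P F \<longleftrightarrow> finite F \<and> F \<subseteq> S \<and> (\<forall>x\<in>F. \<forall>y\<in>F. x \<noteq> y \<longrightarrow> e \<le> dist x y)" for F
  obtain b where b: "\<And>F. P F \<Longrightarrow> card F \<le> b"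
    using separated_card_le[OF S e] unfolding P_def by metis
  have "P {}" by (simp add: P_def)
  then obtain F where F: "P F" "\<And>F'. P F' \<Longrightarrow> card F' \<le> card F"
    using ex_has_greatest_nat[of P "{}" card "Suc b"] b by (metis less_Suc_eq_le)
  have "S \<subseteq> (\<Union>x\<in>F. ball x e)"
  proof (rule ccontr)
    assume "\<not> S \<subseteq> (\<Union>x\<in>F. ball x e)"
    then obtain y where y: "y \<in> S" "\<And>x. x \<in> F \<Longrightarrow> e \<le> dist x y"
      unfolding subset_iff UN_iff mem_ball by (meson not_less)
    then have "y \<notin> F" using e by fastforce
    have "P (insert y F)" using F(1) y unfolding P_def by (auto simp: dist_commute)
    then have "card (insert y F) \<le> card F" by (rule F(2))
    moreover have "finite F" using F(1) by (simp add: P_def)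
    ultimately show False using \<open>y \<notin> F\<close> by simp
  qed
  moreover have "finite F" using F(1) by (simp add: P_def)
  ultimately show "\<exists>k. finite k \<and> S \<subseteq> (\<Union>x\<in>k. ball x e)" by (intro exI[of _ F] conjI)
qed

text \<open>A finite net of \<open>C\<close> at scale \<open>t / 2\<close> reduces the bound to
  finitely many balls. Each of these meets the open set \<Omega> and so contains a small ball of
  positive measure; the ball of radius \<open>t\<close> around a point of \<open>C\<close> contains
  the half-size ball around a nearby net point.\<close>

lemma emeasure_frontier_ball_lower_bound:
  assumes "compact C" "C \<subseteq> closure \<Omega>" "open \<Omega>" "0 < t"
  obtains m :: real where "0 < m" "\<And>x. x \<in> C \<Longrightarrow> ennreal m \<le> emeasure M (ball x t \<inter> \<Omega>)"
proof -
  obtain D where D: "D \<subseteq> C" "finite D" "C \<subseteq> (\<Union>x\<in>D. ball x (t / 2))"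
  proof (rule compactE_image[OF assms(1), of C "\<lambda>x. ball x (t / 2)"])
    show "C \<subseteq> (\<Union>x\<in>C. ball x (t / 2))" using assms(4) by auto
  qed auto
  have sets: "ball x r \<inter> \<Omega> \<in> sets M" for x r by (rule open_sets_M) (use assms(3) in auto)
  have pos: "0 < emeasure M (ball x (t / 2) \<inter> \<Omega>)" if "x \<in> D" for x
  proof -
    have "x \<in> closure \<Omega>" using that D(1) assms(2) by auto
    then obtain y where y: "y \<in> \<Omega>" "dist y x < t / 2" using assms(4) unfolding closure_approachable by (metis half_gt_zero)
    have "open (ball x (t / 2) \<inter> \<Omega>)" "y \<in> ball x (t / 2) \<inter> \<Omega>"
      using y assms(3) by (auto simp: dist_commute)
    then obtain r where r: "0 < r" "ball y r \<subseteq> ball x (t / 2) \<inter> \<Omega>" by (meson openE)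
    have "emeasure M (ball y r) \<le> emeasure M (ball x (t / 2) \<inter> \<Omega>)" by (rule emeasure_mono[OF r(2) sets])
    then show ?thesis using emeasure_ball(1)[OF r(1), of y] by (rule less_le_trans[rotated])
  qed
  \<comment> \<open>The extra entry 1 makes the minimum finite and covers the case of an empty
    net.\<close>
  define b where "b = Min (insert 1 ((\<lambda>x. emeasure M (ball x (t / 2) \<inter> \<Omega>)) ` D))"
  have "b \<in> insert 1 ((\<lambda>x. emeasure M (ball x (t / 2) \<inter> \<Omega>)) ` D)"
    unfolding b_def using D(2) by (intro Min_in) auto
  then have "0 < b" using pos by auto
  moreover have "b \<le> 1" unfolding b_def using D(2) by (intro Min_le) auto
  ultimately obtain m where m: "0 < m" "b = ennreal m"
    by (cases b) (auto simp: top_unique)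
  have "ennreal m \<le> emeasure M (ball x t \<inter> \<Omega>)" if x: "x \<in> C" for x
  proof -
    obtain y where y: "y \<in> D" "x \<in> ball y (t / 2)" using D(3) x by blast
    have "b \<le> emeasure M (ball y (t / 2) \<inter> \<Omega>)" unfolding b_def using D(2) y(1) by (intro Min_le) auto
    also have "\<dots> \<le> emeasure M (ball x t \<inter> \<Omega>)"
    proof (rule emeasure_mono[OF _ sets], rule subsetI)
      fix z assume "z \<in> ball y (t / 2) \<inter> \<Omega>"
      then show "z \<in> ball x t \<inter> \<Omega>"
        using y(2) dist_triangle[of x z y] by (auto simp: dist_commute)
    qed
    finally show ?thesis using m by simp
  qed
  with m(1) show ?thesis by (rule that)
qed

section \<open>Borel majorants\<close>

text \<open>A hull of equal measure differs by a null set only when the measure is finite, so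
  \<open>A\<close> is first cut into bounded pieces by balls.\<close>

lemma borel_null_hull:
  assumes A: "A \<in> sets M"
  obtains B where "B \<in> sets borel" "A \<subseteq> B" "emeasure M (B - A) = 0"
proof -
  fix x0 :: 'a
  define An where "An n = A \<inter> ball x0 (real (Suc n))" for n
  have An: "An n \<in> sets M" "emeasure M (An n) < \<infinity>" for n
    using A emeasure_mono[of "An n" "ball x0 (real (Suc n))" M] emeasure_ball(2)[of "real (Suc n)" x0]
    by (auto simp: An_def intro: le_less_trans)
  have "\<forall>n. \<exists>B. B \<in> sets borel \<and> An n \<subseteq> B \<and> emeasure M B = emeasure M (An n)"
    using borel_hull[OF An(1)] by blast
  then obtain B where B: "\<And>n. B n \<in> sets borel" "\<And>n. An n \<subseteq> B n" "\<And>n. emeasure M (B n) = emeasure M (An n)"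
    by metis
  have "emeasure M (B n - An n) = 0" for n
    using An[of n] B[of n] borel_sets by (subst emeasure_Diff) auto
  then have "B n - An n \<in> null_sets M" for n 
    using An(1) borel_setsD[OF B(1)] by (intro null_setsI sets.Diff)
  then have "(\<Union>n. B n - An n) \<in> null_sets M" by (intro null_sets_UN) auto
  moreover have "(\<Union>n. B n) - A \<subseteq> (\<Union>n. B n - An n)" by (auto simp: An_def)
  moreover have "(\<Union>n. B n) - A \<in> sets M" using B(1) A borel_sets by auto
  ultimately have "emeasure M ((\<Union>n. B n) - A) = 0" by (meson null_setsD1 null_sets_subset)
  moreover have "A \<subseteq> (\<Union>n. B n)"
  proof
    fix x assume "x \<in> A"
    obtain n where "dist x0 x < real n" using reals_Archimedean2 by blast
    then have "x \<in> An n" using \<open>x \<in> A\<close> by (simp add: An_def)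
    then show "x \<in> (\<Union>n. B n)" using B(2) by blast
  qed
  moreover have "(\<Union>n. B n) \<in> sets borel" using B(1) by auto
  ultimately show ?thesis using that by blast
qed

text \<open>Every superlevel set at a rational height is enlarged to a Borel hull, and
  \<open>f'\<close> is the supremum of the resulting step functions. The inequality holds at every
  point of \<open>H\<close>, as needed along curves, which may run inside null sets; the equality
  almost everywhere preserves integrals.\<close>

lemma borel_majorant:
  fixes f :: "'a \<Rightarrow> ennreal"
  assumes f: "f \<in> borel_measurable (restrict_space M H)" and H: "H \<in> sets M"
  obtains f' where "f' \<in> borel_measurable borel" "\<And>x. x \<in> H \<Longrightarrow> f x \<le> f' x"
    "AE x in M. x \<in> H \<longrightarrow> f' x = f x"
proof -
  define A where "A q = {x \<in> H. ennreal (real_of_rat q) < f x}" for q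
  have "A q \<in> sets M" for q
  proof -
    have "{x \<in> space (restrict_space M H). ennreal (real_of_rat q) < f x} \<in> sets (restrict_space M H)"
      using f by measurable
    then show ?thesis
      using H by (simp add: sets_restrict_space_iff space_restrict_space space_M A_def)
  qed
  then have "\<forall>q. \<exists>B. B \<in> sets borel \<and> A q \<subseteq> B \<and> emeasure M (B - A q) = 0"
    using borel_null_hull by metis
  then obtain B where B: "\<And>q. B q \<in> sets borel" "\<And>q. A q \<subseteq> B q" "\<And>q. emeasure M (B q - A q) = 0"
    by metis
  define f' where "f' x = (SUP q. ennreal (real_of_rat q) * indicator (B q) x)" for x
  have "f' \<in> borel_measurable borel"
    unfolding f'_def using B(1) by (intro borel_measurable_SUP) auto
  moreover have "f x \<le> f' x" if "x \<in> H" for x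
  proof (rule ccontr)
    assume "\<not> f x \<le> f' x"
    then obtain q where q: "f' x < ennreal (real_of_rat q)" "ennreal (real_of_rat q) < f x"
      using ennreal_rat_dense[of "f' x" "f x"] by (auto simp: not_le)
    then have "x \<in> B q" using B(2) that by (auto simp: A_def)
    then have "ennreal (real_of_rat q) \<le> f' x" unfolding f'_def by (intro SUP_upper2[of q]) auto
    with q(1) show False by simp
  qed
  moreover have "AE x in M. x \<in> H \<longrightarrow> f' x = f x"
  proof (rule AE_I')
    show "(\<Union>q. B q - A q) \<in> null_sets M"
      using B(3) \<open>\<And>q. A q \<in> sets M\<close> borel_setsD[OF B(1)]
      by (intro null_sets_UN' countableI_type null_setsI sets.Diff)
    show "{x \<in> space M. \<not> (x \<in> H \<longrightarrow> f' x = f x)} \<subseteq> (\<Union>q. B q - A q)"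
    proof (rule subsetI, rule ccontr)
      fix x assume x: "x \<in> {x \<in> space M. \<not> (x \<in> H \<longrightarrow> f' x = f x)}" "x \<notin> (\<Union>q. B q - A q)"
      have "f' x \<le> f x"
        unfolding f'_def
      proof (rule SUP_least)
        fix q
        show "ennreal (real_of_rat q) * indicator (B q) x \<le> f x"
          using x by (cases "x \<in> B q") (auto simp: A_def)
      qed
      then show False using x \<open>\<And>x. x \<in> H \<Longrightarrow> f x \<le> f' x\<close>[of x] by auto
    qed
  qed
  ultimately show ?thesis by (rule that)
qed

lemma nn_integral_on_cong_AE:
  assumes "AE x in M. x \<in> H \<longrightarrow> f x = g x"
  shows "(\<integral>\<^sup>+x\<in>H. f x \<partial>M) = (\<integral>\<^sup>+x\<in>H. g x \<partial>M)"
  using assms by (intro nn_integral_cong_AE) (auto elim!: eventually_mono simp: indicator_def)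

text \<open>Weak upper gradients are merely measurable for the restriction of \<open>M\<close>. This
  replacement makes them integrable along arcs and splittable on subarcs without changing their
  energy.\<close>

lemma weak_upper_gradient_borel:
  assumes "weak_upper_gradient M H u g" "H \<in> sets M"
  obtains h where "h \<in> borel_measurable borel" "weak_upper_gradient M H u h"
    "AE x in M. x \<in> H \<longrightarrow> h x = g x"
proof -
  have "g \<in> borel_measurable (restrict_space M H)"
    using assms(1) by (simp add: weak_upper_gradient_def)
  then obtain h where h: "h \<in> borel_measurable borel" "\<And>x. x \<in> H \<Longrightarrow> g x \<le> h x"
    "AE x in M. x \<in> H \<longrightarrow> h x = g x"
    using borel_majorant[OF _ assms(2)] by metis
  have "weak_upper_gradient M H u h"
    by (rule weak_upper_gradient_mono[OF assms(1) _ assms(2) h(1)]) (use h(2) in auto)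
  with h show ?thesis using that by blast
qed

lemma L1_normI:
  assumes "u \<in> borel_measurable (restrict_space M H)" "H \<in> sets M"
  shows "(\<lambda>x. e2ennreal \<bar>u x\<bar> * indicator H x) \<in> borel_measurable M"
proof -
  have "(\<lambda>x. e2ennreal \<bar>u x\<bar>) \<in> borel_measurable (restrict_space M H)"
    using assms(1) by measurable
  then show ?thesis
    using assms(2) by (subst (asm) borel_measurable_restrict_space_iff_ennreal) (auto simp: space_M)
qed

lemma L1_AE_finite:
  assumes "u \<in> L1 M H" "H \<in> sets M"
  shows "AE x in M. x \<in> H \<longrightarrow> \<bar>u x\<bar> \<noteq> \<infinity>"
proof -
  have "u \<in> borel_measurable (restrict_space M H)" "L1_norm M H u < \<infinity>" using assms(1) by (auto simp: L1_def)
  then have "AE x in M. e2ennreal \<bar>u x\<bar> * indicator H x \<noteq> \<infinity>"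
    by (intro nn_integral_PInf_AE L1_normI assms(2)) (auto simp: L1_norm_def)
  then show ?thesis by (auto elim!: eventually_mono simp: indicator_def)
qed

lemma L1_norm_mono_set: "H' \<subseteq> H \<Longrightarrow> L1_norm M H' u \<le> L1_norm M H u"
  unfolding L1_norm_def by (intro nn_integral_mono) (auto simp: indicator_def)

lemma L1_subset: "u \<in> L1 M H \<Longrightarrow> H' \<subseteq> H \<Longrightarrow> u \<in> L1 M H'"
  using L1_norm_mono_set[of H' H u] by (auto simp: L1_def intro: measurable_restrict_mono le_less_trans)

lemma N11_iff:
  assumes H: "H \<in> sets M"
  shows "u \<in> N11 M H \<longleftrightarrow> u \<in> L1 M H \<and>
    (\<exists>g\<in>borel_measurable borel. weak_upper_gradient M H u g \<and> (\<integral>\<^sup>+x\<in>H. g x \<partial>M) < \<infinity>)"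
proof
  assume u: "u \<in> N11 M H"
  then have "(INF g \<in> {g. weak_upper_gradient M H u g}. \<integral>\<^sup>+x\<in>H. g x \<partial>M) < \<infinity>" "u \<in> L1 M H"
    by (auto simp: N11_def N11_norm_def L1_def)
  then obtain g where g: "weak_upper_gradient M H u g" "(\<integral>\<^sup>+x\<in>H. g x \<partial>M) < \<infinity>"
    by (auto simp: INF_less_iff)
  obtain h where h: "h \<in> borel_measurable borel" "weak_upper_gradient M H u h" "AE x in M. x \<in> H \<longrightarrow> h x = g x"
    using weak_upper_gradient_borel[OF g(1) H] by metis
  then show "u \<in> L1 M H \<and>
    (\<exists>g\<in>borel_measurable borel. weak_upper_gradient M H u g \<and> (\<integral>\<^sup>+x\<in>H. g x \<partial>M) < \<infinity>)"
    using g(2) nn_integral_on_cong_AE[OF h(3)] \<open>u \<in> L1 M H\<close> by auto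
next
  assume *: "u \<in> L1 M H \<and>
    (\<exists>g\<in>borel_measurable borel. weak_upper_gradient M H u g \<and> (\<integral>\<^sup>+x\<in>H. g x \<partial>M) < \<infinity>)"
  then obtain g where g: "weak_upper_gradient M H u g" "(\<integral>\<^sup>+x\<in>H. g x \<partial>M) < \<infinity>" by blast
  then have "(INF g \<in> {g. weak_upper_gradient M H u g}. \<integral>\<^sup>+x\<in>H. g x \<partial>M) < \<infinity>"
    by (auto simp: INF_less_iff)
  then show "u \<in> N11 M H" using * by (auto simp: N11_def N11_norm_def L1_def)
qed

lemma N11_subset:
  assumes u: "u \<in> N11 M H" and H: "H \<in> sets M" "H' \<in> sets M" "H' \<subseteq> H"
  shows "u \<in> N11 M H'"
proof -
  obtain g where g: "u \<in> L1 M H" "g \<in> borel_measurable borel" "weak_upper_gradient M H u g" "(\<integral>\<^sup>+x\<in>H. g x \<partial>M) < \<infinity>"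
    using u unfolding N11_iff[OF H(1)] by blast
  have "weak_upper_gradient M H' u g" by (rule weak_upper_gradient_mono[OF g(3) H(3,2) g(2)]) simp
  moreover have "(\<integral>\<^sup>+x\<in>H'. g x \<partial>M) \<le> (\<integral>\<^sup>+x\<in>H. g x \<partial>M)"
    using H(3) by (intro nn_integral_mono) (auto simp: indicator_def)
  ultimately show ?thesis
    unfolding N11_iff[OF H(2)] using g L1_subset[OF g(1) H(3)] by (auto intro: le_less_trans)
qed

lemma N11_imp_N11_loc:
  assumes "u \<in> N11 M \<Omega>" "open \<Omega>" shows "u \<in> N11_loc M \<Omega>"
proof -
  have "u \<in> N11 M U" if "open U" "compactly_inside U \<Omega>" for U
    using that closure_subset[of U] assms(2)
    by (intro N11_subset[OF assms(1)] open_sets_M) (auto simp: compactly_inside_def)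
  then show ?thesis by (simp add: N11_loc_def)
qed

end

section \<open>Exhaustion by level sets\<close>

text \<open>\<theta> is the minimum of the distance to the complement and of
  \<open>1 / (1 + dist x x0)\<close>. The former detects \<Omega>, the latter decays at infinity, so
  superlevel sets are closed and bounded, hence compact.\<close>

lemma (in metric_measure) exhaustion_function:
  assumes "open \<Omega>"
  obtains \<theta> :: "'a \<Rightarrow> real" where "\<And>x y. \<bar>\<theta> x - \<theta> y\<bar> \<le> dist x y" "\<And>x. 0 \<le> \<theta> x" "\<And>x. \<theta> x \<le> 1"
    "\<And>x. x \<in> \<Omega> \<longleftrightarrow> 0 < \<theta> x" "\<And>e. 0 < e \<Longrightarrow> compact {x. e \<le> \<theta> x}"
proof -
  fix x0 :: 'a
  define p where "p x = 1 / (1 + dist x x0)" for x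
  \<comment> \<open>\<open>infdist\<close> to the empty set is 0 by convention, which would make
    \<theta> vanish identically when \<Omega> is the whole space.\<close>
  define q where "q x = (if \<Omega> = UNIV then 1 else infdist x (- \<Omega>))" for x
  define \<theta> where "\<theta> x = min (p x) (q x)" for x
  have p_lip: "\<bar>p x - p y\<bar> \<le> dist x y" for x y
  proof -
    have "p x - p y = (dist y x0 - dist x x0) / ((1 + dist x x0) * (1 + dist y x0))"
      unfolding p_def by (subst diff_frac_eq) (auto simp: add_nonneg_eq_0_iff)
    then have "\<bar>p x - p y\<bar> = \<bar>dist y x0 - dist x x0\<bar> / ((1 + dist x x0) * (1 + dist y x0))"
      by (simp add: abs_mult)
    also have "\<dots> \<le> \<bar>dist y x0 - dist x x0\<bar> / 1"
      by (intro divide_left_mono) (auto intro!: mult_ge1_I mult_pos_pos add_pos_nonneg)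
    also have "\<dots> \<le> dist x y"
      using dist_triangle[of y x0 x] dist_triangle[of x x0 y] by (simp add: dist_commute)
    finally show ?thesis .
  qed
  have q_lip: "\<bar>q x - q y\<bar> \<le> dist x y" for x y
    using infdist_triangle_abs[of x "- \<Omega>" y] by (simp add: q_def)
  have lip: "\<bar>\<theta> x - \<theta> y\<bar> \<le> dist x y" for x y
    using p_lip[of x y] q_lip[of x y] unfolding \<theta>_def by linarith
  have p: "0 < p x" "p x \<le> 1" for x by (simp_all add: p_def add_pos_nonneg divide_le_eq)
  have q: "0 \<le> q x" for x by (simp add: q_def infdist_nonneg)
  have \<Omega>: "x \<in> \<Omega> \<longleftrightarrow> 0 < \<theta> x" for x
  proof (cases "\<Omega> = UNIV")
    case True then show ?thesis using p(1) by (simp add: \<theta>_def q_def)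
  next
    case False
    then have "x \<in> - \<Omega> \<longleftrightarrow> infdist x (- \<Omega>) = 0"
      using assms by (intro in_closed_iff_infdist_zero) auto
    then show ?thesis using False p(1)[of x] q[of x] by (auto simp: \<theta>_def q_def less_le)
  qed
  have "compact {x. e \<le> \<theta> x}" if e: "0 < e" for e
  proof (rule compact_if_closed_bounded)
    have "continuous_on UNIV \<theta>"
      by (rule lipschitz_on_continuous_on[of 1], rule lipschitz_onI) (use lip in \<open>auto simp: dist_real_def\<close>)
    then show "closed {x. e \<le> \<theta> x}" by (intro closed_Collect_le continuous_on_const)
    show "{x. e \<le> \<theta> x} \<subseteq> ball x0 (1 / e + 1)"
    proof
      fix x assume "x \<in> {x. e \<le> \<theta> x}"
      then have "e \<le> p x" by (simp add: \<theta>_def)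
      then have "e * (1 + dist x x0) \<le> 1" by (simp add: p_def le_divide_eq add_pos_nonneg)
      then have "dist x x0 \<le> 1 / e" using e by (simp add: field_simps)
      then show "x \<in> ball x0 (1 / e + 1)" by (simp add: dist_commute)
    qed
  qed
  moreover have "\<theta> x \<le> 1" "0 \<le> \<theta> x" for x using p[of x] q[of x] by (auto simp: \<theta>_def)
  ultimately show ?thesis using that[of \<theta>] lip \<Omega> by blast
qed

lemma measurable_restrict_UN:
  fixes A :: "nat \<Rightarrow> 'a set"
  assumes f: "\<And>k. f \<in> measurable (restrict_space M (A k)) N" and A: "\<And>k. A k \<in> sets M"
  shows "f \<in> measurable (restrict_space M (\<Union>k. A k)) N"
proof (rule measurableI)
  fix x assume "x \<in> space (restrict_space M (\<Union>k. A k))"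
  then obtain k where "x \<in> space (restrict_space M (A k))" by (auto simp: space_restrict_space)
  then show "f x \<in> space N" using measurable_space[OF f] by blast
next
  have A': "A k \<inter> space M = A k" for k using sets.sets_into_space[OF A] by blast
  have U: "(\<Union>k. A k) \<in> sets M" using A by auto
  fix S assume S: "S \<in> sets N"
  have "f -` S \<inter> A k \<in> sets M" for k
    using measurable_sets[OF f S, of k] A A'
    by (simp add: space_restrict_space sets_restrict_space_iff)
  then have "(\<Union>k. f -` S \<inter> A k) \<in> sets M" by (intro sets.countable_nat_UN) blast
  moreover have "f -` S \<inter> space (restrict_space M (\<Union>k. A k)) = (\<Union>k. f -` S \<inter> A k)"
    using A' by (auto simp: space_restrict_space)
  ultimately show "f -` S \<inter> space (restrict_space M (\<Union>k. A k)) \<in> sets (restrict_space M (\<Union>k. A k))"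
    using U by (subst sets_restrict_space_iff) (auto simp: sets.Int_space_eq2)
qed

locale exhausted_domain = metric_measure M for M :: "'a::complete_space measure" +
  fixes \<Omega> :: "'a set" and \<theta> :: "'a \<Rightarrow> real"
  assumes \<theta>_lipschitz: "\<bar>\<theta> x - \<theta> y\<bar> \<le> dist x y"
    and \<theta>_nonneg: "0 \<le> \<theta> x" and \<theta>_le_1: "\<theta> x \<le> 1"
    and in_domain_iff: "x \<in> \<Omega> \<longleftrightarrow> 0 < \<theta> x"
    and compact_superlevel: "0 < e \<Longrightarrow> compact {x. e \<le> \<theta> x}"
begin

text \<open>The scale starts at 2, above all values of \<theta>, so that the zeroth layer has no
  upper restriction in effect.\<close>

definition level :: "nat \<Rightarrow> real" where "level k = 2 / 2 ^ k"

definition core :: "nat \<Rightarrow> 'a set" where "core k = {x. level (k + 2) < \<theta> x}"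

text \<open>Each layer spans two dyadic steps. Consecutive layers therefore overlap, and these open
  sets cover \<Omega>, as gluing requires. The lower threshold is the one of
  \<open>core k\<close>.\<close>

definition layer :: "nat \<Rightarrow> 'a set" where "layer k = {x. level (k + 2) < \<theta> x \<and> \<theta> x < level k}"

lemma level_pos: "0 < level k"
  by (simp add: level_def)

lemma level_0: "level 0 = 2"
  by (simp add: level_def)

lemma level_Suc: "level (Suc k) = level k / 2"
  by (simp add: level_def)

lemma level_antimono: "j \<le> k \<Longrightarrow> level k \<le> level j"
  by (rule lift_Suc_antimono_le[of level]) (simp_all add: level_Suc less_imp_le[OF level_pos])

lemma level_less_iff: "level k < level j \<longleftrightarrow> j < k"
proof
  assume "level k < level j"
  then show "j < k" using level_antimono[of k j] by linarith
next
  assume "j < k"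
  then have "level k \<le> level (Suc j)" by (intro level_antimono) simp
  then show "level k < level j" using level_pos[of j] unfolding level_Suc by linarith
qed

lemma level_tendsto_0: "level \<longlonglongrightarrow> 0"
  using LIMSEQ_divide_realpow_zero[of 2 2] by (simp add: level_def[abs_def])

lemma ex_level_less: "0 < e \<Longrightarrow> \<exists>k. level k < e"
  using order_tendstoD(2)[OF level_tendsto_0, of e] by (auto simp: eventually_sequentially)

lemma continuous_on_\<theta>: "continuous_on UNIV \<theta>"
  by (rule lipschitz_on_continuous_on[of 1], rule lipschitz_onI)
     (use \<theta>_lipschitz in \<open>auto simp: dist_real_def\<close>)

lemma \<theta>_measurable [measurable]: "\<theta> \<in> borel_measurable borel"
  by (rule borel_measurable_continuous_onI[OF continuous_on_\<theta>])

lemma domain_eq: "\<Omega> = {x. 0 < \<theta> x}"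
  using in_domain_iff by auto

lemma open_domain: "open \<Omega>"
  unfolding domain_eq by (intro open_Collect_less continuous_on_const continuous_on_\<theta>)

lemma open_core: "open (core k)"
  unfolding core_def by (intro open_Collect_less continuous_on_const continuous_on_\<theta>)

lemma open_layer: "open (layer k)"
proof -
  have "layer k = {x. level (k + 2) < \<theta> x} \<inter> {x. \<theta> x < level k}" by (auto simp: layer_def)
  then show ?thesis by (auto intro!: open_Collect_less continuous_on_const continuous_on_\<theta>)
qed

lemma domain_borel [measurable]: "\<Omega> \<in> sets borel"
  and core_borel [measurable]: "core k \<in> sets borel"
  and layer_borel [measurable]: "layer k \<in> sets borel"
  using open_domain open_core open_layer by auto

lemmas domain_sets = borel_setsD[OF domain_borel]
lemmas core_sets = borel_setsD[OF core_borel]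
lemmas layer_sets = borel_setsD[OF layer_borel]

lemma incseq_core: "incseq core"
proof (rule incseq_SucI, rule subsetI)
  fix k x assume "x \<in> core k"
  then show "x \<in> core (Suc k)"
    using level_antimono[of "k + 2" "Suc k + 2"] unfolding core_def by simp
qed

lemma layer_subset_core: "layer k \<subseteq> core k"
  by (auto simp: layer_def core_def)

lemma core_subset: "core k \<subseteq> \<Omega>"
  unfolding core_def domain_eq using level_pos[of "k + 2"] by auto

lemma layer_subset: "layer k \<subseteq> \<Omega>"
  using layer_subset_core core_subset by blast

lemma layer_core_disjoint: "x \<in> layer j \<Longrightarrow> x \<in> core k \<Longrightarrow> j < k + 2"
  using level_less_iff[of "k + 2" j] unfolding layer_def core_def mem_Collect_eq by linarith

lemma ex_layer:
  assumes "x \<in> \<Omega>" obtains k where "x \<in> layer k"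
proof -
  have "0 < \<theta> x" using assms in_domain_iff by blast
  then obtain n where "level n < \<theta> x" using ex_level_less by blast
  then have "level (Suc n) \<le> \<theta> x" using level_antimono[of n "Suc n"] by simp
  define k where "k = (LEAST n. level (Suc n) \<le> \<theta> x)"
  have k: "level (Suc k) \<le> \<theta> x" unfolding k_def by (rule LeastI) fact
  have "\<theta> x < level k"
  proof (cases k)
    case 0 then show ?thesis using \<theta>_le_1[of x] level_0 by simp
  next
    case (Suc m)
    then have "\<not> level (Suc m) \<le> \<theta> x" using not_less_Least[of m "\<lambda>n. level (Suc n) \<le> \<theta> x"] unfolding k_def by simp
    then show ?thesis using Suc by simp
  qed
  moreover have "level (k + 2) < \<theta> x" using k level_less_iff[of "k + 2" "Suc k"] by simp
  ultimately show ?thesis using that[of k] by (simp add: layer_def)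
qed

lemma UN_layer: "(\<Union>k. layer k) = \<Omega>"
  using layer_subset ex_layer by (metis UNIV_I UN_I UN_least subsetI subset_antisym)

lemma UN_core: "(\<Union>k. core k) = \<Omega>"
  using UN_layer layer_subset_core core_subset by blast

lemma compactly_inside_core: "compactly_inside (core k) \<Omega>"
proof -
  have "closed {x. level (k + 2) \<le> \<theta> x}"
    by (intro closed_Collect_le continuous_on_const continuous_on_\<theta>)
  then have "closure (core k) \<subseteq> {x. level (k + 2) \<le> \<theta> x}"
    by (intro closure_minimal) (auto simp: core_def)
  moreover have "{x. level (k + 2) \<le> \<theta> x} \<subseteq> \<Omega>"
    using level_pos[of "k + 2"] unfolding domain_eq by auto
  ultimately show ?thesis
    using compact_superlevel[OF level_pos[of "k + 2"]]
    unfolding compactly_inside_def by (metis closed_closure compact_Int_closed inf.absorb_iff2 order_trans)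
qed

lemma compactly_inside_subset_core:
  assumes "compactly_inside V \<Omega>" obtains k where "V \<subseteq> core k"
proof -
  have "compact (closure V)" "closure V \<subseteq> (\<Union>k\<in>UNIV. core k)"
    using assms UN_core by (auto simp: compactly_inside_def)
  then obtain C where C: "finite C" "closure V \<subseteq> (\<Union>k\<in>C. core k)"
    using compactE_image[of "closure V" UNIV core] open_core by metis
  have "core k \<subseteq> core (Max (insert 0 C))" if "k \<in> C" for k
    by (rule incseqD[OF incseq_core]) (use C(1) that in simp)
  then have "V \<subseteq> core (Max (insert 0 C))" using C(2) closure_subset[of V] by blast
  then show ?thesis by (rule that)
qed

lemma L1_loc_iff: "u \<in> L1_loc M \<Omega> \<longleftrightarrow> (\<forall>k. u \<in> L1 M (core k))"
proof
  assume "u \<in> L1_loc M \<Omega>"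
  then show "\<forall>k. u \<in> L1 M (core k)"
    using open_core compactly_inside_core by (auto simp: L1_loc_def)
next
  assume "\<forall>k. u \<in> L1 M (core k)"
  then show "u \<in> L1_loc M \<Omega>"
    unfolding L1_loc_def mem_Collect_eq by (metis compactly_inside_subset_core L1_subset)
qed

lemma N11_loc_core: "u \<in> N11_loc M \<Omega> \<Longrightarrow> u \<in> N11 M (core k)"
  using open_core compactly_inside_core by (auto simp: N11_loc_def)

lemma N11_loc_measurable:
  assumes "u \<in> N11_loc M \<Omega>" shows "u \<in> borel_measurable (restrict_space M \<Omega>)"
  unfolding UN_core[symmetric]
  by (rule measurable_restrict_UN) (use N11_loc_core[OF assms] core_sets in \<open>auto simp: N11_def\<close>)

lemma enn2ereal_L1_loc_iff:
  assumes "g \<in> borel_measurable borel"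
  shows "enn2ereal \<circ> g \<in> L1_loc M \<Omega> \<longleftrightarrow> integrable_along_exhaustion core g"
proof -
  have norm: "L1_norm M H (enn2ereal \<circ> g) = (\<integral>\<^sup>+x\<in>H. g x \<partial>M)" for H
    by (simp add: L1_norm_def)
  have "(enn2ereal \<circ> g) \<in> borel_measurable (restrict_space M H)" for H
    using borel_measurable_restrict[OF assms] by (simp add: comp_def)
  then show ?thesis
    using assms norm unfolding L1_loc_iff by (auto simp: L1_def integrable_along_exhaustion_def)
qed

section \<open>Minimal weak upper gradients\<close>

text \<open>Membership in \<open>N11_loc\<close> supplies weak upper gradients on the individual
  cores, with no relation between them. They are glued along the layers; the sum defining
  \<open>G\<close> is finite on each core because only finitely many layers meet it, so local
  integrability survives.\<close>

lemma N11_loc_weak_upper_gradient: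
  assumes u: "u \<in> N11_loc M \<Omega>"
  obtains g where "integrable_along_exhaustion core g" "weak_upper_gradient M \<Omega> u g"
proof -
  have "\<exists>h. h \<in> borel_measurable borel \<and> weak_upper_gradient M (core k) u h \<and> (\<integral>\<^sup>+x\<in>core k. h x \<partial>M) < \<infinity>" for k
    using N11_loc_core[OF u, of k] unfolding N11_iff[OF core_sets] by blast
  then obtain h where h [measurable]: "\<And>k. h k \<in> borel_measurable borel"
    and wug: "\<And>k. weak_upper_gradient M (core k) u (h k)"
    and fin: "\<And>k. (\<integral>\<^sup>+x\<in>core k. h k x \<partial>M) < \<infinity>" by metis
  define G where "G x = (\<Sum>k. h k x * indicator (layer k) x)" for x
  have G [measurable]: "G \<in> borel_measurable borel" unfolding G_def by measurable
  have "weak_upper_gradient M \<Omega> u G"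
  proof (rule weak_upper_gradient_glue[where W = layer and h = h])
    show "\<Omega> \<subseteq> (\<Union>k. layer k)" using UN_layer by simp
    show "weak_upper_gradient M (layer k) u (h k)" for k
      by (rule weak_upper_gradient_mono[OF wug layer_subset_core layer_sets h]) simp
    fix k x assume "x \<in> layer k"
    then have "h k x = (\<Sum>j\<in>{k}. h j x * indicator (layer j) x)" by simp
    also have "\<dots> \<le> G x" unfolding G_def by (rule sum_le_suminf) auto
    finally show "h k x \<le> G x" .
  qed (use open_layer h G in auto)
  moreover have "(\<integral>\<^sup>+x\<in>core j. G x \<partial>M) < \<infinity>" for j
  proof -
    have "(\<integral>\<^sup>+x\<in>core j. G x \<partial>M) \<le> (\<integral>\<^sup>+x. (\<Sum>k<j + 2. h k x * indicator (core k) x) \<partial>M)"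
    proof (intro nn_integral_mono)
      fix x
      show "G x * indicator (core j) x \<le> (\<Sum>k<j + 2. h k x * indicator (core k) x)"
      proof (cases "x \<in> core j")
        case True
        have "G x = (\<Sum>k<j + 2. h k x * indicator (layer k) x)"
          unfolding G_def by (rule suminf_finite) (use layer_core_disjoint[OF _ True] in \<open>auto simp: indicator_def\<close>)
        also have "\<dots> \<le> (\<Sum>k<j + 2. h k x * indicator (core k) x)"
          using layer_subset_core by (intro sum_mono mult_left_mono) (auto simp: indicator_def)
        finally show ?thesis using True by simp
      qed simp
    qed
    also have "\<dots> = (\<Sum>k<j + 2. \<integral>\<^sup>+x\<in>core k. h k x \<partial>M)"
      by (rule nn_integral_sum) (auto intro!: borel_measurable_M)
    also have "\<dots> < \<infinity>" using fin by (simp add: ennreal_sum_less_top del: sum.lessThan_Suc)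
    finally show ?thesis .
  qed
  ultimately show ?thesis using that[of G] G by (simp add: integrable_along_exhaustion_def)
qed

text \<open>
  The minimal weak upper gradient minimizes a weighted integral that is finite for one weak upper
  gradient; a minimizing sequence may be chosen decreasing because pointwise minima are weak upper
  gradients.
\<close>

lemma minimal_weak_upper_gradient_exists:
  assumes u: "u \<in> N11_loc M \<Omega>"
  shows "\<exists>g. minimal_weak_upper_gradient M \<Omega> u g"
proof -
  define F where "F = {g. integrable_along_exhaustion core g \<and> weak_upper_gradient M \<Omega> u g}"
  have F_borel [measurable_dest]: "g \<in> borel_measurable borel" if "g \<in> F" for g
    using that by (simp add: F_def integrable_along_exhaustion_def)
  have exh: "\<And>k. open (core k)" "incseq core" "\<Omega> \<subseteq> (\<Union>k. core k)"
    using open_core incseq_core UN_core by auto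
  have F_min: "(\<lambda>x. min (g x) (h x)) \<in> F" if "g \<in> F" "h \<in> F" for g h
  proof -
    have "(\<integral>\<^sup>+x\<in>core k. min (g x) (h x) \<partial>M) \<le> (\<integral>\<^sup>+x\<in>core k. g x \<partial>M)" for k
      by (intro nn_integral_mono) (auto simp: indicator_def)
    then have "integrable_along_exhaustion core (\<lambda>x. min (g x) (h x))"
      using that F_borel[OF that(1)] F_borel[OF that(2)]
      by (auto simp: F_def integrable_along_exhaustion_def intro: le_less_trans)
    then show ?thesis using that weak_upper_gradient_min[OF exh] by (simp add: F_def)
  qed
  obtain g0 where g0: "g0 \<in> F" using N11_loc_weak_upper_gradient[OF u] by (auto simp: F_def)
  note [measurable] = F_borel[OF g0]
  obtain a where a: "\<And>k. 0 < a k" "\<And>k. a k < \<infinity>" "(\<Sum>k. a k * (\<integral>\<^sup>+x\<in>core k. g0 x \<partial>M)) < \<infinity>"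
    using ex_summable_weights[of "\<lambda>k. \<integral>\<^sup>+x\<in>core k. g0 x \<partial>M"] g0
    by (auto simp: F_def integrable_along_exhaustion_def)
  \<comment> \<open>Positivity of this weight on \<Omega> is what turns equality of weighted
    integrals into equality almost everywhere.\<close>
  define w where "w x = (\<Sum>k. a k * indicator (core k) x)" for x
  have w [measurable]: "w \<in> borel_measurable borel" unfolding w_def by measurable
  have w_pos: "0 < w x" if x: "x \<in> \<Omega>" for x
  proof -
    obtain k where k: "x \<in> core k" using x UN_core by blast
    have "(\<Sum>j\<in>{k}. a j * indicator (core j) x) \<le> w x" unfolding w_def by (rule sum_le_suminf) auto
    then show ?thesis using k a(1)[of k] by simp
  qed
  define \<Phi> where "\<Phi> g = (\<integral>\<^sup>+x. g x * w x \<partial>M)" for g :: "'a \<Rightarrow> ennreal"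
  have "\<Phi> g0 = (\<integral>\<^sup>+x. (\<Sum>k. a k * (g0 x * indicator (core k) x)) \<partial>M)"
    unfolding \<Phi>_def w_def by (intro nn_integral_cong) (simp add: ennreal_suminf_cmult[symmetric] ac_simps)
  also have "\<dots> = (\<Sum>k. a k * (\<integral>\<^sup>+x\<in>core k. g0 x \<partial>M))"
    by (subst nn_integral_suminf) (auto intro!: suminf_cong nn_integral_cmult borel_measurable_M)
  finally have \<Phi>_g0: "\<Phi> g0 < \<infinity>" using a(3) by simp
  define m where "m = (INF g\<in>F. \<Phi> g)"
  have "\<exists>f::nat \<Rightarrow> ennreal. decseq f \<and> range f \<subseteq> \<Phi> ` F \<and> Inf (\<Phi> ` F) = (INF i. f i)"
    using g0 by (intro ennreal_Inf_countable_INF) auto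
  then obtain f :: "nat \<Rightarrow> ennreal" where f: "range f \<subseteq> \<Phi> ` F" "m = (INF i. f i)"
    unfolding m_def by blast
  then have "\<forall>i. \<exists>g\<in>F. f i = \<Phi> g" by blast
  then obtain g where g: "\<And>i. g i \<in> F" "\<And>i. f i = \<Phi> (g i)" by metis
  \<comment> \<open>Running minima of a minimizing sequence: they stay in \<open>F\<close>,
    decrease, and lie below its members, so their limit is admissible and attains the
    infimum.\<close>
  define G where "G = rec_nat g0 (\<lambda>i h x. min (h x) (g i x))"
  have G_0: "G 0 = g0" and G_Suc: "G (Suc i) = (\<lambda>x. min (G i x) (g i x))" for i by (simp_all add: G_def)
  have G_F: "G i \<in> F" for i by (induction i) (simp_all add: G_0 G_Suc g0 g(1) F_min)
  have G_dec: "decseq (\<lambda>i. G i x)" for x by (rule decseq_SucI) (simp add: G_Suc)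
  define g\<^sub>m where "g\<^sub>m x = (INF i. G i x)" for x
  have gm_le: "g\<^sub>m x \<le> G i x" for x i unfolding g\<^sub>m_def by (rule INF_lower) simp
  have gm_borel [measurable]: "g\<^sub>m \<in> borel_measurable borel"
    unfolding g\<^sub>m_def using F_borel[OF G_F] by (intro borel_measurable_INF) auto
  have gm_F: "g\<^sub>m \<in> F"
  proof -
    have "weak_upper_gradient M \<Omega> u g\<^sub>m"
      unfolding g\<^sub>m_def
      by (rule weak_upper_gradient_INF[OF exh _ _ G_dec]) (use G_F in \<open>auto simp: F_def\<close>)
    moreover have "(\<integral>\<^sup>+x\<in>core k. g\<^sub>m x \<partial>M) \<le> (\<integral>\<^sup>+x\<in>core k. g0 x \<partial>M)" for k
      using gm_le[of _ 0] by (intro nn_integral_mono) (auto simp: indicator_def G_0)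
    then have "integrable_along_exhaustion core g\<^sub>m"
      using g0 gm_borel by (auto simp: F_def integrable_along_exhaustion_def intro: le_less_trans)
    ultimately show ?thesis by (simp add: F_def)
  qed
  have \<Phi>_mono: "\<Phi> h \<le> \<Phi> h'" if "\<And>x. h x \<le> h' x" for h h'
    unfolding \<Phi>_def by (intro nn_integral_mono mult_right_mono that) auto
  have \<Phi>_gm: "\<Phi> g\<^sub>m \<le> m"
    unfolding f(2)
  proof (rule INF_greatest)
    fix i
    have "g\<^sub>m x \<le> g i x" for x using gm_le[of x "Suc i"] by (simp add: G_Suc)
    then show "\<Phi> g\<^sub>m \<le> f i" unfolding g(2) by (rule \<Phi>_mono)
  qed
  have \<Phi>_fin: "\<Phi> g\<^sub>m < \<infinity>"
    using \<Phi>_mono[of g\<^sub>m g0] gm_le[of _ 0] \<Phi>_g0 by (auto simp: G_0 intro: le_less_trans)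
  have "AE x in M. x \<in> \<Omega> \<longrightarrow> g\<^sub>m x \<le> h x"
    if h: "weak_upper_gradient M \<Omega> u h" "enn2ereal \<circ> h \<in> L1_loc M \<Omega>" for h
  proof -
    obtain h' where h' [measurable]: "h' \<in> borel_measurable borel" and wug: "weak_upper_gradient M \<Omega> u h'"
      and eq: "AE x in M. x \<in> \<Omega> \<longrightarrow> h' x = h x"
      using weak_upper_gradient_borel[OF h(1) domain_sets] by metis
    have "(\<integral>\<^sup>+x\<in>core k. h' x \<partial>M) < \<infinity>" for k
    proof -
      have "(\<integral>\<^sup>+x\<in>core k. h' x \<partial>M) = (\<integral>\<^sup>+x\<in>core k. h x \<partial>M)"
        by (rule nn_integral_on_cong_AE) (use eq core_subset in \<open>auto elim!: eventually_mono\<close>)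
      then show ?thesis using h(2) unfolding L1_loc_iff by (auto simp: L1_def L1_norm_def)
    qed
    then have "h' \<in> F" using wug h' by (simp add: F_def integrable_along_exhaustion_def)
    \<comment> \<open>The minimum with a competitor lies in \<open>F\<close> and cannot have a
      smaller weighted integral. It also lies below the minimizer, whose weighted integral is
      finite, so the weighted functions agree almost everywhere.\<close>
    define k where "k x = min (g\<^sub>m x) (h' x)" for x
    have [measurable]: "k \<in> borel_measurable borel" unfolding k_def by measurable
    have "k \<in> F" unfolding k_def by (rule F_min[OF gm_F \<open>h' \<in> F\<close>])
    then have "m \<le> \<Phi> k" unfolding m_def by (rule INF_lower)
    moreover have k_le: "k x \<le> g\<^sub>m x" for x by (simp add: k_def)
    ultimately have \<Phi>_eq: "\<Phi> k = \<Phi> g\<^sub>m" using \<Phi>_gm \<Phi>_mono[of k g\<^sub>m] by auto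
    have "(\<integral>\<^sup>+x. g\<^sub>m x * w x - k x * w x \<partial>M) = \<Phi> g\<^sub>m - \<Phi> k"
      unfolding \<Phi>_def using \<Phi>_fin \<Phi>_eq
      by (intro nn_integral_diff) (auto intro!: borel_measurable_M mult_right_mono simp: k_le \<Phi>_def)
    then have "(\<integral>\<^sup>+x. g\<^sub>m x * w x - k x * w x \<partial>M) = 0" using \<Phi>_eq \<Phi>_fin by simp
    then have "AE x in M. g\<^sub>m x * w x - k x * w x = 0"
      by (subst (asm) nn_integral_0_iff_AE) (auto intro!: borel_measurable_M)
    moreover have "AE x in M. g\<^sub>m x * w x \<noteq> \<infinity>"
      using \<Phi>_fin unfolding \<Phi>_def by (intro nn_integral_PInf_AE) (auto intro!: borel_measurable_M)
    ultimately show ?thesis using eq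
    proof eventually_elim
      case (elim x)
      show ?case
      proof
        assume x: "x \<in> \<Omega>"
        show "g\<^sub>m x \<le> h x"
        proof (rule ccontr)
          assume "\<not> g\<^sub>m x \<le> h x"
          then have "k x < g\<^sub>m x" using elim(3) x by (auto simp: k_def min_def)
          \<comment> \<open>Strict monotonicity of multiplication requires a finite factor: the
            product with \<open>g\<^sub>m x\<close> is finite and \<open>g\<^sub>m x\<close> is
            positive here.\<close>
          moreover have "w x < \<infinity>"
            using elim(2) \<open>k x < g\<^sub>m x\<close> by (cases "w x") (auto simp: ennreal_mult_top split: if_splits)
          ultimately have "k x * w x < g\<^sub>m x * w x"
            using w_pos[OF x] by (intro ennreal_mult_strict_right_mono) auto
          moreover have "g\<^sub>m x * w x \<le> k x * w x" using elim(1) by (simp add: diff_eq_0_iff_ennreal)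
          ultimately show False by simp
        qed
      qed
    qed
  qed
  then have "minimal_weak_upper_gradient M \<Omega> u g\<^sub>m"
    unfolding minimal_weak_upper_gradient_def
    using gm_F enn2ereal_L1_loc_iff[OF gm_borel] by (simp add: F_def)
  then show ?thesis by blast
qed

lemma min_wug_minimal: "u \<in> N11_loc M \<Omega> \<Longrightarrow> minimal_weak_upper_gradient M \<Omega> u (min_wug M \<Omega> u)"
  unfolding min_wug_def by (rule someI_ex[OF minimal_weak_upper_gradient_exists])

text \<open>The constant sequence is admissible in the relaxation. Since
  \<open>\<infinity> - \<infinity>\<close> is not 0 in \<open>ereal\<close>, its convergence rests
  on the finiteness of \<open>u\<close> almost everywhere.\<close>

lemma N11_total_variation_le:
  assumes u: "u \<in> N11 M \<Omega>" and g: "weak_upper_gradient M \<Omega> u g" "(\<integral>\<^sup>+x\<in>\<Omega>. g x \<partial>M) < \<infinity>"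
  shows "total_variation M \<Omega> u \<le> (\<integral>\<^sup>+x\<in>\<Omega>. g x \<partial>M)"
proof -
  have loc: "u \<in> N11_loc M \<Omega>" by (rule N11_imp_N11_loc[OF u open_domain])
  obtain h where h: "h \<in> borel_measurable borel" "weak_upper_gradient M \<Omega> u h" "AE x in M. x \<in> \<Omega> \<longrightarrow> h x = g x"
    using weak_upper_gradient_borel[OF g(1) domain_sets] by metis
  have h_int: "(\<integral>\<^sup>+x\<in>\<Omega>. h x \<partial>M) = (\<integral>\<^sup>+x\<in>\<Omega>. g x \<partial>M)" by (rule nn_integral_on_cong_AE[OF h(3)])
  have "(\<integral>\<^sup>+x\<in>core k. h x \<partial>M) \<le> (\<integral>\<^sup>+x\<in>\<Omega>. h x \<partial>M)" for k
    using core_subset by (intro nn_integral_mono) (auto simp: indicator_def)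
  then have "integrable_along_exhaustion core h"
    using h(1) g(2) h_int by (auto simp: integrable_along_exhaustion_def intro: le_less_trans)
  then have "AE x in M. x \<in> \<Omega> \<longrightarrow> min_wug M \<Omega> u x \<le> h x"
    using min_wug_minimal[OF loc] h(2) enn2ereal_L1_loc_iff[OF h(1)]
    by (auto simp: minimal_weak_upper_gradient_def)
  then have "(\<integral>\<^sup>+x\<in>\<Omega>. min_wug M \<Omega> u x \<partial>M) \<le> (\<integral>\<^sup>+x\<in>\<Omega>. h x \<partial>M)"
    by (intro nn_integral_mono_AE) (auto elim!: eventually_mono simp: indicator_def)
  moreover have "total_variation M \<Omega> u \<le> liminf (\<lambda>i::nat. \<integral>\<^sup>+x\<in>\<Omega>. min_wug M \<Omega> u x \<partial>M)"
    unfolding total_variation_def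
  proof (rule INF_lower2[of "\<lambda>_. u"])
    have "AE x in M. x \<in> \<Omega> \<longrightarrow> \<bar>u x\<bar> \<noteq> \<infinity>"
      using u by (intro L1_AE_finite domain_sets) (simp add: N11_iff[OF domain_sets])
    then have "L1_norm M U (\<lambda>x. u x - u x) = 0" if "U \<subseteq> \<Omega>" for U
      unfolding L1_norm_def using that
      by (subst nn_integral_cong_AE[where v = "\<lambda>_. 0"]) (auto elim!: eventually_mono simp: indicator_def e2ennreal_neg)
    moreover have "U \<subseteq> \<Omega>" if "compactly_inside U \<Omega>" for U
      using that closure_subset[of U] by (auto simp: compactly_inside_def)
    ultimately have "L1_loc_converges M \<Omega> (\<lambda>_. u) u"
      unfolding L1_loc_converges_def by simp
    then show "(\<lambda>_. u) \<in> {us. (\<forall>i. us i \<in> N11_loc M \<Omega>) \<and> L1_loc_converges M \<Omega> us u}" using loc by simp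
  qed simp
  ultimately show ?thesis by (simp add: h_int Liminf_const)
qed

lemma N11_BV:
  assumes u: "u \<in> N11 M \<Omega>"
  shows "u \<in> BV M \<Omega>" "BV_norm M \<Omega> u \<le> N11_norm M \<Omega> u"
proof -
  obtain g where "weak_upper_gradient M \<Omega> u g" "(\<integral>\<^sup>+x\<in>\<Omega>. g x \<partial>M) < \<infinity>" "u \<in> L1 M \<Omega>"
    using u unfolding N11_iff[OF domain_sets] by blast
  then show "u \<in> BV M \<Omega>"
    using N11_total_variation_le[OF u] by (auto simp: BV_def intro: le_less_trans)
  have "total_variation M \<Omega> u \<le> (INF g \<in> {g. weak_upper_gradient M \<Omega> u g}. \<integral>\<^sup>+x\<in>\<Omega>. g x \<partial>M)"
  proof (rule INF_greatest)
    fix g assume "g \<in> {g. weak_upper_gradient M \<Omega> u g}"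
    then show "total_variation M \<Omega> u \<le> (\<integral>\<^sup>+x\<in>\<Omega>. g x \<partial>M)"
      using N11_total_variation_le[OF u, of g] by (cases "(\<integral>\<^sup>+x\<in>\<Omega>. g x \<partial>M) < \<infinity>") (auto simp: less_top[symmetric])
  qed
  then show "BV_norm M \<Omega> u \<le> N11_norm M \<Omega> u"
    unfolding BV_norm_def N11_norm_def by (rule add_left_mono)
qed

end

section \<open>Pasting an approximating sequence along the exhaustion\<close>

lemma ennreal_suminf_shift_le:
  fixes c :: "nat \<Rightarrow> ennreal"
  shows "(\<Sum>k. c (k + j)) \<le> (\<Sum>k. c k)"
proof (rule suminf_le_const[OF summableI])
  fix n
  have "(\<Sum>k<n. c (k + j)) = sum c ((\<lambda>k. k + j) ` {..<n})" by (subst sum.reindex) (auto simp: inj_on_def)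
  also have "\<dots> \<le> (\<Sum>k. c k)" by (rule sum_le_suminf) auto
  finally show "(\<Sum>k<n. c (k + j)) \<le> (\<Sum>k. c k)" .
qed

lemma ennreal_suminf_half_power:
  fixes \<kappa> :: real
  assumes "0 \<le> \<kappa>" shows "(\<Sum>k. ennreal (\<kappa> * (1/2) ^ Suc k)) = ennreal \<kappa>"
  using assms sums_mult[OF power_half_series, of \<kappa>] by (intro suminf_ennreal_eq) auto

text \<open>A third of the running minimum of \<open>b\<close> does not increase with
  \<open>k\<close>, so each of the three terms is at most a third of \<open>b k\<close>.\<close>

lemma ex_consecutive_small:
  fixes b :: "nat \<Rightarrow> real"
  assumes "\<And>k. 0 < b k"
  obtains \<epsilon> where "\<And>k. 0 < \<epsilon> k" "\<And>k. \<epsilon> k + \<epsilon> (k + 1) + \<epsilon> (k + 2) \<le> b k"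
proof
  let ?\<epsilon> = "\<lambda>k. Min (b ` {..k}) / 3"
  show "0 < ?\<epsilon> k" for k using assms by simp
  have *: "?\<epsilon> (k + i) \<le> b k / 3" for k i by (intro divide_right_mono Min_le) auto
  show "?\<epsilon> k + ?\<epsilon> (k + 1) + ?\<epsilon> (k + 2) \<le> b k" for k
    using *[of k 0] *[of k 1] *[of k 2] unfolding add_0_right by linarith
qed

lemma e2ennreal_abs_diff_triangle:
  "e2ennreal \<bar>ereal a - w\<bar> \<le> ennreal \<bar>a - b\<bar> + e2ennreal \<bar>ereal b - w\<bar>"
  "ennreal \<bar>a - b\<bar> \<le> e2ennreal \<bar>ereal a - w\<bar> + e2ennreal \<bar>ereal b - w\<bar>"
  "e2ennreal \<bar>ereal a\<bar> \<le> e2ennreal \<bar>w\<bar> + e2ennreal \<bar>ereal a - w\<bar>"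
  by (cases w; auto simp flip: ennreal_plus intro!: ennreal_leI)+

lemma e2ennreal_abs_minus_commute: "e2ennreal \<bar>a - b\<bar> = e2ennreal \<bar>b - a\<bar>" for a b :: ereal
  by (cases a; cases b) (auto simp: abs_minus_commute)

context metric_measure
begin

lemma weak_upper_gradient_cong:
  assumes "weak_upper_gradient M H u g" "\<And>x. x \<in> H \<Longrightarrow> u x = v x"
  shows "weak_upper_gradient M H v g"
proof -
  have "pathstart \<gamma> \<in> path_image \<gamma>" "pathfinish \<gamma> \<in> path_image \<gamma>" for \<gamma> :: "real \<Rightarrow> 'a" by auto
  then show ?thesis using assms unfolding weak_upper_gradient_def by (metis subsetD)
qed

lemma weak_upper_gradient_uminus:
  fixes f :: "'a \<Rightarrow> real"
  assumes "weak_upper_gradient M H (\<lambda>x. ereal (f x)) g"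
  shows "weak_upper_gradient M H (\<lambda>x. ereal (- f x)) g"
proof -
  have "abs_diff (ereal (- a)) (ereal (- b)) = abs_diff (ereal a) (ereal b)" for a b
    by (simp add: abs_minus_commute)
  then show ?thesis using assms unfolding weak_upper_gradient_def by simp
qed

end

context exhausted_domain
begin

section \<open>Cutoffs and the pasted function\<close>

text \<open>The slope is chosen so that the ramp runs exactly from 0 at \<open>level k\<close> to 1
  at \<open>level (k + 1)\<close>, since \<open>2 ^ k * level k\<close> equals 2.\<close>

definition cutoff :: "nat \<Rightarrow> 'a \<Rightarrow> real" where
  "cutoff k x = max 0 (min 1 (2 ^ k * (level k - \<theta> x)))"

text \<open>A telescoping form of a locally finite interpolation: where the cutoffs with index below
  \<open>k\<close> are 1 and the others 0, the value is \<open>f k x\<close>. Each term is a cutoff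
  times a difference, the shape handled by the cutoff rule.\<close>

definition paste :: "(nat \<Rightarrow> 'a \<Rightarrow> real) \<Rightarrow> 'a \<Rightarrow> real" where
  "paste f x = f 0 x + (\<Sum>k. cutoff k x * (f (Suc k) x - f k x))"

lemma cutoff_bounds: "0 \<le> cutoff k x" "cutoff k x \<le> 1"
  by (auto simp: cutoff_def)

lemma cutoff_lipschitz: "\<bar>cutoff k x - cutoff k y\<bar> \<le> 2 ^ k * dist x y"
proof -
  have "\<bar>cutoff k x - cutoff k y\<bar> \<le> \<bar>2 ^ k * (level k - \<theta> x) - 2 ^ k * (level k - \<theta> y)\<bar>"
    unfolding cutoff_def by linarith
  also have "\<dots> = 2 ^ k * \<bar>\<theta> x - \<theta> y\<bar>"
    unfolding right_diff_distrib[symmetric] abs_mult by (simp add: abs_minus_commute)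
  also have "\<dots> \<le> 2 ^ k * dist x y" by (intro mult_left_mono \<theta>_lipschitz) simp
  finally show ?thesis .
qed

lemma cutoff_eq_0: "level k \<le> \<theta> x \<Longrightarrow> cutoff k x = 0"
  using mult_nonneg_nonpos[of "2 ^ k" "level k - \<theta> x"] by (simp add: cutoff_def)

lemma cutoff_eq_1:
  assumes "\<theta> x \<le> level (Suc k)" shows "cutoff k x = 1"
proof -
  have "2 ^ k * level k = 2" by (simp add: level_def)
  moreover have "2 ^ k * (level k / 2) \<le> 2 ^ k * (level k - \<theta> x)"
    using assms unfolding level_Suc by (intro mult_left_mono) auto
  ultimately show ?thesis by (simp add: cutoff_def)
qed

lemma cutoff_measurable [measurable]: "cutoff k \<in> borel_measurable borel"
  unfolding cutoff_def by measurable

text \<open>On this layer the cutoffs below index \<open>k\<close> are 1 and telescope to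
  \<open>f k x - f 0 x\<close>, those from \<open>k + 2\<close> on vanish, and two transitions
  remain.\<close>

lemma paste_on_layer:
  assumes x: "x \<in> layer k"
  shows "paste f x = f k x + (cutoff k x * (f (k + 1) x - f k x) + cutoff (k + 1) x * (f (k + 2) x - f (k + 1) x))"
proof -
  have \<theta>: "level (k + 2) < \<theta> x" "\<theta> x < level k" using x by (auto simp: layer_def)
  have one: "cutoff j x = 1" if "j < k" for j
    using \<theta>(2) level_antimono[of "Suc j" k] that by (intro cutoff_eq_1) simp
  have "(\<Sum>j. cutoff j x * (f (Suc j) x - f j x)) = (\<Sum>j<k + 2. cutoff j x * (f (Suc j) x - f j x))"
  proof (rule suminf_finite)
    fix j assume "j \<notin> {..<k + 2}"
    then have "level j \<le> \<theta> x" using \<theta>(1) level_antimono[of "k + 2" j] by simp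
    then show "cutoff j x * (f (Suc j) x - f j x) = 0" by (simp add: cutoff_eq_0)
  qed simp
  also have "\<dots> = (\<Sum>j<k. cutoff j x * (f (Suc j) x - f j x))
      + cutoff k x * (f (k + 1) x - f k x) + cutoff (k + 1) x * (f (k + 2) x - f (k + 1) x)"
    by (simp add: numeral_2_eq_2)
  also have "(\<Sum>j<k. cutoff j x * (f (Suc j) x - f j x)) = (\<Sum>j<k. f (Suc j) x - f j x)"
    by (intro sum.cong) (auto simp: one)
  also have "\<dots> = f k x - f 0 x" by (rule sum_lessThan_telescope)
  finally show ?thesis by (simp add: paste_def)
qed

text \<open>The gradient produced by the sum and cutoff rules on the \<open>k\<close>-th layer, with
  \<open>p k\<close> a Borel majorant of \<open>\<bar>f (Suc k) - f k\<bar>\<close>. No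
  \<open>g j\<close> occurs more than twice.\<close>

definition paste_gradient :: "(nat \<Rightarrow> 'a \<Rightarrow> ennreal) \<Rightarrow> (nat \<Rightarrow> 'a \<Rightarrow> ennreal) \<Rightarrow> nat \<Rightarrow> 'a \<Rightarrow> ennreal" where
  "paste_gradient g p k x = g k x + (((g (k + 1) x + g k x) + ennreal (2 ^ k) * p k x)
     + ((g (k + 2) x + g (k + 1) x) + ennreal (2 ^ (k + 1)) * p (k + 1) x))"

text \<open>On a layer the series reduces to three summands, to which the calculus rules apply.
  Differences are written as sums with a negated function so that the sum rule covers them.\<close>

lemma paste_weak_upper_gradient_layer:
  assumes f: "\<And>k. weak_upper_gradient M \<Omega> (\<lambda>x. ereal (f k x)) (g k)" "\<And>k. g k \<in> borel_measurable borel"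
    and p: "\<And>k. p k \<in> borel_measurable borel" "\<And>k x. x \<in> \<Omega> \<Longrightarrow> ennreal \<bar>f (Suc k) x - f k x\<bar> \<le> p k x"
  shows "weak_upper_gradient M (layer k) (\<lambda>x. ereal (paste f x)) (paste_gradient g p k)"
proof -
  note [measurable] = f(2) p(1)
  have wug: "weak_upper_gradient M (layer j) (\<lambda>x. ereal (f k x)) (g k)" for j k
    by (rule weak_upper_gradient_mono[OF f(1) layer_subset layer_sets f(2)]) simp
  have diff: "weak_upper_gradient M (layer j) (\<lambda>x. ereal (f (k + 1) x + - f k x)) (\<lambda>x. g (k + 1) x + g k x)" for j k
    by (intro weak_upper_gradient_add weak_upper_gradient_uminus wug f(2))
  have cut: "weak_upper_gradient M (layer j) (\<lambda>x. ereal (cutoff k x * (f (k + 1) x + - f k x)))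
    (\<lambda>x. (g (k + 1) x + g k x) + ennreal (2 ^ k) * p k x)" for j k
    by (rule weak_upper_gradient_cutoff[OF diff])
       (use p(2)[of _ k] layer_subset[of j] cutoff_bounds cutoff_lipschitz in auto)
  have "weak_upper_gradient M (layer k)
    (\<lambda>x. ereal (f k x + (cutoff k x * (f (k + 1) x + - f k x) + cutoff (k + 1) x * (f (k + 1 + 1) x + - f (k + 1) x))))
    (\<lambda>x. g k x + (((g (k + 1) x + g k x) + ennreal (2 ^ k) * p k x)
      + ((g (k + 1 + 1) x + g (k + 1) x) + ennreal (2 ^ (k + 1)) * p (k + 1) x)))"
    by (intro weak_upper_gradient_add wug f(2) cut) measurable
  then have "weak_upper_gradient M (layer k)
    (\<lambda>x. ereal (f k x + (cutoff k x * (f (k + 1) x + - f k x) + cutoff (k + 1) x * (f (k + 1 + 1) x + - f (k + 1) x))))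
    (paste_gradient g p k)"
    unfolding paste_gradient_def[abs_def] by (simp add: numeral_2_eq_2)
  then show ?thesis
    by (rule weak_upper_gradient_cong) (simp add: paste_on_layer numeral_2_eq_2)
qed

lemma paste_weak_upper_gradient:
  assumes f: "\<And>k. weak_upper_gradient M \<Omega> (\<lambda>x. ereal (f k x)) (g k)" "\<And>k. g k \<in> borel_measurable borel"
    and p: "\<And>k. p k \<in> borel_measurable borel" "\<And>k x. x \<in> \<Omega> \<Longrightarrow> ennreal \<bar>f (Suc k) x - f k x\<bar> \<le> p k x"
  shows "weak_upper_gradient M \<Omega> (\<lambda>x. ereal (paste f x)) (\<lambda>x. \<Sum>k. paste_gradient g p k x * indicator (layer k) x)"
proof (rule weak_upper_gradient_glue[where W = layer and h = "paste_gradient g p"])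
  note [measurable] = f(2) p(1)
  show [measurable]: "paste_gradient g p k \<in> borel_measurable borel" for k
    unfolding paste_gradient_def[abs_def] by measurable
  show "(\<lambda>x. \<Sum>k. paste_gradient g p k x * indicator (layer k) x) \<in> borel_measurable borel" by measurable
  show "\<Omega> \<subseteq> (\<Union>k. layer k)" using UN_layer by simp
  show "weak_upper_gradient M (layer k) (\<lambda>x. ereal (paste f x)) (paste_gradient g p k)" for k
    by (rule paste_weak_upper_gradient_layer) (use f p in auto)
  fix k x assume "x \<in> layer k"
  then have "paste_gradient g p k x = (\<Sum>j\<in>{k}. paste_gradient g p j x * indicator (layer j) x)" by simp
  also have "\<dots> \<le> (\<Sum>k. paste_gradient g p k x * indicator (layer k) x)" by (rule sum_le_suminf) auto
  finally show "paste_gradient g p k x \<le> (\<Sum>k. paste_gradient g p k x * indicator (layer k) x)" .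
qed (rule open_layer)

lemma measurable_on_layer:
  fixes f :: "'a \<Rightarrow> ennreal"
  assumes f: "(\<lambda>x. f x * indicator \<Omega> x) \<in> borel_measurable M" and B: "B \<in> sets M"
  shows "(\<lambda>x. f x * indicator (B \<inter> layer k) x) \<in> borel_measurable M"
proof -
  have "(\<lambda>x. f x * indicator \<Omega> x * indicator (B \<inter> layer k) x) \<in> borel_measurable M"
    using f B layer_sets by measurable
  also have "(\<lambda>x. f x * indicator \<Omega> x * indicator (B \<inter> layer k) x) = (\<lambda>x. f x * indicator (B \<inter> layer k) x)"
    using layer_subset by (intro ext) (auto simp: indicator_def)
  finally show ?thesis .
qed

lemma nn_integral_le_suminf_layers:
  fixes f :: "'a \<Rightarrow> ennreal"
  assumes f: "(\<lambda>x. f x * indicator \<Omega> x) \<in> borel_measurable M" and B: "B \<in> sets M"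
  shows "(\<integral>\<^sup>+x\<in>B \<inter> \<Omega>. f x \<partial>M) \<le> (\<Sum>k. \<integral>\<^sup>+x\<in>B \<inter> layer k. f x \<partial>M)"
proof -
  note [measurable] = measurable_on_layer[OF f B]
  have "(\<integral>\<^sup>+x\<in>B \<inter> \<Omega>. f x \<partial>M) \<le> (\<integral>\<^sup>+x. (\<Sum>k. f x * indicator (B \<inter> layer k) x) \<partial>M)"
  proof (intro nn_integral_mono)
    fix x
    show "f x * indicator (B \<inter> \<Omega>) x \<le> (\<Sum>k. f x * indicator (B \<inter> layer k) x)"
    proof (cases "x \<in> B \<inter> \<Omega>")
      case True
      then obtain k where "x \<in> layer k" using ex_layer by blast
      then have "f x * indicator (B \<inter> \<Omega>) x = (\<Sum>j\<in>{k}. f x * indicator (B \<inter> layer j) x)" using True by simp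
      also have "\<dots> \<le> (\<Sum>k. f x * indicator (B \<inter> layer k) x)" by (rule sum_le_suminf) auto
      finally show ?thesis .
    qed simp
  qed
  also have "\<dots> = (\<Sum>k. \<integral>\<^sup>+x\<in>B \<inter> layer k. f x \<partial>M)" by (rule nn_integral_suminf) measurable
  finally show ?thesis .
qed

section \<open>Overlap of energies and closeness at the boundary\<close>

text \<open>The member \<open>f k\<close> of the sequence enters the interpolation on the layers
  \<open>k - 2\<close>, \<open>k - 1\<close> and \<open>k\<close>. The bound
  \<open>4 * level k\<close>, which is the upper end of layer \<open>k - 2\<close>, makes one set
  contain all of them.\<close>

definition wide_layer :: "nat \<Rightarrow> 'a set" where
  "wide_layer k = {x. level (k + 2) < \<theta> x \<and> \<theta> x < 4 * level k}"

lemma layer_subset_wide_layer: "layer k \<subseteq> wide_layer k" "layer k \<subseteq> wide_layer (k + 1)" "layer k \<subseteq> wide_layer (k + 2)"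
  using level_pos[of k] by (auto simp: layer_def wide_layer_def level_Suc numeral_2_eq_2)

lemma wide_layer_borel [measurable]: "wide_layer k \<in> sets borel"
  unfolding wide_layer_def by measurable

text \<open>If \<open>n\<close> is the first index with \<open>x\<close> in the wide layer, then
  \<theta>\<open>x\<close> exceeds \<open>level (n + 2)\<close>, which is at least
  \<open>4 * level k\<close> for \<open>k \<ge> n + 4\<close>. Hence at most the indices
  \<open>n\<close> to \<open>n + 3\<close> occur.\<close>

lemma wide_layer_overlap: "(\<Sum>k. indicator (wide_layer k) x :: ennreal) \<le> 4 * indicator \<Omega> x"
proof (cases "\<exists>k. x \<in> wide_layer k")
  case False
  then show ?thesis by simp
next
  case True
  define n where "n = (LEAST k. x \<in> wide_layer k)"
  have n: "x \<in> wide_layer n" unfolding n_def using True by (rule LeastI_ex)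
  then have \<theta>: "level (n + 2) < \<theta> x" by (simp add: wide_layer_def)
  then have "x \<in> \<Omega>" using level_pos[of "n + 2"] by (simp add: in_domain_iff)
  have range: "k \<in> {n..<n + 4}" if k: "x \<in> wide_layer k" for k
  proof -
    have "n \<le> k" unfolding n_def by (rule Least_le) fact
    moreover have "k < n + 4"
    proof (rule ccontr)
      assume "\<not> k < n + 4"
      then have "level k \<le> level (n + 2 + 2)" by (intro level_antimono) simp
      then have "4 * level k \<le> level (n + 2)" by (simp add: level_Suc numeral_2_eq_2)
      then show False using k \<theta> by (simp add: wide_layer_def)
    qed
    ultimately show ?thesis by simp
  qed
  have "(\<Sum>k. indicator (wide_layer k) x :: ennreal) = (\<Sum>k\<in>{n..<n + 4}. indicator (wide_layer k) x)"
    by (rule suminf_finite) (use range in \<open>auto simp: indicator_def\<close>)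
  also have "\<dots> \<le> (\<Sum>k\<in>{n..<n + 4}. 1)" by (intro sum_mono) (auto simp: indicator_def)
  finally show ?thesis using \<open>x \<in> \<Omega>\<close> by simp
qed

lemma suminf_wide_layer_le:
  assumes [measurable]: "g \<in> borel_measurable borel"
  shows "(\<Sum>k. \<integral>\<^sup>+x\<in>wide_layer k. g x \<partial>M) \<le> 4 * (\<integral>\<^sup>+x\<in>\<Omega>. g x \<partial>M)"
proof -
  have "(\<Sum>k. \<integral>\<^sup>+x\<in>wide_layer k. g x \<partial>M) = (\<integral>\<^sup>+x. (\<Sum>k. g x * indicator (wide_layer k) x) \<partial>M)"
    by (rule nn_integral_suminf[symmetric]) (intro borel_measurable_M, measurable)
  also have "\<dots> \<le> (\<integral>\<^sup>+x. 4 * (g x * indicator \<Omega> x) \<partial>M)"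
    using mult_left_mono[OF wide_layer_overlap] by (intro nn_integral_mono) (simp add: ac_simps)
  also have "\<dots> = 4 * (\<integral>\<^sup>+x\<in>\<Omega>. g x \<partial>M)"
    by (rule nn_integral_cmult) (intro borel_measurable_M, measurable)
  finally show ?thesis .
qed

text \<open>The limit in the definition of a trace, with a function in place of the constant; the
  triangle inequality then transports traces pointwise between \<open>u\<close> and
  \<open>v\<close>.\<close>

definition close_at :: "('a \<Rightarrow> ereal) \<Rightarrow> ('a \<Rightarrow> ereal) \<Rightarrow> 'a \<Rightarrow> bool" where
  "close_at u v x \<longleftrightarrow>
     ((\<lambda>r. (\<integral>\<^sup>+y\<in>ball x r \<inter> \<Omega>. e2ennreal \<bar>u y - v y\<bar> \<partial>M) / emeasure M (ball x r \<inter> \<Omega>)) \<longlongrightarrow> 0) (at_right 0)"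

text \<open>
  A ball centred at \<open>x\<close> on the boundary that meets the \<open>k\<close>-th layer has radius at least
  \<open>level (k + 2)\<close>, so the measure of its part in \<open>\<Omega>\<close> is bounded below in terms of \<open>k\<close> only.
\<close>

lemma close_at_if_small_on_layers:
  obtains m :: "nat \<Rightarrow> real" where "\<And>k. 0 < m k"
    "\<And>u v x. \<lbrakk>u \<in> borel_measurable (restrict_space M \<Omega>); v \<in> borel_measurable (restrict_space M \<Omega>);
        \<And>k. (\<integral>\<^sup>+y\<in>layer k. e2ennreal \<bar>u y - v y\<bar> \<partial>M) \<le> ennreal ((1/2) ^ k * ((1/2) ^ Suc k * m k));
        x \<in> frontier \<Omega>\<rbrakk> \<Longrightarrow> close_at u v x"
proof -
  have "\<exists>m>0. \<forall>x\<in>frontier \<Omega>. \<forall>y. level (k + 2) \<le> \<theta> y \<and> dist x y \<le> 1 \<longrightarrow>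
    ennreal m \<le> emeasure M (ball x (level (k + 2)) \<inter> \<Omega>)" for k
  proof -
    fix x0 :: 'a
    have "bounded {y. level (k + 2) \<le> \<theta> y}"
      by (rule compact_imp_bounded[OF compact_superlevel[OF level_pos]])
    then obtain R where R: "\<And>y. level (k + 2) \<le> \<theta> y \<Longrightarrow> dist x0 y \<le> R" unfolding bounded_any_center[of _ x0] by blast
    \<comment> \<open>The frontier itself may be unbounded. Only its points within distance 1 of the
      superlevel set are relevant, and they lie in this compact part.\<close>
    have "compact (frontier \<Omega> \<inter> cball x0 (R + 1))"
      by (rule compact_if_closed_bounded[of _ x0 "R + 2"]) auto
    then obtain m :: real where m: "0 < m"
      "\<And>x. x \<in> frontier \<Omega> \<inter> cball x0 (R + 1) \<Longrightarrow> ennreal m \<le> emeasure M (ball x (level (k + 2)) \<inter> \<Omega>)"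
      using emeasure_frontier_ball_lower_bound[of _ \<Omega> "level (k + 2)"] open_domain level_pos
      by (metis Int_iff frontier_def DiffD1 subsetI)
    have "ennreal m \<le> emeasure M (ball x (level (k + 2)) \<inter> \<Omega>)"
      if "x \<in> frontier \<Omega>" "level (k + 2) \<le> \<theta> y" "dist x y \<le> 1" for x y
      using R[OF that(2)] that dist_triangle[of x0 x y] by (intro m(2)) (auto simp: dist_commute)
    then show ?thesis using m(1) by blast
  qed
  then obtain m :: "nat \<Rightarrow> real" where m_pos: "\<And>k. 0 < m k"
    and m: "\<And>k x y. x \<in> frontier \<Omega> \<Longrightarrow> level (k + 2) \<le> \<theta> y \<Longrightarrow> dist x y \<le> 1 \<Longrightarrow>
      ennreal (m k) \<le> emeasure M (ball x (level (k + 2)) \<inter> \<Omega>)"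
    by metis
  show ?thesis
  proof (rule that[OF m_pos])
    fix u v :: "'a \<Rightarrow> ereal" and x
    assume uv: "u \<in> borel_measurable (restrict_space M \<Omega>)" "v \<in> borel_measurable (restrict_space M \<Omega>)"
      and small: "\<And>k. (\<integral>\<^sup>+y\<in>layer k. e2ennreal \<bar>u y - v y\<bar> \<partial>M) \<le> ennreal ((1/2) ^ k * ((1/2) ^ Suc k * m k))"
      and x: "x \<in> frontier \<Omega>"
    have "x \<notin> \<Omega>" using x open_domain by (simp add: frontier_def interior_open)
    then have "\<theta> x = 0" using \<theta>_nonneg[of x] in_domain_iff[of x] by simp
    then have \<theta>_ball: "\<theta> y < r" if "y \<in> ball x r" for y r
      using \<theta>_lipschitz[of y x] that by (simp add: dist_commute)
    define e where "e r = emeasure M (ball x r \<inter> \<Omega>)" for r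
    define d where "d y = e2ennreal \<bar>u y - v y\<bar>" for y
    have "(\<lambda>y. u y - v y) \<in> borel_measurable (restrict_space M \<Omega>)" using uv by measurable
    then have d: "(\<lambda>y. d y * indicator \<Omega> y) \<in> borel_measurable M"
      unfolding d_def by (rule L1_normI[OF _ domain_sets])
    have half_power_nonneg: "0 \<le> (1/2 :: real) ^ N" for N by simp
    \<comment> \<open>A ball of radius at most \<open>level (N + 2)\<close> reaches only layers with
      \<open>k \<ge> N\<close>. In the tolerance on such a layer, \<open>(1/2) ^ k\<close> then
      yields the decay, \<open>(1/2) ^ Suc k\<close> yields summability over the layers, and
      \<open>m k\<close> is absorbed by \<open>e r\<close>.\<close>
    have ratio: "(\<integral>\<^sup>+y\<in>ball x r \<inter> \<Omega>. d y \<partial>M) / e r \<le> ennreal ((1/2) ^ N)"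
      if r: "0 < r" "r \<le> 1" "r \<le> level (N + 2)" for r N
    proof -
      have e_fin: "e r < \<infinity>"
        using emeasure_mono[of "ball x r \<inter> \<Omega>" "ball x r" M] emeasure_ball(2)[OF r(1), of x]
        by (auto simp: e_def intro: le_less_trans)
      have "(\<integral>\<^sup>+y\<in>ball x r \<inter> layer k. d y \<partial>M) \<le> ennreal ((1/2) ^ N * (1/2) ^ Suc k) * e r" for k
      proof (cases "ball x r \<inter> layer k = {}")
        case True
        then show ?thesis by simp
      next
        case False
        then obtain y where y: "y \<in> ball x r" "level (k + 2) < \<theta> y" by (auto simp: layer_def)
        have k_r: "level (k + 2) < r" using \<theta>_ball[OF y(1)] y(2) by simp
        then have "N \<le> k" using r(3) level_less_iff[of "k + 2" "N + 2"] by simp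
        have "ennreal (m k) \<le> emeasure M (ball x (level (k + 2)) \<inter> \<Omega>)"
          using y r(2) by (intro m[OF x, of k y]) auto
        also have "\<dots> \<le> e r"
          unfolding e_def using k_r domain_sets by (intro emeasure_mono) (auto intro: sets.Int)
        finally have mk: "ennreal (m k) \<le> e r" .
        have "(\<integral>\<^sup>+y\<in>ball x r \<inter> layer k. d y \<partial>M) \<le> (\<integral>\<^sup>+y\<in>layer k. d y \<partial>M)"
          by (intro nn_integral_mono) (auto simp: indicator_def)
        also have "\<dots> \<le> ennreal ((1/2) ^ k * ((1/2) ^ Suc k * m k))" unfolding d_def by (rule small)
        also have "\<dots> \<le> ennreal ((1/2) ^ N * ((1/2) ^ Suc k * m k))"
          using m_pos[of k] \<open>N \<le> k\<close> by (intro ennreal_leI mult_right_mono power_decreasing) auto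
        also have "\<dots> = ennreal ((1/2) ^ N * (1/2) ^ Suc k) * ennreal (m k)"
          using m_pos[of k] by (subst ennreal_mult[symmetric]) (auto simp: mult.assoc)
        also have "\<dots> \<le> ennreal ((1/2) ^ N * (1/2) ^ Suc k) * e r" by (intro mult_left_mono mk) simp
        finally show ?thesis .
      qed
      then have "(\<integral>\<^sup>+y\<in>ball x r \<inter> \<Omega>. d y \<partial>M) \<le> (\<Sum>k. ennreal ((1/2) ^ N * (1/2) ^ Suc k) * e r)"
        by (intro order_trans[OF nn_integral_le_suminf_layers[OF d ball_sets]] suminf_le) auto
      also have "\<dots> = ennreal ((1/2) ^ N) * e r"
        by (simp only: ennreal_suminf_multc ennreal_suminf_half_power[OF half_power_nonneg])
      finally have *: "(\<integral>\<^sup>+y\<in>ball x r \<inter> \<Omega>. d y \<partial>M) \<le> ennreal ((1/2) ^ N) * e r" .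
      show ?thesis
      \<comment> \<open>If \<open>e r\<close> is 0, the numerator is 0 as well, and
        \<open>0 / 0 = 0\<close> in \<open>ennreal\<close>.\<close>
      proof (cases "e r = 0")
        case True
        then show ?thesis using * by simp
      next
        case False
        then show ?thesis using e_fin divide_right_mono_ennreal[OF *, of "e r"]
          by (simp add: ennreal_mult_divide_eq)
      qed
    qed
    show "close_at u v x"
      unfolding close_at_def d_def[symmetric] e_def[symmetric]
    proof (rule order_tendstoI)
      fix y :: ennreal assume y: "0 < y"
      have "(\<lambda>N. ennreal ((1/2) ^ N)) \<longlonglongrightarrow> ennreal 0"
        by (intro tendsto_ennrealI LIMSEQ_power_zero) auto
      then have "\<forall>\<^sub>F N in sequentially. ennreal ((1/2) ^ N) < y" using y by (intro order_tendstoD(2)) auto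
      then obtain N where N: "ennreal ((1/2) ^ N) < y" by (auto simp: eventually_sequentially)
      have "\<forall>\<^sub>F r in at_right 0. r \<in> {0<..<min 1 (level (N + 2))}"
        using level_pos[of "N + 2"] by (intro eventually_at_right_real) auto
      then show "\<forall>\<^sub>F r in at_right 0. (\<integral>\<^sup>+y\<in>ball x r \<inter> \<Omega>. d y \<partial>M) / e r < y"
        by eventually_elim (use le_less_trans[OF ratio N] in auto)
    qed simp
  qed
qed

section \<open>Approximation with the same boundary behaviour\<close>

text \<open>The strict bound on the relaxed energy provides a sequence whose lower limit is below
  \<open>A\<close>; a subsequence has all its energies below \<open>A\<close>. Infinite values,
  which occur on null sets only, are then removed and the minimal gradients replaced by Borel
  ones.\<close>

lemma total_variation_approximants:
  assumes u: "u \<in> L1 M \<Omega>" and A: "total_variation M \<Omega> u < ennreal A"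
  obtains F :: "nat \<Rightarrow> 'a \<Rightarrow> real" and h :: "nat \<Rightarrow> 'a \<Rightarrow> ennreal" where
    "\<And>i. F i \<in> borel_measurable (restrict_space M \<Omega>)"
    "\<And>i. h i \<in> borel_measurable borel"
    "\<And>i. weak_upper_gradient M \<Omega> (\<lambda>x. ereal (F i x)) (h i)"
    "\<And>i. (\<integral>\<^sup>+x\<in>\<Omega>. h i x \<partial>M) \<le> ennreal A"
    "\<And>k. (\<lambda>i. L1_norm M (core k) (\<lambda>x. ereal (F i x) - u x)) \<longlonglongrightarrow> 0"
proof -
  obtain us where us: "\<And>i. us i \<in> N11_loc M \<Omega>" and conv: "L1_loc_converges M \<Omega> us u"
    and lim: "liminf (\<lambda>i. \<integral>\<^sup>+x\<in>\<Omega>. min_wug M \<Omega> (us i) x \<partial>M) < ennreal A"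
    using A unfolding total_variation_def by (auto simp: INF_less_iff)
  have "\<exists>i\<ge>n. (\<integral>\<^sup>+x\<in>\<Omega>. min_wug M \<Omega> (us i) x \<partial>M) < ennreal A" for n
  proof (rule ccontr)
    assume "\<not> ?thesis"
    then have "\<forall>\<^sub>F i in sequentially. ennreal A \<le> (\<integral>\<^sup>+x\<in>\<Omega>. min_wug M \<Omega> (us i) x \<partial>M)"
      unfolding eventually_sequentially by (meson not_le)
    then have "ennreal A \<le> liminf (\<lambda>i. \<integral>\<^sup>+x\<in>\<Omega>. min_wug M \<Omega> (us i) x \<partial>M)" by (rule Liminf_bounded)
    with lim show False by simp
  qed
  then obtain r where r: "\<And>n. n \<le> r n" "\<And>n. (\<integral>\<^sup>+x\<in>\<Omega>. min_wug M \<Omega> (us (r n)) x \<partial>M) < ennreal A"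
    by metis
  have r_lim: "filterlim r sequentially sequentially"
    by (rule filterlim_at_top_mono[OF filterlim_ident]) (simp add: r(1))
  have "\<exists>h. h \<in> borel_measurable borel \<and> weak_upper_gradient M \<Omega> (us (r n)) h \<and>
    (\<integral>\<^sup>+x\<in>\<Omega>. h x \<partial>M) \<le> ennreal A" for n
  proof -
    have "weak_upper_gradient M \<Omega> (us (r n)) (min_wug M \<Omega> (us (r n)))"
      using min_wug_minimal[OF us] by (simp add: minimal_weak_upper_gradient_def)
    then obtain h where h: "h \<in> borel_measurable borel" "weak_upper_gradient M \<Omega> (us (r n)) h"
      "AE x in M. x \<in> \<Omega> \<longrightarrow> h x = min_wug M \<Omega> (us (r n)) x"
      using weak_upper_gradient_borel[OF _ domain_sets] by metis
    then show ?thesis using nn_integral_on_cong_AE[OF h(3)] r(2)[of n] by (auto simp: less_imp_le)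
  qed
  then obtain h where h: "\<And>n. h n \<in> borel_measurable borel" "\<And>n. weak_upper_gradient M \<Omega> (us (r n)) (h n)"
    "\<And>n. (\<integral>\<^sup>+x\<in>\<Omega>. h n x \<partial>M) \<le> ennreal A" by metis
  show ?thesis
  proof (rule that[of "\<lambda>n x. real_of_ereal (us (r n) x)" h])
    show "(\<lambda>x. real_of_ereal (us (r n) x)) \<in> borel_measurable (restrict_space M \<Omega>)" for n
      using N11_loc_measurable[OF us[of "r n"]] by measurable
    show "weak_upper_gradient M \<Omega> (\<lambda>x. ereal (real_of_ereal (us (r n) x))) (h n)" for n
      by (rule weak_upper_gradient_real_of_ereal[OF h(2)])
    fix k
    have "L1_norm M (core k) (\<lambda>x. ereal (real_of_ereal (us (r n) x)) - u x)
      = L1_norm M (core k) (\<lambda>x. us (r n) x - u x)" for n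
    proof -
      have "us (r n) \<in> L1 M (core k)"
        using N11_loc_core[OF us[of "r n"], of k] unfolding N11_iff[OF core_sets] by blast
      then have "AE x in M. x \<in> core k \<longrightarrow> \<bar>us (r n) x\<bar> \<noteq> \<infinity>" by (rule L1_AE_finite[OF _ core_sets])
      then show ?thesis
        unfolding L1_norm_def
        by (intro nn_integral_on_cong_AE) (auto elim!: eventually_mono simp: ereal_real)
    qed
    moreover have "(\<lambda>i. L1_norm M (core k) (\<lambda>x. us i x - u x)) \<longlonglongrightarrow> 0"
      using conv open_core compactly_inside_core by (auto simp: L1_loc_converges_def)
    ultimately show "(\<lambda>n. L1_norm M (core k) (\<lambda>x. ereal (real_of_ereal (us (r n) x)) - u x)) \<longlonglongrightarrow> 0"
      using filterlim_compose[OF _ r_lim] by (simp add: comp_def)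
  qed (use h in auto)
qed

text \<open>
  By Fatou's lemma the lower limits of the energies on the wide layers have a sum controlled by
  the total energy, so that on each layer one may pick a far out member of the sequence whose
  energy there is close to the lower limit.
\<close>

lemma layerwise_selection:
  fixes h :: "nat \<Rightarrow> 'a \<Rightarrow> ennreal" and D :: "nat \<Rightarrow> nat \<Rightarrow> ennreal"
  assumes h: "\<And>i. h i \<in> borel_measurable borel" "\<And>i. (\<integral>\<^sup>+x\<in>\<Omega>. h i x \<partial>M) \<le> ennreal A"
    and D: "\<And>k. (\<lambda>i. D k i) \<longlonglongrightarrow> 0" and \<epsilon>: "\<And>k. 0 < \<epsilon> k" and \<kappa>: "0 < \<kappa>"
  obtains s where "\<And>k. D k (s k) \<le> ennreal (\<epsilon> k)"
    "(\<Sum>k. \<integral>\<^sup>+x\<in>wide_layer k. h (s k) x \<partial>M) \<le> 4 * ennreal A + ennreal \<kappa>"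
proof -
  define X where "X i k = (\<integral>\<^sup>+x\<in>wide_layer k. h i x \<partial>M)" for i k
  define a where "a k = liminf (\<lambda>i. X i k)" for k
  have X_sum: "(\<Sum>k. X i k) \<le> 4 * ennreal A" for i
    unfolding X_def by (rule order_trans[OF suminf_wide_layer_le[OF h(1)]]) (intro mult_left_mono h(2), simp)
  \<comment> \<open>The sum over layers is an integral for counting measure, so Fatou's lemma
    applies with the layer index as the variable.\<close>
  have "(\<Sum>k. a k) = (\<integral>\<^sup>+k. liminf (\<lambda>i. X i k) \<partial>count_space UNIV)"
    by (simp add: nn_integral_count_space_nat a_def)
  also have "\<dots> \<le> liminf (\<lambda>i. \<integral>\<^sup>+k. X i k \<partial>count_space UNIV)"
    by (rule nn_integral_liminf) simp
  also have "\<dots> \<le> liminf (\<lambda>i::nat. 4 * ennreal A)"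
    by (intro Liminf_mono always_eventually allI) (simp add: nn_integral_count_space_nat X_sum)
  finally have a_sum: "(\<Sum>k. a k) \<le> 4 * ennreal A" by (simp add: Liminf_const)
  have "\<exists>i. X i k \<le> a k + ennreal (\<kappa> * (1/2) ^ Suc k) \<and> D k i \<le> ennreal (\<epsilon> k)" for k
  proof -
    define y where "y = a k + ennreal (\<kappa> * (1/2) ^ Suc k)"
    \<comment> \<open>The lower limit must be finite for adding a positive constant to it to be a
      strict increase.\<close>
    have "(\<Sum>j\<in>{k}. a j) \<le> (\<Sum>j. a j)" by (rule sum_le_suminf) auto
    then have "a k \<le> 4 * ennreal A" using a_sum by simp
    also have "\<dots> < \<infinity>" by (simp add: ennreal_mult_less_top)
    finally have "a k < \<infinity>" .
    then have "a k < y" using \<kappa> unfolding y_def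
      by (cases "a k") (auto simp flip: ennreal_plus intro!: ennreal_lessI add_nonneg_pos)
    have "\<forall>\<^sub>F i in sequentially. D k i < ennreal (\<epsilon> k)"
      using D[of k] \<epsilon>[of k] by (auto intro: order_tendstoD(2))
    then obtain n where n: "\<And>i. n \<le> i \<Longrightarrow> D k i < ennreal (\<epsilon> k)" by (auto simp: eventually_sequentially)
    have "\<exists>i\<ge>n. X i k < y"
    proof (rule ccontr)
      assume "\<not> ?thesis"
      then have "\<forall>\<^sub>F i in sequentially. y \<le> X i k" unfolding eventually_sequentially by (meson not_le)
      then have "y \<le> a k" unfolding a_def by (rule Liminf_bounded)
      with \<open>a k < y\<close> show False by simp
    qed
    then show ?thesis using n unfolding y_def by (meson less_imp_le)
  qed
  then obtain s where s: "\<And>k. X (s k) k \<le> a k + ennreal (\<kappa> * (1/2) ^ Suc k)" "\<And>k. D k (s k) \<le> ennreal (\<epsilon> k)"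
    by metis
  have "(\<Sum>k. X (s k) k) \<le> (\<Sum>k. a k + ennreal (\<kappa> * (1/2) ^ Suc k))" by (intro suminf_le s) auto
  also have "\<dots> = (\<Sum>k. a k) + (\<Sum>k. ennreal (\<kappa> * (1/2) ^ Suc k))" by (intro suminf_add[symmetric]) auto
  also have "\<dots> \<le> 4 * ennreal A + ennreal \<kappa>"
    unfolding ennreal_suminf_half_power[OF less_imp_le[OF \<kappa>]] by (intro add_right_mono a_sum)
  finally show ?thesis using that[OF s(2)] by (simp only: X_def)
qed

text \<open>The energy part is \<open>2 * 3 * (4 * A +\<close> \<kappa>\<open>) +\<close> \<kappa>:
  double counting in \<open>paste_gradient\<close>, three shifted copies of the layerwise energies,
  their total, and the transition terms. One more \<kappa> is the L1 distance of the companion to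
  \<open>u\<close>.\<close>

theorem BV_N11_approximation:
  assumes u: "u \<in> L1 M \<Omega>" and A: "total_variation M \<Omega> u < ennreal A" and \<kappa>: "0 < \<kappa>"
  obtains v :: "'a \<Rightarrow> real" where "(\<lambda>x. ereal (v x)) \<in> N11 M \<Omega>"
    "N11_norm M \<Omega> (\<lambda>x. ereal (v x)) \<le> L1_norm M \<Omega> u + ennreal (24 * A + 8 * \<kappa>)"
    "\<And>x. x \<in> frontier \<Omega> \<Longrightarrow> close_at (\<lambda>x. ereal (v x)) u x"
proof -
  have "0 < A" using A by (cases "0 < A") (auto simp: ennreal_neg)
  have u_meas: "u \<in> borel_measurable (restrict_space M \<Omega>)" using u by (simp add: L1_def)
  obtain m :: "nat \<Rightarrow> real" where m: "\<And>k. 0 < m k"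
    and close: "\<And>u v x. \<lbrakk>u \<in> borel_measurable (restrict_space M \<Omega>); v \<in> borel_measurable (restrict_space M \<Omega>);
        \<And>k. (\<integral>\<^sup>+y\<in>layer k. e2ennreal \<bar>u y - v y\<bar> \<partial>M) \<le> ennreal ((1/2) ^ k * ((1/2) ^ Suc k * m k));
        x \<in> frontier \<Omega>\<rbrakk> \<Longrightarrow> close_at u v x"
    by (rule close_at_if_small_on_layers) blast
  \<comment> \<open>The first bound beats the slope factor \<open>2 ^ (k + 2)\<close> and leaves a
    summable share of \<kappa>; the second is half the tolerance on the layer that guarantees
    closeness at the boundary.\<close>
  define b where "b k = min (\<kappa> * (1/2) ^ (2 * k + 4)) ((1/2) ^ (2 * k + 2) * m k)" for k
  have b: "0 < b k" for k using \<kappa> m by (simp add: b_def)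
  have pow: "(1/2 :: real) ^ (2 * k) = (1/2) ^ k * (1/2) ^ k" for k by (simp add: mult_2 power_add)
  have b_small: "2 * b k \<le> (1/2) ^ k * ((1/2) ^ Suc k * m k)"
    "2 * b k \<le> \<kappa> * (1/2) ^ Suc k" "2 ^ (k + 2) * b k \<le> \<kappa> * (1/2) ^ Suc k" for k
  proof -
    have "b k \<le> (1/2) ^ (2 * k + 2) * m k" by (simp add: b_def)
    then show "2 * b k \<le> (1/2) ^ k * ((1/2) ^ Suc k * m k)" by (simp add: power_add pow)
    have bk: "b k \<le> \<kappa> * (1/2) ^ (2 * k + 4)" by (simp add: b_def)
    have "2 ^ (k + 2) * b k \<le> 2 ^ (k + 2) * (\<kappa> * (1/2) ^ (2 * k + 4))" by (intro mult_left_mono bk) simp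
    also have "\<dots> = \<kappa> * ((2 * (1/2)) ^ k * (1/2) ^ k * (1/4))"
      unfolding power_mult_distrib by (simp add: power_add pow power_one_over[of _ 4])
    also have "\<dots> \<le> \<kappa> * (1/2) ^ Suc k" using \<kappa> by simp
    finally show "2 ^ (k + 2) * b k \<le> \<kappa> * (1/2) ^ Suc k" .
    moreover have "2 * b k \<le> 2 ^ (k + 2) * b k"
      using b[of k] power_increasing[of 1 "k + 2" "2::real"] by (intro mult_right_mono) auto
    ultimately show "2 * b k \<le> \<kappa> * (1/2) ^ Suc k" by linarith
  qed
  \<comment> \<open>On layer \<open>k\<close> the members with indices \<open>k\<close>,
    \<open>k + 1\<close> and \<open>k + 2\<close> interact, so their three errors together have to
    fit into \<open>b k\<close>.\<close>
  obtain \<epsilon> where \<epsilon>: "\<And>k. 0 < \<epsilon> k" "\<And>k. \<epsilon> k + \<epsilon> (k + 1) + \<epsilon> (k + 2) \<le> b k"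
    using ex_consecutive_small[of b, OF b] by metis
  obtain F h where F: "\<And>i. F i \<in> borel_measurable (restrict_space M \<Omega>)"
    and h: "\<And>i. h i \<in> borel_measurable borel"
      "\<And>i. weak_upper_gradient M \<Omega> (\<lambda>x. ereal (F i x)) (h i)"
      "\<And>i. (\<integral>\<^sup>+x\<in>\<Omega>. h i x \<partial>M) \<le> ennreal A"
    and conv: "\<And>k. (\<lambda>i. L1_norm M (core k) (\<lambda>x. ereal (F i x) - u x)) \<longlonglongrightarrow> 0"
    by (rule total_variation_approximants[OF u A]) blast
  obtain s where s: "\<And>k. L1_norm M (core k) (\<lambda>x. ereal (F (s k) x) - u x) \<le> ennreal (\<epsilon> k)"
    "(\<Sum>k. \<integral>\<^sup>+x\<in>wide_layer k. h (s k) x \<partial>M) \<le> 4 * ennreal A + ennreal \<kappa>"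
    by (rule layerwise_selection[of h A "\<lambda>k i. L1_norm M (core k) (\<lambda>x. ereal (F i x) - u x)" \<epsilon> \<kappa>,
      OF h(1,3) conv \<epsilon>(1) \<kappa>]) blast
  define f where "f k = F (s k)" for k
  define g where "g k = h (s k)" for k
  define d where "d k x = e2ennreal \<bar>ereal (f k x) - u x\<bar>" for k x
  have f_meas [measurable]: "f k \<in> borel_measurable (restrict_space M \<Omega>)" for k unfolding f_def by (rule F)
  have g_meas [measurable]: "g k \<in> borel_measurable borel" for k unfolding g_def by (rule h)
  have f_wug: "weak_upper_gradient M \<Omega> (\<lambda>x. ereal (f k x)) (g k)" for k unfolding f_def g_def by (rule h)
  define v where "v = paste f"
  have v_meas: "v \<in> borel_measurable (restrict_space M \<Omega>)"
    using borel_measurable_restrict[OF cutoff_measurable] unfolding v_def paste_def by measurable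
  have d_meas [measurable]: "(\<lambda>x. d j x * indicator (layer k) x) \<in> borel_measurable M" for j k
  proof -
    have "(\<lambda>x. ereal (f j x) - u x) \<in> borel_measurable (restrict_space M \<Omega>)" using u_meas by measurable
    then have "(\<lambda>x. d j x * indicator \<Omega> x) \<in> borel_measurable M"
      unfolding d_def by (rule L1_normI[OF _ domain_sets])
    then show ?thesis 
      using measurable_on_layer[of "d j" UNIV k] sets.top[of M] by (simp add: space_M)
  qed
  \<comment> \<open>The member \<open>f j\<close> is close to \<open>u\<close> on all of
    \<open>core j\<close>, which contains every layer of index at most \<open>j\<close>; this covers
    the members with index above that of the layer.\<close>
  have d_int: "(\<integral>\<^sup>+x\<in>layer k. d j x \<partial>M) \<le> ennreal (\<epsilon> j)" if "k \<le> j" for j k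
  proof -
    have "layer k \<subseteq> core j" using layer_subset_core[of k] incseqD[OF incseq_core that] by blast
    then have "(\<integral>\<^sup>+x\<in>layer k. d j x \<partial>M) \<le> (\<integral>\<^sup>+x\<in>core j. d j x \<partial>M)"
      by (intro nn_integral_mono) (auto simp: indicator_def)
    also have "\<dots> \<le> ennreal (\<epsilon> j)" using s(1)[of j] by (simp add: L1_norm_def d_def f_def)
    finally show ?thesis .
  qed
  have d_sum: "(\<integral>\<^sup>+x\<in>layer k. (d i x + d j x) \<partial>M) \<le> ennreal (\<epsilon> i + \<epsilon> j)" if "k \<le> i" "k \<le> j" for i j k
  proof -
    have "(\<integral>\<^sup>+x\<in>layer k. (d i x + d j x) \<partial>M) = (\<integral>\<^sup>+x\<in>layer k. d i x \<partial>M) + (\<integral>\<^sup>+x\<in>layer k. d j x \<partial>M)"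
      unfolding distrib_right by (rule nn_integral_add) measurable
    also have "\<dots> \<le> ennreal (\<epsilon> i) + ennreal (\<epsilon> j)" by (intro add_mono d_int that)
    finally show ?thesis using \<epsilon>(1)[of i] \<epsilon>(1)[of j] by (simp add: ennreal_plus)
  qed
  have f_diff: "ennreal \<bar>f i x - f j x\<bar> \<le> d i x + d j x" for i j x
    unfolding d_def by (rule e2ennreal_abs_diff_triangle(2))

  \<comment> \<open>The differences are measurable only for the restriction of \<open>M\<close>, so
    Borel majorants are taken for use along arcs; equality almost everywhere lets their integrals be
    estimated by those of the differences.\<close>
  have "\<exists>p. p \<in> borel_measurable borel \<and> (\<forall>x\<in>\<Omega>. ennreal \<bar>f (Suc k) x - f k x\<bar> \<le> p x) \<and>
    (AE x in M. x \<in> \<Omega> \<longrightarrow> p x = ennreal \<bar>f (Suc k) x - f k x\<bar>)" for k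
  proof -
    have "(\<lambda>x. ennreal \<bar>f (Suc k) x - f k x\<bar>) \<in> borel_measurable (restrict_space M \<Omega>)" by measurable
    then show ?thesis by (rule borel_majorant[OF _ domain_sets]) blast
  qed
  then have "\<exists>p. \<forall>k. p k \<in> borel_measurable borel \<and> (\<forall>x\<in>\<Omega>. ennreal \<bar>f (Suc k) x - f k x\<bar> \<le> p k x) \<and>
    (AE x in M. x \<in> \<Omega> \<longrightarrow> p k x = ennreal \<bar>f (Suc k) x - f k x\<bar>)"
    by (intro choice allI)
  then obtain p where p [measurable]: "\<And>k. p k \<in> borel_measurable borel"
    and p_ge: "\<And>k x. x \<in> \<Omega> \<Longrightarrow> ennreal \<bar>f (Suc k) x - f k x\<bar> \<le> p k x"
    and p_eq: "\<And>k. AE x in M. x \<in> \<Omega> \<longrightarrow> p k x = ennreal \<bar>f (Suc k) x - f k x\<bar>"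
    by blast
  have p_int: "(\<integral>\<^sup>+x\<in>layer k. p j x \<partial>M) \<le> ennreal (b k)" if "j \<in> {k, k + 1}" for j k
  proof -
    have "(\<integral>\<^sup>+x\<in>layer k. p j x \<partial>M) = (\<integral>\<^sup>+x\<in>layer k. ennreal \<bar>f (Suc j) x - f j x\<bar> \<partial>M)"
      using p_eq[of j] layer_subset by (intro nn_integral_on_cong_AE) (auto elim!: eventually_mono)
    also have "\<dots> \<le> (\<integral>\<^sup>+x\<in>layer k. (d (Suc j) x + d j x) \<partial>M)"
      by (intro nn_integral_mono mult_right_mono f_diff) simp
    also have "\<dots> \<le> ennreal (\<epsilon> (Suc j) + \<epsilon> j)" using that by (intro d_sum) auto
    also have "\<dots> \<le> ennreal (b k)"
      using that \<epsilon>(1)[of k] \<epsilon>(1)[of "k + 2"] \<epsilon>(2)[of k] by (intro ennreal_leI) auto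
    finally show ?thesis .
  qed

  define G where "G x = (\<Sum>k. paste_gradient g p k x * indicator (layer k) x)" for x
  have pg [measurable]: "paste_gradient g p k \<in> borel_measurable borel" for k
    unfolding paste_gradient_def[abs_def] by measurable
  have G_meas [measurable]: "G \<in> borel_measurable borel" unfolding G_def by measurable
  have G_wug: "weak_upper_gradient M \<Omega> (\<lambda>x. ereal (v x)) G"
    unfolding v_def G_def[abs_def] 
    by (rule paste_weak_upper_gradient[where f = f and g = g and p = p]) (use f_wug g_meas p p_ge in auto)
  define c where "c k = (\<integral>\<^sup>+x\<in>wide_layer k. g k x \<partial>M)" for k
  have c_sum: "(\<Sum>k. c k) \<le> 4 * ennreal A + ennreal \<kappa>" using s(2) by (simp add: c_def g_def)
  have pg_int: "(\<integral>\<^sup>+x\<in>layer k. paste_gradient g p k x \<partial>M)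
    \<le> 2 * (c k + c (k + 1) + c (k + 2)) + ennreal (\<kappa> * (1/2) ^ Suc k)" for k
  proof -
    let ?I = "\<lambda>q. \<integral>\<^sup>+x\<in>layer k. q x \<partial>M"
    have meas: "(\<lambda>x. q x * indicator (layer k) x) \<in> borel_measurable M"
      if "q \<in> borel_measurable borel" for q :: "'a \<Rightarrow> ennreal"
      by (rule borel_measurable_M) (use that in measurable)
    have lin: "?I (\<lambda>x. q x + q' x) = ?I q + ?I q'"
      if "q \<in> borel_measurable borel" "q' \<in> borel_measurable borel" for q q' :: "'a \<Rightarrow> ennreal"
      unfolding distrib_right by (intro nn_integral_add meas that)
    have cm: "?I (\<lambda>x. r * q x) = r * ?I q" if "q \<in> borel_measurable borel" for q :: "'a \<Rightarrow> ennreal" and r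
      unfolding mult.assoc by (intro nn_integral_cmult meas that)
    have I_c: "?I (g j) \<le> c j" if "j \<in> {k, k + 1, k + 2}" for j
      unfolding c_def using layer_subset_wide_layer[of k] that
      by (intro nn_integral_mono) (auto simp: indicator_def)
    have "?I (paste_gradient g p k) = ?I (g k) + (((?I (g (k + 1)) + ?I (g k)) + ennreal (2 ^ k) * ?I (p k))
      + ((?I (g (k + 2)) + ?I (g (k + 1))) + ennreal (2 ^ (k + 1)) * ?I (p (k + 1))))"
      unfolding paste_gradient_def by (simp add: lin cm)
    also have "\<dots> \<le> c k + (((c (k + 1) + c k) + ennreal (2 ^ k) * ennreal (b k))
      + ((c (k + 2) + c (k + 1)) + ennreal (2 ^ (k + 1)) * ennreal (b k)))"
      by (intro add_mono mult_left_mono I_c p_int) auto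
    also have "\<dots> = (2 * c k + 2 * c (k + 1) + c (k + 2)) + ennreal (2 ^ k * b k + 2 ^ (k + 1) * b k)"
    proof -
      have "ennreal (2 ^ k * b k + 2 ^ (k + 1) * b k) = ennreal (2 ^ k) * ennreal (b k) + ennreal (2 ^ (k + 1)) * ennreal (b k)"
        using less_imp_le[OF b[of k]]
        by (simp only: ennreal_plus ennreal_mult zero_le_power zero_le_numeral mult_nonneg_nonneg)
      then show ?thesis unfolding mult_2 by (simp only: ac_simps)
    qed
    also have "\<dots> \<le> (2 * c k + 2 * c (k + 1) + 2 * c (k + 2)) + ennreal (\<kappa> * (1/2) ^ Suc k)"
    proof (intro add_mono ennreal_leI order_refl)
      show "c (k + 2) \<le> 2 * c (k + 2)" by (simp add: mult_2 add_increasing)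
      \<comment> \<open>The two slopes \<open>2 ^ k\<close> and \<open>2 ^ (k + 1)\<close> add up to
        \<open>3 * 2 ^ k\<close>, rounded up to the power of 2 that went into
        \<open>b\<close>.\<close>
      have "2 ^ k * b k + 2 ^ (k + 1) * b k \<le> 2 ^ (k + 2) * b k" using b[of k] by (simp add: algebra_simps)
      then show "2 ^ k * b k + 2 ^ (k + 1) * b k \<le> \<kappa> * (1/2) ^ Suc k" using b_small(3)[of k] by linarith
    qed
    finally show ?thesis by (simp only: distrib_left)
  qed
  have "(\<integral>\<^sup>+x\<in>\<Omega>. G x \<partial>M) \<le> (\<integral>\<^sup>+x. G x \<partial>M)" by (intro nn_integral_mono) (auto simp: indicator_def)
  also have "\<dots> = (\<Sum>k. \<integral>\<^sup>+x\<in>layer k. paste_gradient g p k x \<partial>M)"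
    unfolding G_def by (rule nn_integral_suminf) (intro borel_measurable_M, measurable)
  also have "\<dots> \<le> (\<Sum>k. 2 * (c k + c (k + 1) + c (k + 2)) + ennreal (\<kappa> * (1/2) ^ Suc k))"
    by (intro suminf_le pg_int) auto
  also have "\<dots> = (\<Sum>k. 2 * (c k + c (k + 1) + c (k + 2))) + (\<Sum>k. ennreal (\<kappa> * (1/2) ^ Suc k))"
    by (rule suminf_add[symmetric]) auto
  also have "\<dots> = 2 * ((\<Sum>k. c k) + (\<Sum>k. c (k + 1)) + (\<Sum>k. c (k + 2))) + ennreal \<kappa>"
    unfolding ennreal_suminf_half_power[OF less_imp_le[OF \<kappa>]] ennreal_suminf_cmult
    by (simp only: suminf_add[OF summableI summableI])
  \<comment> \<open>Dropping initial terms does not increase a series in \<open>ennreal\<close>, so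
    each shifted series obeys the bound for the full one.\<close>
  also have "\<dots> \<le> 2 * ((4 * ennreal A + ennreal \<kappa>) + (4 * ennreal A + ennreal \<kappa>) + (4 * ennreal A + ennreal \<kappa>)) + ennreal \<kappa>"
    by (intro add_mono mult_left_mono order_trans[OF ennreal_suminf_shift_le c_sum] c_sum) auto
  also have "\<dots> = ennreal (2 * ((4 * A + \<kappa>) + (4 * A + \<kappa>) + (4 * A + \<kappa>)) + \<kappa>)"
    using less_imp_le[OF \<open>0 < A\<close>] less_imp_le[OF \<kappa>]
    by (simp only: ennreal_plus ennreal_mult ennreal_numeral zero_le_numeral add_nonneg_nonneg mult_nonneg_nonneg)
  also have "\<dots> = ennreal (24 * A + 7 * \<kappa>)" by (simp add: algebra_simps)
  finally have G_int: "(\<integral>\<^sup>+x\<in>\<Omega>. G x \<partial>M) \<le> ennreal (24 * A + 7 * \<kappa>)" .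

  define e where "e x = e2ennreal \<bar>ereal (v x) - u x\<bar>" for x
  have e_int: "(\<integral>\<^sup>+x\<in>layer k. e x \<partial>M) \<le> ennreal (2 * b k)" for k
  proof -
    \<comment> \<open>Comparison with \<open>f k\<close>: cutoffs are at most 1, so the two
      transitions cost at most the two consecutive differences, each of which is measured through
      \<open>u\<close>. In total \<epsilon>\<open>k\<close> and \<epsilon>\<open>(k + 1)\<close> are
      used twice, which fits into \<open>2 * b k\<close>.\<close>
    have e_le: "e x \<le> (d (k + 1) x + d k x) + (d (k + 2) x + d (k + 1) x) + d k x" if x: "x \<in> layer k" for x
    proof -
      have "\<bar>v x - f k x\<bar> \<le> \<bar>cutoff k x * (f (k + 1) x - f k x)\<bar> + \<bar>cutoff (k + 1) x * (f (k + 2) x - f (k + 1) x)\<bar>"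
        unfolding v_def paste_on_layer[OF x] by linarith
      also have "\<dots> \<le> \<bar>f (k + 1) x - f k x\<bar> + \<bar>f (k + 2) x - f (k + 1) x\<bar>"
        unfolding abs_mult using cutoff_bounds by (intro add_mono mult_left_le_one_le) auto
      finally have "ennreal \<bar>v x - f k x\<bar> \<le> ennreal \<bar>f (k + 1) x - f k x\<bar> + ennreal \<bar>f (k + 2) x - f (k + 1) x\<bar>"
        by (simp add: ennreal_leI flip: ennreal_plus)
      also have "\<dots> \<le> (d (k + 1) x + d k x) + (d (k + 2) x + d (k + 1) x)"
        by (intro add_mono f_diff)
      finally show ?thesis
        unfolding e_def d_def[of k] using e2ennreal_abs_diff_triangle(1)[of "v x" "u x" "f k x"]
        by (meson add_right_mono order_trans)
    qed
    have "(\<integral>\<^sup>+x\<in>layer k. e x \<partial>M) \<le> (\<integral>\<^sup>+x. ((d (k + 1) x * indicator (layer k) x + d k x * indicator (layer k) x)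
      + (d (k + 2) x * indicator (layer k) x + d (k + 1) x * indicator (layer k) x)) + d k x * indicator (layer k) x \<partial>M)"
      using e_le by (intro nn_integral_mono) (auto simp: indicator_def)
    also have "\<dots> = (((\<integral>\<^sup>+x\<in>layer k. d (k + 1) x \<partial>M) + (\<integral>\<^sup>+x\<in>layer k. d k x \<partial>M))
      + ((\<integral>\<^sup>+x\<in>layer k. d (k + 2) x \<partial>M) + (\<integral>\<^sup>+x\<in>layer k. d (k + 1) x \<partial>M))) + (\<integral>\<^sup>+x\<in>layer k. d k x \<partial>M)"
      by (simp add: nn_integral_add)
    also have "\<dots> \<le> ((ennreal (\<epsilon> (k + 1)) + ennreal (\<epsilon> k)) + (ennreal (\<epsilon> (k + 2)) + ennreal (\<epsilon> (k + 1)))) + ennreal (\<epsilon> k)"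
      by (intro add_mono d_int) auto
    also have "\<dots> = ennreal (((\<epsilon> (k + 1) + \<epsilon> k) + (\<epsilon> (k + 2) + \<epsilon> (k + 1))) + \<epsilon> k)"
      using less_imp_le[OF \<epsilon>(1)] by (simp only: ennreal_plus add_nonneg_nonneg)
    also have "\<dots> \<le> ennreal (2 * b k)"
      using \<epsilon>(1)[of "k + 2"] \<epsilon>(2)[of k] by (intro ennreal_leI) linarith
    finally show ?thesis .
  qed
  have vu_meas: "(\<lambda>x. ereal (v x) - u x) \<in> borel_measurable (restrict_space M \<Omega>)"
    using v_meas u_meas by measurable
  have e_meas: "(\<lambda>x. e x * indicator \<Omega> x) \<in> borel_measurable M"
    unfolding e_def by (rule L1_normI[OF vu_meas domain_sets])
  have "(\<integral>\<^sup>+x\<in>\<Omega>. e x \<partial>M) \<le> (\<Sum>k. \<integral>\<^sup>+x\<in>layer k. e x \<partial>M)"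
    using nn_integral_le_suminf_layers[OF e_meas, of UNIV] space_M sets.top[of M] by simp
  also have "\<dots> \<le> (\<Sum>k. ennreal (\<kappa> * (1/2) ^ Suc k))"
    by (intro suminf_le order_trans[OF e_int] ennreal_leI b_small) auto
  also have "\<dots> = ennreal \<kappa>" using \<kappa> by (intro ennreal_suminf_half_power) simp
  finally have e_total: "(\<integral>\<^sup>+x\<in>\<Omega>. e x \<partial>M) \<le> ennreal \<kappa>" .
  have "L1_norm M \<Omega> (\<lambda>x. ereal (v x)) \<le> (\<integral>\<^sup>+x. e2ennreal \<bar>u x\<bar> * indicator \<Omega> x + e x * indicator \<Omega> x \<partial>M)"
    unfolding L1_norm_def e_def using e2ennreal_abs_diff_triangle(3)
    by (intro nn_integral_mono) (auto simp: indicator_def simp del: abs_ereal.simps e2ennreal_ereal)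
  also have "\<dots> = L1_norm M \<Omega> u + (\<integral>\<^sup>+x\<in>\<Omega>. e x \<partial>M)"
    unfolding L1_norm_def by (rule nn_integral_add[OF L1_normI[OF u_meas domain_sets] e_meas])
  also have "\<dots> \<le> L1_norm M \<Omega> u + ennreal \<kappa>" by (intro add_left_mono e_total)
  finally have v_L1: "L1_norm M \<Omega> (\<lambda>x. ereal (v x)) \<le> L1_norm M \<Omega> u + ennreal \<kappa>" .
  have "L1_norm M \<Omega> u < \<infinity>" using u by (simp add: L1_def)
  then have "(\<lambda>x. ereal (v x)) \<in> L1 M \<Omega>"
    using v_L1 v_meas by (auto simp: L1_def intro: le_less_trans)
  then have "(\<lambda>x. ereal (v x)) \<in> N11 M \<Omega>"
    unfolding N11_iff[OF domain_sets]
    using G_wug G_meas le_less_trans[OF G_int, of \<infinity>] by (intro conjI bexI[of _ G]) auto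
  moreover have "N11_norm M \<Omega> (\<lambda>x. ereal (v x)) \<le> L1_norm M \<Omega> u + ennreal (24 * A + 8 * \<kappa>)"
  proof -
    have "(INF g \<in> {g. weak_upper_gradient M \<Omega> (\<lambda>x. ereal (v x)) g}. \<integral>\<^sup>+x\<in>\<Omega>. g x \<partial>M) \<le> ennreal (24 * A + 7 * \<kappa>)"
      by (rule INF_lower2[of G]) (simp_all add: G_wug G_int)
    then have "N11_norm M \<Omega> (\<lambda>x. ereal (v x)) \<le> (L1_norm M \<Omega> u + ennreal \<kappa>) + ennreal (24 * A + 7 * \<kappa>)"
      unfolding N11_norm_def by (intro add_mono v_L1)
    also have "\<dots> = L1_norm M \<Omega> u + ennreal (24 * A + 8 * \<kappa>)"
      using \<open>0 < A\<close> \<kappa> by (simp add: add.assoc flip: ennreal_plus)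
    finally show ?thesis .
  qed
  moreover have "close_at (\<lambda>x. ereal (v x)) u x" if "x \<in> frontier \<Omega>" for x
  proof (rule close[OF _ u_meas _ that])
    show "(\<lambda>x. ereal (v x)) \<in> borel_measurable (restrict_space M \<Omega>)" using v_meas by measurable
    show "(\<integral>\<^sup>+y\<in>layer k. e2ennreal \<bar>ereal (v y) - u y\<bar> \<partial>M) \<le> ennreal ((1/2) ^ k * ((1/2) ^ Suc k * m k))" for k
      using order_trans[OF e_int ennreal_leI[OF b_small(1)]] unfolding e_def .
  qed
  ultimately show ?thesis by (rule that)
qed

section \<open>Traces\<close>

lemma close_at_sym: "close_at u v x \<Longrightarrow> close_at v u x"
  unfolding close_at_def by (subst e2ennreal_abs_minus_commute)

text \<open>The common core of transporting traces and of forming linear combinations: a pointwise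
  linear bound almost everywhere passes to averages over the part of the ball in \<Omega>, which are
  then squeezed to 0.\<close>

lemma average_tendsto_0:
  fixes p q s :: "'a \<Rightarrow> ennreal"
  defines "avg \<equiv> \<lambda>f r x. (\<integral>\<^sup>+y\<in>ball x r \<inter> \<Omega>. f y \<partial>M) / emeasure M (ball x r \<inter> \<Omega>)"
  assumes meas: "(\<lambda>y. p y * indicator \<Omega> y) \<in> borel_measurable M" "(\<lambda>y. q y * indicator \<Omega> y) \<in> borel_measurable M"
    and le: "AE y in M. y \<in> \<Omega> \<longrightarrow> s y \<le> ennreal a * p y + ennreal b * q y"
    and p: "((\<lambda>r. avg p r x) \<longlongrightarrow> 0) (at_right 0)" and q: "((\<lambda>r. avg q r x) \<longlongrightarrow> 0) (at_right 0)"
  shows "((\<lambda>r. avg s r x) \<longlongrightarrow> 0) (at_right 0)"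
proof -
  have restrict: "(\<lambda>y. f y * indicator (ball x r \<inter> \<Omega>) y) \<in> borel_measurable M"
    if "(\<lambda>y. f y * indicator \<Omega> y) \<in> borel_measurable M" for f :: "'a \<Rightarrow> ennreal" and r
  proof -
    have "(\<lambda>y. f y * indicator \<Omega> y * indicator (ball x r) y) \<in> borel_measurable M"
      using that by measurable
    also have "(\<lambda>y. f y * indicator \<Omega> y * indicator (ball x r) y) = (\<lambda>y. f y * indicator (ball x r \<inter> \<Omega>) y)"
      by (intro ext) (auto simp: indicator_def)
    finally show ?thesis .
  qed
  have "avg s r x \<le> ennreal a * avg p r x + ennreal b * avg q r x" for r
  proof -
    have "(\<integral>\<^sup>+y\<in>ball x r \<inter> \<Omega>. s y \<partial>M)
      \<le> (\<integral>\<^sup>+y. ennreal a * (p y * indicator (ball x r \<inter> \<Omega>) y) + ennreal b * (q y * indicator (ball x r \<inter> \<Omega>) y) \<partial>M)"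
      using le by (intro nn_integral_mono_AE) (auto elim!: eventually_mono simp: indicator_def)
    also have "\<dots> = ennreal a * (\<integral>\<^sup>+y\<in>ball x r \<inter> \<Omega>. p y \<partial>M) + ennreal b * (\<integral>\<^sup>+y\<in>ball x r \<inter> \<Omega>. q y \<partial>M)"
      using restrict[OF meas(1)] restrict[OF meas(2)] by (subst nn_integral_add) (auto simp: nn_integral_cmult)
    finally show ?thesis
      unfolding avg_def ennreal_times_divide add_divide_distrib_ennreal[symmetric] by (rule divide_right_mono_ennreal)
  qed
  then have upper: "\<forall>\<^sub>F r in at_right 0. avg s r x \<le> ennreal a * avg p r x + ennreal b * avg q r x"
    by (intro always_eventually allI)
  have "((\<lambda>r. ennreal a * avg p r x + ennreal b * avg q r x) \<longlongrightarrow> ennreal a * 0 + ennreal b * 0) (at_right 0)"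
    using p q by (intro tendsto_add ennreal_tendsto_cmult) auto
  then have lim: "((\<lambda>r. ennreal a * avg p r x + ennreal b * avg q r x) \<longlongrightarrow> 0) (at_right 0)" by simp
  show ?thesis by (rule tendsto_sandwich[OF _ upper tendsto_const lim]) simp
qed

lemma is_trace_at_if_close:
  assumes close: "close_at v u x" and meas: "u \<in> borel_measurable (restrict_space M \<Omega>)" "v \<in> borel_measurable (restrict_space M \<Omega>)"
    and t: "is_trace_at M \<Omega> u x t"
  shows "is_trace_at M \<Omega> v x t"
  unfolding is_trace_at_def
proof (rule average_tendsto_0[OF _ _ _ close[unfolded close_at_def] t[unfolded is_trace_at_def]])
  have "e2ennreal \<bar>v y - ereal t\<bar> \<le> e2ennreal \<bar>v y - u y\<bar> + e2ennreal \<bar>u y - ereal t\<bar>" for y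
    by (cases "v y"; cases "u y") (auto simp flip: ennreal_plus intro!: ennreal_leI)
  then show "AE y in M. y \<in> \<Omega> \<longrightarrow> e2ennreal \<bar>v y - ereal t\<bar>
      \<le> ennreal 1 * e2ennreal \<bar>v y - u y\<bar> + ennreal 1 * e2ennreal \<bar>u y - ereal t\<bar>" by simp
  have "(\<lambda>y. v y - u y) \<in> borel_measurable (restrict_space M \<Omega>)"
    "(\<lambda>y. u y - ereal t) \<in> borel_measurable (restrict_space M \<Omega>)" using meas by measurable
  then show "(\<lambda>y. e2ennreal \<bar>v y - u y\<bar> * indicator \<Omega> y) \<in> borel_measurable M"
    "(\<lambda>y. e2ennreal \<bar>u y - ereal t\<bar> * indicator \<Omega> y) \<in> borel_measurable M"
    using domain_sets by (auto intro!: L1_normI)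
qed

lemma is_trace_at_close_iff:
  assumes "close_at v u x" "u \<in> borel_measurable (restrict_space M \<Omega>)" "v \<in> borel_measurable (restrict_space M \<Omega>)"
  shows "is_trace_at M \<Omega> v x t \<longleftrightarrow> is_trace_at M \<Omega> u x t"
  using is_trace_at_if_close[of v u x t] is_trace_at_if_close[of u v x t] close_at_sym[of v u x] assms by blast

text \<open>The predicates inside the definite description agree for every \<open>t\<close>, so the
  two terms are equal even at points where no trace exists; uniqueness of the trace is not
  involved.\<close>

lemma boundary_trace_close:
  assumes "close_at v u x" "u \<in> borel_measurable (restrict_space M \<Omega>)" "v \<in> borel_measurable (restrict_space M \<Omega>)"
  shows "boundary_trace M \<Omega> v x = boundary_trace M \<Omega> u x"
  unfolding boundary_trace_def is_trace_at_close_iff[OF assms] ..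

text \<open>All four functions are finite almost everywhere, so there the extended arithmetic is
  that of the reals and the triangle inequality applies.\<close>

lemma close_at_linear_combination:
  assumes close: "close_at v v' x" "close_at w w' x"
    and L1: "v \<in> L1 M \<Omega>" "v' \<in> L1 M \<Omega>" "w \<in> L1 M \<Omega>" "w' \<in> L1 M \<Omega>"
  shows "close_at (\<lambda>y. ereal a * v y + ereal b * w y) (\<lambda>y. ereal a * v' y + ereal b * w' y) x"
  unfolding close_at_def
proof (rule average_tendsto_0[OF _ _ _ close[unfolded close_at_def]])
  show "AE y in M. y \<in> \<Omega> \<longrightarrow> e2ennreal \<bar>(ereal a * v y + ereal b * w y) - (ereal a * v' y + ereal b * w' y)\<bar>
      \<le> ennreal \<bar>a\<bar> * e2ennreal \<bar>v y - v' y\<bar> + ennreal \<bar>b\<bar> * e2ennreal \<bar>w y - w' y\<bar>"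
    using L1[THEN L1_AE_finite[OF _ domain_sets]]
  proof eventually_elim
    case (elim y)
    show ?case
    proof
      assume "y \<in> \<Omega>"
      with elim obtain r r' z z' where *: "v y = ereal r" "v' y = ereal r'" "w y = ereal z" "w' y = ereal z'"
        by (metis ereal_real)
      have "\<bar>(a * r + b * z) - (a * r' + b * z')\<bar> = \<bar>a * (r - r') + b * (z - z')\<bar>"
        by (simp add: algebra_simps)
      also have "\<dots> \<le> \<bar>a\<bar> * \<bar>r - r'\<bar> + \<bar>b\<bar> * \<bar>z - z'\<bar>"
        by (intro order_trans[OF abs_triangle_ineq]) (simp add: abs_mult)
      finally show "e2ennreal \<bar>(ereal a * v y + ereal b * w y) - (ereal a * v' y + ereal b * w' y)\<bar>
          \<le> ennreal \<bar>a\<bar> * e2ennreal \<bar>v y - v' y\<bar> + ennreal \<bar>b\<bar> * e2ennreal \<bar>w y - w' y\<bar>"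
        unfolding * by (simp add: ennreal_leI flip: ennreal_plus ennreal_mult)
    qed
  qed
  show "(\<lambda>y. e2ennreal \<bar>v y - v' y\<bar> * indicator \<Omega> y) \<in> borel_measurable M"
    "(\<lambda>y. e2ennreal \<bar>w y - w' y\<bar> * indicator \<Omega> y) \<in> borel_measurable M"
    using L1 domain_sets by (auto intro!: L1_normI simp: L1_def)
qed

end

lemma hausdorff_aeI:
  assumes "\<And>x. x \<in> S \<Longrightarrow> P x" shows "hausdorff_ae M S P"
proof -
  have "codim1_content M R {} = 0" for R
  proof -
    have "codim1_content M R {} \<le> 0"
      unfolding codim1_content_def by (rule INF_lower2[of "({}, undefined, undefined)"]) auto
    then show ?thesis by simp
  qed
  then have "codim1_hausdorff M {} = 0"
    unfolding codim1_hausdorff_def by (simp add: tendsto_Lim)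
  moreover have "{x \<in> S. \<not> P x} = {}" using assms by blast
  ultimately show ?thesis by (simp only: hausdorff_ae_def)
qed

lemma hausdorff_ae_cong:
  assumes "\<And>x. x \<in> S \<Longrightarrow> P x \<longleftrightarrow> Q x" shows "hausdorff_ae M S P \<longleftrightarrow> hausdorff_ae M S Q"
proof -
  have "{x \<in> S. \<not> P x} = {x \<in> S. \<not> Q x}" using assms by blast
  then show ?thesis by (simp add: hausdorff_ae_def)
qed

section \<open>Transfer of the trace space property between the two spaces\<close>

context exhausted_domain
begin

lemma BV_N11_same_trace:
  assumes u: "u \<in> BV M \<Omega>" and \<kappa>: "0 < \<kappa>"
  obtains v where "v \<in> N11 M \<Omega>" "N11_norm M \<Omega> v \<le> 24 * BV_norm M \<Omega> u + ennreal \<kappa>"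
    "\<And>x. x \<in> frontier \<Omega> \<Longrightarrow> close_at v u x"
proof -
  have uL1: "u \<in> L1 M \<Omega>" and fin: "total_variation M \<Omega> u < \<infinity>" using u by (auto simp: BV_def)
  obtain V where V: "0 \<le> V" "total_variation M \<Omega> u = ennreal V"
    using fin by (cases "total_variation M \<Omega> u") auto
  \<comment> \<open>With slack \<kappa>\<open>/32\<close> in both parameters the additive errors
    \<open>24 *\<close> and \<open>8 *\<close> this slack sum to exactly \<kappa>. The slack also
    makes the inequality strict.\<close>
  have "total_variation M \<Omega> u < ennreal (V + \<kappa> / 32)"
    using V \<kappa> by (simp add: ennreal_less_iff)
  then obtain v :: "'a \<Rightarrow> real" where v: "(\<lambda>x. ereal (v x)) \<in> N11 M \<Omega>"
    "N11_norm M \<Omega> (\<lambda>x. ereal (v x)) \<le> L1_norm M \<Omega> u + ennreal (24 * (V + \<kappa> / 32) + 8 * (\<kappa> / 32))"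
    "\<And>x. x \<in> frontier \<Omega> \<Longrightarrow> close_at (\<lambda>x. ereal (v x)) u x"
    using BV_N11_approximation[OF uL1, of "V + \<kappa> / 32" "\<kappa> / 32"] \<kappa> by auto
  have "N11_norm M \<Omega> (\<lambda>x. ereal (v x)) \<le> L1_norm M \<Omega> u + ennreal (24 * V + \<kappa>)"
    using v(2) by (simp add: algebra_simps)
  also have "\<dots> = L1_norm M \<Omega> u + (24 * total_variation M \<Omega> u + ennreal \<kappa>)"
    using V \<kappa> by (simp add: ennreal_plus ennreal_mult)
  also have "\<dots> \<le> 24 * L1_norm M \<Omega> u + (24 * total_variation M \<Omega> u + ennreal \<kappa>)"
    using mult_right_mono[of 1 "24::ennreal" "L1_norm M \<Omega> u"] by (intro add_right_mono) simp
  also have "\<dots> = 24 * BV_norm M \<Omega> u + ennreal \<kappa>"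
    by (simp add: BV_norm_def distrib_left add.assoc)
  finally show ?thesis using that v by blast
qed

lemma BV_measurable: "u \<in> BV M \<Omega> \<Longrightarrow> u \<in> borel_measurable (restrict_space M \<Omega>)"
  by (simp add: BV_def L1_def)

text \<open>Existence, range, linearity and boundedness are inherited through the norm-decreasing
  inclusion of \<open>N11\<close> in \<open>BV\<close>. Surjectivity alone calls for the companion:
  it has the trace of a given preimage in \<open>BV\<close>.\<close>

lemma trace_space_BV_imp_N11:
  assumes "is_trace_space M \<Omega> (BV M \<Omega>) (BV_norm M \<Omega>) Z nZ"
  shows "is_trace_space M \<Omega> (N11 M \<Omega>) (N11_norm M \<Omega>) Z nZ"
proof -
  note BV = assms[unfolded is_trace_space_def]
  obtain C where C: "0 \<le> C"
    "\<And>u. u \<in> BV M \<Omega> \<Longrightarrow> ennreal (nZ (boundary_trace M \<Omega> u)) \<le> ennreal C * BV_norm M \<Omega> u"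
    using BV by blast
  have bound: "ennreal (nZ (boundary_trace M \<Omega> u)) \<le> ennreal C * N11_norm M \<Omega> u" if "u \<in> N11 M \<Omega>" for u
    using C(2)[OF N11_BV(1)[OF that]] mult_left_mono[OF N11_BV(2)[OF that], of "ennreal C"] by simp
  have surj: "\<exists>v\<in>N11 M \<Omega>. hausdorff_ae M (frontier \<Omega>) (\<lambda>x. boundary_trace M \<Omega> v x = f x)" if f: "f \<in> Z" for f
  proof -
    obtain u where u: "u \<in> BV M \<Omega>" "hausdorff_ae M (frontier \<Omega>) (\<lambda>x. boundary_trace M \<Omega> u x = f x)"
      using BV f by blast
    obtain v where v: "v \<in> N11 M \<Omega>" "\<And>x. x \<in> frontier \<Omega> \<Longrightarrow> close_at v u x"
      using BV_N11_same_trace[OF u(1) zero_less_one] by metis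
    have "boundary_trace M \<Omega> v x = boundary_trace M \<Omega> u x" if "x \<in> frontier \<Omega>" for x
      using v that u(1) N11_BV(1) by (intro boundary_trace_close BV_measurable) auto
    then have "hausdorff_ae M (frontier \<Omega>) (\<lambda>x. boundary_trace M \<Omega> v x = f x)"
      using u(2) by (subst hausdorff_ae_cong[where Q = "\<lambda>x. boundary_trace M \<Omega> u x = f x"]) auto
    then show ?thesis using v(1) by blast
  qed
  show ?thesis
    unfolding is_trace_space_def
    using BV N11_BV(1) bound surj C(1) by blast
qed

text \<open>Surjectivity is inherited by the larger space, and every other property of the trace of
  \<open>u\<close> is read off from a companion. For linearity the companions of the two functions
  are combined, as closeness respects linear combinations.\<close>

lemma trace_space_N11_imp_BV:
  assumes "is_trace_space M \<Omega> (N11 M \<Omega>) (N11_norm M \<Omega>) Z nZ"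
  shows "is_trace_space M \<Omega> (BV M \<Omega>) (BV_norm M \<Omega>) Z nZ"
proof -
  have Z: "banach_function_space M (frontier \<Omega>) Z nZ"
    and has: "\<And>v. v \<in> N11 M \<Omega> \<Longrightarrow> has_trace M \<Omega> v"
    and range: "\<And>v. v \<in> N11 M \<Omega> \<Longrightarrow> boundary_trace M \<Omega> v \<in> Z"
    and lin: "\<And>v w a b. v \<in> N11 M \<Omega> \<Longrightarrow> w \<in> N11 M \<Omega> \<Longrightarrow> hausdorff_ae M (frontier \<Omega>)
        (\<lambda>x. boundary_trace M \<Omega> (\<lambda>y. ereal a * v y + ereal b * w y) x
              = a * boundary_trace M \<Omega> v x + b * boundary_trace M \<Omega> w x)"
    and surj: "\<And>f. f \<in> Z \<Longrightarrow> \<exists>v\<in>N11 M \<Omega>. hausdorff_ae M (frontier \<Omega>) (\<lambda>x. boundary_trace M \<Omega> v x = f x)"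
    using assms unfolding is_trace_space_def by blast+
  obtain C where C: "0 \<le> C"
    "\<And>v. v \<in> N11 M \<Omega> \<Longrightarrow> ennreal (nZ (boundary_trace M \<Omega> v)) \<le> ennreal C * N11_norm M \<Omega> v"
    using assms unfolding is_trace_space_def by blast
  \<comment> \<open>The traces of \<open>u\<close> and of its companion agree on the boundary but
    are total functions that may differ elsewhere; saturation of \<open>Z\<close> identifies them
    together with their norms.\<close>
  have saturated: "g \<in> Z \<and> nZ g = nZ f" if "f \<in> Z" "\<And>x. x \<in> frontier \<Omega> \<Longrightarrow> f x = g x" for f g
  proof -
    have "hausdorff_ae M (frontier \<Omega>) (\<lambda>x. f x = g x)" by (rule hausdorff_aeI) (rule that(2))
    then show ?thesis using Z that(1) unfolding banach_function_space_def by blast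
  qed
  have trace_eq: "boundary_trace M \<Omega> v x = boundary_trace M \<Omega> u x"
    if "u \<in> BV M \<Omega>" "v \<in> N11 M \<Omega>" "close_at v u x" for u v x
    using that N11_BV(1) by (intro boundary_trace_close BV_measurable) auto
  have L1: "u \<in> L1 M \<Omega>" if "u \<in> BV M \<Omega>" for u using that by (simp add: BV_def)
  have u_has: "has_trace M \<Omega> u" if u: "u \<in> BV M \<Omega>" for u
  proof -
    obtain v where v: "v \<in> N11 M \<Omega>" "\<And>x. x \<in> frontier \<Omega> \<Longrightarrow> close_at v u x"
      using BV_N11_same_trace[OF u zero_less_one] by metis
    have "(\<exists>t. is_trace_at M \<Omega> v x t) \<longleftrightarrow> (\<exists>t. is_trace_at M \<Omega> u x t)" if "x \<in> frontier \<Omega>" for x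
      using is_trace_at_close_iff[OF v(2)[OF that] BV_measurable[OF u] BV_measurable[OF N11_BV(1)[OF v(1)]]] by simp
    then have "hausdorff_ae M (frontier \<Omega>) (\<lambda>x. \<exists>t. is_trace_at M \<Omega> u x t)"
      using has[OF v(1)] unfolding has_trace_def
      by (subst (asm) hausdorff_ae_cong[where Q = "\<lambda>x. \<exists>t. is_trace_at M \<Omega> u x t"]) auto
    then show ?thesis using BV_measurable[OF u] by (simp add: has_trace_def)
  qed
  have u_range: "boundary_trace M \<Omega> u \<in> Z" if u: "u \<in> BV M \<Omega>" for u
  proof -
    obtain v where v: "v \<in> N11 M \<Omega>" "\<And>x. x \<in> frontier \<Omega> \<Longrightarrow> close_at v u x"
      using BV_N11_same_trace[OF u zero_less_one] by metis
    show ?thesis using saturated[OF range[OF v(1)]] trace_eq[OF u v(1) v(2)] by blast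
  qed
  have u_lin: "hausdorff_ae M (frontier \<Omega>)
        (\<lambda>x. boundary_trace M \<Omega> (\<lambda>y. ereal a * u y + ereal b * u' y) x
              = a * boundary_trace M \<Omega> u x + b * boundary_trace M \<Omega> u' x)"
    if u: "u \<in> BV M \<Omega>" "u' \<in> BV M \<Omega>" for u u' a b
  proof -
    obtain v where v: "v \<in> N11 M \<Omega>" "\<And>x. x \<in> frontier \<Omega> \<Longrightarrow> close_at v u x"
      using BV_N11_same_trace[OF u(1) zero_less_one] by metis
    obtain v' where v': "v' \<in> N11 M \<Omega>" "\<And>x. x \<in> frontier \<Omega> \<Longrightarrow> close_at v' u' x"
      using BV_N11_same_trace[OF u(2) zero_less_one] by metis
    have meas: "(\<lambda>y. ereal a * w y + ereal b * w' y) \<in> borel_measurable (restrict_space M \<Omega>)"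
      if "w \<in> BV M \<Omega>" "w' \<in> BV M \<Omega>" for w w'
      using BV_measurable[OF that(1)] BV_measurable[OF that(2)] by measurable
    have "boundary_trace M \<Omega> (\<lambda>y. ereal a * v y + ereal b * v' y) x
      = boundary_trace M \<Omega> (\<lambda>y. ereal a * u y + ereal b * u' y) x" if "x \<in> frontier \<Omega>" for x
      using v v' u that L1 N11_BV(1)
      by (intro boundary_trace_close close_at_linear_combination meas) auto
    then show ?thesis
      using lin[OF v(1) v'(1), of a b] trace_eq[OF u(1) v(1) v(2)] trace_eq[OF u(2) v'(1) v'(2)]
      by (subst (asm) hausdorff_ae_cong) auto
  qed
  have u_bound: "ennreal (nZ (boundary_trace M \<Omega> u)) \<le> ennreal (C * 24) * BV_norm M \<Omega> u" if u: "u \<in> BV M \<Omega>" for u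
  proof (rule ennreal_le_epsilon)
    fix e :: real assume e: "0 < e"
    \<comment> \<open>The companion depends on the additive error \<kappa>, but its trace does not,
      so letting \<open>e\<close> tend to 0 leaves the constant \<open>24 * C\<close>. Adding 1
      covers \<open>C = 0\<close>.\<close>
    define \<kappa> where "\<kappa> = e / (C + 1)"
    have \<kappa>: "0 < \<kappa>" "C * \<kappa> \<le> e" using e C(1) by (auto simp: \<kappa>_def field_simps)
    obtain v where v: "v \<in> N11 M \<Omega>" "N11_norm M \<Omega> v \<le> 24 * BV_norm M \<Omega> u + ennreal \<kappa>"
      "\<And>x. x \<in> frontier \<Omega> \<Longrightarrow> close_at v u x"
      by (rule BV_N11_same_trace[OF u \<kappa>(1)]) blast
    have "nZ (boundary_trace M \<Omega> u) = nZ (boundary_trace M \<Omega> v)"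
      using saturated[OF range[OF v(1)]] trace_eq[OF u v(1) v(3)] by blast
    then have "ennreal (nZ (boundary_trace M \<Omega> u)) \<le> ennreal C * N11_norm M \<Omega> v" using C(2)[OF v(1)] by simp
    also have "\<dots> \<le> ennreal C * (24 * BV_norm M \<Omega> u + ennreal \<kappa>)" by (intro mult_left_mono v(2)) simp
    also have "\<dots> = ennreal (C * 24) * BV_norm M \<Omega> u + ennreal (C * \<kappa>)"
      using C(1) \<kappa>(1) by (simp add: distrib_left ennreal_mult mult.assoc)
    also have "\<dots> \<le> ennreal (C * 24) * BV_norm M \<Omega> u + ennreal e" by (intro add_left_mono ennreal_leI \<kappa>(2))
    finally show "ennreal (nZ (boundary_trace M \<Omega> u)) \<le> ennreal (C * 24) * BV_norm M \<Omega> u + ennreal e" .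
  qed
  have "\<exists>C\<ge>0. \<forall>u\<in>BV M \<Omega>. ennreal (nZ (boundary_trace M \<Omega> u)) \<le> ennreal C * BV_norm M \<Omega> u"
    using u_bound C(1) by (intro exI[of _ "C * 24"]) auto
  moreover have "\<forall>f\<in>Z. \<exists>u\<in>BV M \<Omega>. hausdorff_ae M (frontier \<Omega>) (\<lambda>x. boundary_trace M \<Omega> u x = f x)"
    using surj N11_BV(1) by blast
  ultimately show ?thesis
    unfolding is_trace_space_def using Z u_has u_range u_lin by blast
qed

end

theorem corollary1p5:
  fixes \<mu> :: "'a::complete_space set \<Rightarrow> ennreal"
    and \<Omega> :: "'a set"
    and Z :: "('a \<Rightarrow> real) set" and nZ :: "('a \<Rightarrow> real) \<Rightarrow> real"
  assumes "borel_regular_outer_measure \<mu>"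
    and "doubling (caratheodory \<mu>)"
    and "poincare_1_1 (caratheodory \<mu>)"
    and "open \<Omega>" and "\<Omega> \<noteq> {}"
    and "banach_function_space (caratheodory \<mu>) (frontier \<Omega>) Z nZ"
  shows "is_trace_space (caratheodory \<mu>) \<Omega>
           (BV (caratheodory \<mu>) \<Omega>) (BV_norm (caratheodory \<mu>) \<Omega>) Z nZ \<longleftrightarrow>
         is_trace_space (caratheodory \<mu>) \<Omega>
           (N11 (caratheodory \<mu>) \<Omega>) (N11_norm (caratheodory \<mu>) \<Omega>) Z nZ"
proof -
  interpret metric_measure "caratheodory \<mu>"
    by (rule metric_measure_caratheodory[OF assms(1,2)])
  obtain \<theta> :: "'a \<Rightarrow> real" where \<theta>: "\<And>x y. \<bar>\<theta> x - \<theta> y\<bar> \<le> dist x y" "\<And>x. 0 \<le> \<theta> x" "\<And>x. \<theta> x \<le> 1"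
    "\<And>x. x \<in> \<Omega> \<longleftrightarrow> 0 < \<theta> x" "\<And>e. 0 < e \<Longrightarrow> compact {x. e \<le> \<theta> x}"
    using exhaustion_function[OF assms(4)] by metis
  interpret exhausted_domain "caratheodory \<mu>" \<Omega> \<theta>
    by unfold_locales (use \<theta> in auto)
  show ?thesis using trace_space_BV_imp_N11 trace_space_N11_imp_BV by blast
qed

end
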